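(* Let $\Phi=B_n$ or $D_n$, let $D=\{\beta_1,\dots,\beta_t\}\subset\Phi^+$ ($t\ge1$, $\mathrm{col}(\beta_1)<\dots<\mathrm{col}(\beta_t)$) be an orthogonal rook placement, let $\xi=(\xi_\beta)_{\beta\in D}$ be a tuple of non-zero elements of $\mathbb{F}_q$, let $\Omega=\Omega_{D,\xi}$ be the associated coadjoint orbit, and let $\chi=\chi_\Omega$ be the corresponding irreducible character of $U$. With $U_1$, $V'$, $\widetilde U$, $\psi$, $\widetilde\chi$ and the projections defined in the context, put $\pi^{U_1\rtimes V'}_{\widetilde U}=\pi^{V'}_{\widetilde U}\circ\pi^{U_1\rtimes V'}_{V'}$. Then $$\chi=\mathrm{Ind}_{U_1\rtimes V'}^{U}\bigl((\psi\circ\pi^{U_1\rtimes V'}_{U_1})\cdot(\widetilde\chi\circ\pi^{U_1\rtimes V'}_{\widetilde U})\bigr).$$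
   Context: Root systems. Let $\epsilon_1,\dots,\epsilon_n$ be the standard basis of $\mathbb{R}^n$. $B_n=\{\pm\epsilon_i\pm\epsilon_j,\ i<j\}\cup\{\pm\epsilon_i\}$, $D_n=\{\pm\epsilon_i\pm\epsilon_j,\ i<j\}$; the positive roots are $B_n^+=\{\epsilon_i\pm\epsilon_j,\ 1\le i<j\le n\}\cup\{\epsilon_i,\ 1\le i\le n\}$ and $D_n^+=\{\epsilon_i\pm\epsilon_j,\ 1\le i<j\le n\}$ ($B_0$, $D_0$, $D_1$ are empty). For positive roots put $\mathrm{col}(\epsilon_i\pm\epsilon_j)=\mathrm{col}(\epsilon_i)=i$, $\mathrm{row}(\epsilon_i\pm\epsilon_j)=\mp j$ (for $i<j$), $\mathrm{row}(\epsilon_i)=0$. Let $R_i=\{\alpha\in\Phi^+\mid\mathrm{row}(\alpha)=i\}$ for $-n+1\le i\le n-1$ and $C_j=\{\alpha\in\Phi^+\mid\mathrm{col}(\alpha)=j\}$ for $1\le j\le n$. Lie algebra and group. Let $m=2n+1$ for $\Phi=B_n$ and $m=2n$ for $\Phi=D_n$; $\mathbb{F}_q$ is a finite field of characteristic $p\ge m$. Rows and columns of $m\times m$ matrices are indexed by $1,2,\dots,n,0,-n,\dots,-2,-1$ in this order (no index $0$ for $D_n$), and $e_{a,b}$ are the elementary matrices. Put $e_{\epsilon_i}=e_{0,i}-e_{-i,0}$, $e_{\epsilon_i-\epsilon_j}=e_{j,i}-e_{-i,-j}$, $e_{\epsilon_i+\epsilon_j}=e_{-j,i}-e_{-i,j}$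 ($i<j$). Then $\mathfrak{u}=\mathfrak{u}(\Phi)\subset\mathfrak{gl}_m(\mathbb{F}_q)$ is the Lie subalgebra with basis $e_\alpha$, $\alpha\in\Phi^+$; $e_\alpha^*$ denotes the dual basis of $\mathfrak{u}^*$. $U=\exp(\mathfrak{u})$ where $\exp(x)=\sum_{i=0}^{m-1}x^i/i!$, a bijection $\mathfrak{u}\to U$ with inverse $\ln$. The group $U$ acts on $\mathfrak{u}$ by conjugation and on $\mathfrak{u}^*$ by the dual (coadjoint) action $(g.\lambda)(x)=\lambda(g^{-1}xg)$. Orthogonal rook placement: a subset $D\subset\Phi^+$ of pairwise orthogonal roots with $|D\cap R_i|\le1$ and $|D\cap C_j|\le1$ for all $i,j$. The associated orbit $\Omega_{D,\xi}$ is the coadjoint orbit of $f=f_{D,\xi}=\sum_{\beta\in D}\xi_\beta e_\beta^*$. Characters. Fix a nontrivial homomorphism $\theta$ from the additive group of $\mathbb{F}_q$ to $\mathbb{C}^\times$. For a coadjoint orbit $\Omega$ the corresponding irreducible character of $U$ (Kirillov orbit method) is $\chi_\Omega(g)=|\Omega|^{-1/2}\sum_{\lambda\in\Omega}\theta(\lambda(\ln g))$. Singular roots. For $\beta\in\Phi^+$, $S(\beta)$ is the set of all $\alpha\in\Phi^+$ for which there is $\gamma\in\Phi^+$ with $\alpha+\gamma=\beta$; $S^-(\beta)=\{\alpha\in S(\beta)\mid\mathrm{col}(\alpha)\ne\mathrm{col}(\beta)\}$. Subgroups. Let $\mathfrak{u}_1=\bigoplus_{\alpha\in C_1}\mathbb{F}_qe_\alpha$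 and $U_1=\exp(\mathfrak{u}_1)$ (an abelian normal subgroup of $U$). Put $\Phi_1^+=\Phi^+\setminus C_1$ if $\mathrm{col}(\beta_1)>1$ and $\Phi_1^+=\Phi^+\setminus(C_1\cup S^-(\beta_1))$ if $\mathrm{col}(\beta_1)=1$. Put $\Phi_2^+=\Phi_1^+\setminus S^-(\epsilon_1\pm\epsilon_i)$ if $\beta_1=\epsilon_1\mp\epsilon_i$ with $2\le i\le n$ (opposite signs), and $\Phi_2^+=\Phi_1^+$ otherwise. Let $\mathfrak{v}'=\bigoplus_{\alpha\in\Phi_1^+}\mathbb{F}_qe_\alpha$, $\mathfrak{v}_1=\bigoplus_{\alpha\in\Phi_1^+\setminus\Phi_2^+}\mathbb{F}_qe_\alpha$, $\widetilde{\mathfrak{u}}=\bigoplus_{\alpha\in\Phi_2^+}\mathbb{F}_qe_\alpha$, and $V'=\exp(\mathfrak{v}')$, $V_1=\exp(\mathfrak{v}_1)$, $\widetilde U=\exp(\widetilde{\mathfrak{u}})$. One has $V'=V_1\rtimes\widetilde U$ with $V_1$ abelian and normal in $V'$, and $U_1V'=U_1\rtimes V'$. For a semidirect product $\mathcal{G}=A\rtimes B$ ($A$ normal), each $g\in\mathcal{G}$ is uniquely $g=ab$ with $a\in A$, $b\in B$; $\pi^{\mathcal{G}}_A(g)=a$, $\pi^{\mathcal{G}}_B(g)=b$. The character $\psi$ of $U_1$ is $\psi(x)=\theta(f(\ln x))$, $x\in U_1$. Smaller root system. $\widetilde\Phi=B_{n-1}$ (resp. $D_{n-1}$) if $\Phi=B_n$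 (resp. $D_n$) and $\mathrm{col}(\beta_1)>1$; $\widetilde\Phi=D_{n-2}$ if $\Phi=D_n$ and $\mathrm{col}(\beta_1)=1$; $\widetilde\Phi=B_{n-2}$ if $\Phi=B_n$, $\mathrm{col}(\beta_1)=1$, $\mathrm{row}(\beta_1)\ne0$; $\widetilde\Phi=D_{n-1}$ if $\Phi=B_n$ and $\beta_1=\epsilon_1$. Let $I=\{2,\dots,n\}\setminus\{i\}$ if $\beta_1=\epsilon_1\pm\epsilon_i$, and $I=\{2,\dots,n\}$ otherwise; let $\kappa\colon I\to\{1,\dots,|I|\}$ be the increasing bijection. The bijection $\pi\colon\Phi_2^+\to\widetilde\Phi^+$ is $\pi(\epsilon_a\pm\epsilon_b)=\epsilon_{\kappa(a)}\pm\epsilon_{\kappa(b)}$, $\pi(\epsilon_a)=\epsilon_{\kappa(a)}$; $e_\alpha\mapsto e_{\pi(\alpha)}$ defines a Lie algebra isomorphism $\widetilde{\mathfrak{u}}\to\mathfrak{u}(\widetilde\Phi)$, also denoted $\pi$. Put $\widetilde D=\pi(D\setminus C_1)$, an orthogonal rook placement in $\widetilde\Phi^+$, and $\widetilde\xi_{\pi(\beta)}=\xi_\beta$ for $\beta\in D\setminus C_1$. Let $\widetilde\Omega=\Omega_{\widetilde D,\widetilde\xi}\subset\mathfrak{u}(\widetilde\Phi)^*$ be the associated orbit; $\widetilde\chi$ is the corresponding irreducible character of $\widetilde U$, via the isomorphism $\pi$: $\widetilde\chi(g)=|\widetilde\Omega|^{-1/2}\sum_{\lambda\in\widetilde\Omega}\theta(\lambda(\pi(\ln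 g)))$, $g\in\widetilde U$ (if $\widetilde D=\varnothing$ then $\widetilde\Omega=\{0\}$ and $\widetilde\chi=1$). *)

theory Defs
  imports
    Complex_Main
    "HOL-Algebra.Group_Action"
    "HOL-Computational_Algebra.Computational_Algebra"
    "HOL-Library.FuncSet"
    "Jordan_Normal_Form.Matrix"
begin

section \<open>Root systems of types B and D\<close>

datatype root_system = TypeB nat | TypeD nat

fun rank :: "root_system \<Rightarrow> nat" where
  "rank (TypeB n) = n"
| "rank (TypeD n) = n"

text \<open>Names for the positive roots: \<open>Eps i\<close> is $\epsilon_i$, \<open>EpsMinus i j\<close> is
  $\epsilon_i - \epsilon_j$, \<open>EpsPlus i j\<close> is $\epsilon_i + \epsilon_j$.  Everything that concerns
  roots as vectors (orthogonality, sums of roots) goes through \<open>root_vec\<close>.\<close>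

datatype root = Eps nat | EpsMinus nat nat | EpsPlus nat nat

text \<open>Vectors are indexed from 0 in the library, the standard basis from 1 here.\<close>

definition eps :: "nat \<Rightarrow> nat \<Rightarrow> real vec" where
  "eps n i = unit_vec n (i - 1)"

fun root_vec :: "nat \<Rightarrow> root \<Rightarrow> real vec" where
  "root_vec n (Eps i) = eps n i"
| "root_vec n (EpsMinus i j) = eps n i - eps n j"
| "root_vec n (EpsPlus i j) = eps n i + eps n j"

fun pos_roots :: "root_system \<Rightarrow> root set" where
  "pos_roots (TypeB n) =
     {EpsMinus i j | i j. 1 \<le> i \<and> i < j \<and> j \<le> n} \<union>
     {EpsPlus i j | i j. 1 \<le> i \<and> i < j \<and> j \<le> n} \<union>
     {Eps i | i. 1 \<le> i \<and> i \<le> n}"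
| "pos_roots (TypeD n) =
     {EpsMinus i j | i j. 1 \<le> i \<and> i < j \<and> j \<le> n} \<union>
     {EpsPlus i j | i j. 1 \<le> i \<and> i < j \<and> j \<le> n}"

fun root_col :: "root \<Rightarrow> nat" where
  "root_col (Eps i) = i"
| "root_col (EpsMinus i j) = i"
| "root_col (EpsPlus i j) = i"

fun root_row :: "root \<Rightarrow> int" where
  "root_row (Eps i) = 0"
| "root_row (EpsMinus i j) = int j"
| "root_row (EpsPlus i j) = - int j"

definition row_set :: "root_system \<Rightarrow> int \<Rightarrow> root set" where
  "row_set \<Phi> i = {\<alpha> \<in> pos_roots \<Phi>. root_row \<alpha> = i}"

definition col_set :: "root_system \<Rightarrow> nat \<Rightarrow> root set" where
  "col_set \<Phi> j = {\<alpha> \<in> pos_roots \<Phi>. root_col \<alpha> = j}"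

text \<open>The rows $\pm n$ are left out of the third conjunct; there the bound follows from
  orthogonality.\<close>

definition orthogonal_rook_placement :: "root_system \<Rightarrow> root set \<Rightarrow> bool" where
  "orthogonal_rook_placement \<Phi> D \<longleftrightarrow>
     D \<subseteq> pos_roots \<Phi> \<and>
     (\<forall>\<alpha>\<in>D. \<forall>\<beta>\<in>D. \<alpha> \<noteq> \<beta> \<longrightarrow> root_vec (rank \<Phi>) \<alpha> \<bullet> root_vec (rank \<Phi>) \<beta> = 0) \<and>
     (\<forall>i\<in>{- int (rank \<Phi>) + 1 .. int (rank \<Phi>) - 1}. card (D \<inter> row_set \<Phi> i) \<le> 1) \<and>
     (\<forall>j\<in>{1..rank \<Phi>}. card (D \<inter> col_set \<Phi> j) \<le> 1)"

definition singular_roots :: "root_system \<Rightarrow> root \<Rightarrow> root set" where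
  "singular_roots \<Phi> \<beta> =
     {\<alpha> \<in> pos_roots \<Phi>. \<exists>\<gamma>\<in>pos_roots \<Phi>.
        root_vec (rank \<Phi>) \<alpha> + root_vec (rank \<Phi>) \<gamma> = root_vec (rank \<Phi>) \<beta>}"

definition singular_minus :: "root_system \<Rightarrow> root \<Rightarrow> root set" where
  "singular_minus \<Phi> \<beta> = {\<alpha> \<in> singular_roots \<Phi> \<beta>. root_col \<alpha> \<noteq> root_col \<beta>}"


section \<open>The Lie algebra, the group and the exponential map\<close>

fun mat_size :: "root_system \<Rightarrow> nat" where
  "mat_size (TypeB n) = 2 * n + 1"
| "mat_size (TypeD n) = 2 * n"

text \<open>Position (from 0) of the index \<open>k\<close> in the order $1, \ldots, n, 0, -n, \ldots, -1$, where 0 is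
  absent in type D.\<close>

definition pos :: "root_system \<Rightarrow> int \<Rightarrow> nat" where
  "pos \<Phi> k = (if k > 0 then nat (k - 1) else if k = 0 then rank \<Phi>
     else nat (int (mat_size \<Phi>) + k))"

definition elem_mat :: "root_system \<Rightarrow> int \<Rightarrow> int \<Rightarrow> 'a::field mat" where
  "elem_mat \<Phi> a b = mat (mat_size \<Phi>) (mat_size \<Phi>)
     (\<lambda>(r, c). if r = pos \<Phi> a \<and> c = pos \<Phi> b then 1 else 0)"

fun root_mat :: "root_system \<Rightarrow> root \<Rightarrow> 'a::field mat" where
  "root_mat \<Phi> (Eps i) = elem_mat \<Phi> 0 (int i) - elem_mat \<Phi> (- int i) 0"
| "root_mat \<Phi> (EpsMinus i j) =
     elem_mat \<Phi> (int j) (int i) - elem_mat \<Phi> (- int i) (- int j)"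
| "root_mat \<Phi> (EpsPlus i j) =
     elem_mat \<Phi> (- int j) (int i) - elem_mat \<Phi> (- int i) (int j)"

definition mat_sum :: "nat \<Rightarrow> ('b \<Rightarrow> 'a::field mat) \<Rightarrow> 'b set \<Rightarrow> 'a mat" where
  "mat_sum m F S = mat m m (\<lambda>rc. \<Sum>k\<in>S. F k $$ rc)"

definition lin_comb :: "root_system \<Rightarrow> root set \<Rightarrow> (root \<Rightarrow> 'a::field) \<Rightarrow> 'a mat" where
  "lin_comb \<Phi> S c = mat_sum (mat_size \<Phi>) (\<lambda>\<alpha>. c \<alpha> \<cdot>\<^sub>m root_mat \<Phi> \<alpha>) S"

definition root_span :: "root_system \<Rightarrow> root set \<Rightarrow> 'a::field mat set" where
  "root_span \<Phi> S = range (lin_comb \<Phi> S)"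

definition lie_alg :: "root_system \<Rightarrow> 'a::field mat set" where
  "lie_alg \<Phi> = root_span \<Phi> (pos_roots \<Phi>)"

definition mat_exp :: "root_system \<Rightarrow> 'a::field mat \<Rightarrow> 'a mat" where
  "mat_exp \<Phi> x =
     mat_sum (mat_size \<Phi>) (\<lambda>i. (1 / of_nat (fact i)) \<cdot>\<^sub>m (x ^\<^sub>m i)) {..<mat_size \<Phi>}"

definition mat_ln :: "root_system \<Rightarrow> 'a::field mat \<Rightarrow> 'a mat" where
  "mat_ln \<Phi> = the_inv_into (lie_alg \<Phi>) (mat_exp \<Phi>)"

definition unip :: "root_system \<Rightarrow> 'a::field mat monoid" where
  "unip \<Phi> = \<lparr>carrier = mat_exp \<Phi> ` lie_alg \<Phi>, monoid.mult = (*), one = 1\<^sub>m (mat_size \<Phi>)\<rparr>"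


section \<open>The coadjoint action and orbit sums\<close>

text \<open>Elements of the dual space are functions restricted to \<open>lie_alg \<Phi>\<close> (extensional), so that
  equality of such functions is equality of linear forms.\<close>

definition coords :: "root_system \<Rightarrow> 'a::field mat \<Rightarrow> root \<Rightarrow> 'a" where
  "coords \<Phi> x =
     (THE c. c \<in> extensional (pos_roots \<Phi>) \<and> x = lin_comb \<Phi> (pos_roots \<Phi>) c)"

definition dual_basis :: "root_system \<Rightarrow> root \<Rightarrow> 'a::field mat \<Rightarrow> 'a" where
  "dual_basis \<Phi> \<alpha> = (\<lambda>x\<in>lie_alg \<Phi>. coords \<Phi> x \<alpha>)"

definition rook_form :: "root_system \<Rightarrow> root set \<Rightarrow> (root \<Rightarrow> 'a) \<Rightarrow> 'a::field mat \<Rightarrow> 'a" where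
  "rook_form \<Phi> D \<xi> = (\<lambda>x\<in>lie_alg \<Phi>. \<Sum>\<beta>\<in>D. \<xi> \<beta> * dual_basis \<Phi> \<beta> x)"

definition coadj ::
    "root_system \<Rightarrow> 'a mat \<Rightarrow> ('a mat \<Rightarrow> 'a) \<Rightarrow> 'a::field mat \<Rightarrow> 'a" where
  "coadj \<Phi> g \<mu> = (\<lambda>x\<in>lie_alg \<Phi>. \<mu> (inv\<^bsub>unip \<Phi>\<^esub> g * x * g))"

definition rook_orbit ::
    "root_system \<Rightarrow> root set \<Rightarrow> (root \<Rightarrow> 'a) \<Rightarrow> ('a::field mat \<Rightarrow> 'a) set" where
  "rook_orbit \<Phi> D \<xi> = orbit (unip \<Phi>) (coadj \<Phi>) (rook_form \<Phi> D \<xi>)"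

definition orbit_sum ::
    "('a \<Rightarrow> complex) \<Rightarrow> ('a mat \<Rightarrow> 'a) set \<Rightarrow> 'a mat \<Rightarrow> complex" where
  "orbit_sum \<theta> \<Omega> x = of_real (real (card \<Omega>) powr (- 1 / 2)) * (\<Sum>\<mu>\<in>\<Omega>. \<theta> (\<mu> x))"

definition orbit_char ::
    "root_system \<Rightarrow> ('a \<Rightarrow> complex) \<Rightarrow> ('a mat \<Rightarrow> 'a) set \<Rightarrow> 'a::field mat \<Rightarrow> complex" where
  "orbit_char \<Phi> \<theta> \<Omega> g = orbit_sum \<theta> \<Omega> (mat_ln \<Phi> g)"


section \<open>Semidirect products and induced class functions\<close>

text \<open>Components of \<open>g = a b\<close> with \<open>a \<in> A\<close>, \<open>b \<in> B\<close> (meant for $A \rtimes B$, where they are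
  unique).\<close>

definition semi_left :: "('g, 'm) monoid_scheme \<Rightarrow> 'g set \<Rightarrow> 'g set \<Rightarrow> 'g \<Rightarrow> 'g" where
  "semi_left G A B g = (THE a. a \<in> A \<and> (\<exists>b\<in>B. g = a \<otimes>\<^bsub>G\<^esub> b))"

definition semi_right :: "('g, 'm) monoid_scheme \<Rightarrow> 'g set \<Rightarrow> 'g set \<Rightarrow> 'g \<Rightarrow> 'g" where
  "semi_right G A B g = (THE b. b \<in> B \<and> (\<exists>a\<in>A. g = a \<otimes>\<^bsub>G\<^esub> b))"

definition induced ::
    "('g, 'm) monoid_scheme \<Rightarrow> 'g set \<Rightarrow> ('g \<Rightarrow> complex) \<Rightarrow> 'g \<Rightarrow> complex" where
  "induced G H \<phi> g = 1 / of_nat (card H) *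
     (\<Sum>x | x \<in> carrier G \<and> inv\<^bsub>G\<^esub> x \<otimes>\<^bsub>G\<^esub> g \<otimes>\<^bsub>G\<^esub> x \<in> H. \<phi> (inv\<^bsub>G\<^esub> x \<otimes>\<^bsub>G\<^esub> g \<otimes>\<^bsub>G\<^esub> x))"


section \<open>The subgroups attached to the first root\<close>

definition roots1 :: "root_system \<Rightarrow> root \<Rightarrow> root set" where
  "roots1 \<Phi> \<beta> = (if root_col \<beta> > 1 then pos_roots \<Phi> - col_set \<Phi> 1
     else pos_roots \<Phi> - (col_set \<Phi> 1 \<union> singular_minus \<Phi> \<beta>))"

definition roots2 :: "root_system \<Rightarrow> root \<Rightarrow> root set" where
  "roots2 \<Phi> \<beta> = (case \<beta> of
       EpsMinus a i \<Rightarrow>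
         if a = 1 then roots1 \<Phi> \<beta> - singular_minus \<Phi> (EpsPlus 1 i) else roots1 \<Phi> \<beta>
     | EpsPlus a i \<Rightarrow>
         if a = 1 then roots1 \<Phi> \<beta> - singular_minus \<Phi> (EpsMinus 1 i) else roots1 \<Phi> \<beta>
     | Eps a \<Rightarrow> roots1 \<Phi> \<beta>)"

definition exp_span :: "root_system \<Rightarrow> root set \<Rightarrow> 'a::field mat set" where
  "exp_span \<Phi> S = mat_exp \<Phi> ` root_span \<Phi> S"

definition U1 :: "root_system \<Rightarrow> 'a::field mat set" where
  "U1 \<Phi> = exp_span \<Phi> (col_set \<Phi> 1)"

definition V' :: "root_system \<Rightarrow> root \<Rightarrow> 'a::field mat set" where
  "V' \<Phi> \<beta> = exp_span \<Phi> (roots1 \<Phi> \<beta>)"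

definition V1 :: "root_system \<Rightarrow> root \<Rightarrow> 'a::field mat set" where
  "V1 \<Phi> \<beta> = exp_span \<Phi> (roots1 \<Phi> \<beta> - roots2 \<Phi> \<beta>)"

definition U_tilde :: "root_system \<Rightarrow> root \<Rightarrow> 'a::field mat set" where
  "U_tilde \<Phi> \<beta> = exp_span \<Phi> (roots2 \<Phi> \<beta>)"

definition U1V' :: "root_system \<Rightarrow> root \<Rightarrow> 'a::field mat set" where
  "U1V' \<Phi> \<beta> = U1 \<Phi> <#>\<^bsub>unip \<Phi>\<^esub> V' \<Phi> \<beta>"

definition proj_U1 :: "root_system \<Rightarrow> root \<Rightarrow> 'a::field mat \<Rightarrow> 'a mat" where
  "proj_U1 \<Phi> \<beta> = semi_left (unip \<Phi>) (U1 \<Phi>) (V' \<Phi> \<beta>)"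

definition proj_U_tilde :: "root_system \<Rightarrow> root \<Rightarrow> 'a::field mat \<Rightarrow> 'a mat" where
  "proj_U_tilde \<Phi> \<beta> =
     semi_right (unip \<Phi>) (V1 \<Phi> \<beta>) (U_tilde \<Phi> \<beta>) \<circ> semi_right (unip \<Phi>) (U1 \<Phi>) (V' \<Phi> \<beta>)"


section \<open>The smaller root system\<close>

fun smaller :: "root_system \<Rightarrow> root \<Rightarrow> root_system" where
  "smaller (TypeB n) \<beta> =
     (if root_col \<beta> > 1 then TypeB (n - 1)
      else if root_row \<beta> \<noteq> 0 then TypeB (n - 2) else TypeD (n - 1))"
| "smaller (TypeD n) \<beta> = (if root_col \<beta> > 1 then TypeD (n - 1) else TypeD (n - 2))"

definition index_set :: "root_system \<Rightarrow> root \<Rightarrow> nat set" where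
  "index_set \<Phi> \<beta> = (case \<beta> of
       EpsMinus a i \<Rightarrow> if a = 1 then {2..rank \<Phi>} - {i} else {2..rank \<Phi>}
     | EpsPlus a i \<Rightarrow> if a = 1 then {2..rank \<Phi>} - {i} else {2..rank \<Phi>}
     | Eps a \<Rightarrow> {2..rank \<Phi>})"

text \<open>The increasing bijection from a finite set \<open>I\<close> of numbers onto $\{1, \ldots, |I|\}$.\<close>

definition kappa :: "nat set \<Rightarrow> nat \<Rightarrow> nat" where
  "kappa I a = card {b \<in> I. b \<le> a}"

lemma strict_mono_on_kappa:
  assumes "finite I"
  shows "strict_mono_on I (kappa I)"
proof (rule strict_mono_onI)
  fix r s assume "r \<in> I" "s \<in> I" "r < s"
  then have "{b \<in> I. b \<le> r} \<subset> {b \<in> I. b \<le> s}" by force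
  then show "kappa I r < kappa I s"
    unfolding kappa_def by (rule psubset_card_mono[rotated]) (use assms in auto)
qed

lemma bij_betw_kappa:
  assumes "finite I"
  shows "bij_betw (kappa I) I {1..card I}"
proof -
  have inj: "inj_on (kappa I) I"
    using strict_mono_on_kappa[OF assms] strict_mono_on_imp_inj_on by blast
  have "kappa I ` I \<subseteq> {1..card I}"
    using assms by (auto simp: kappa_def Suc_le_eq card_gt_0_iff intro: card_mono)
  moreover have "card (kappa I ` I) = card {1..card I}"
    using card_image[OF inj] by simp
  ultimately have "kappa I ` I = {1..card I}"
    by (intro card_subset_eq) auto
  with inj show ?thesis by (simp add: bij_betw_def)
qed

fun relabel :: "(nat \<Rightarrow> nat) \<Rightarrow> root \<Rightarrow> root" where
  "relabel k (Eps a) = Eps (k a)"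
| "relabel k (EpsMinus a b) = EpsMinus (k a) (k b)"
| "relabel k (EpsPlus a b) = EpsPlus (k a) (k b)"

definition pi_root :: "root_system \<Rightarrow> root \<Rightarrow> root \<Rightarrow> root" where
  "pi_root \<Phi> \<beta> = relabel (kappa (index_set \<Phi> \<beta>))"

text \<open>The linear extension of $e_\alpha \mapsto e_{\pi(\alpha)}$.\<close>

definition pi_lie :: "root_system \<Rightarrow> root \<Rightarrow> 'a::field mat \<Rightarrow> 'a mat" where
  "pi_lie \<Phi> \<beta> x = mat_sum (mat_size (smaller \<Phi> \<beta>))
     (\<lambda>\<alpha>. dual_basis \<Phi> \<alpha> x \<cdot>\<^sub>m root_mat (smaller \<Phi> \<beta>) (pi_root \<Phi> \<beta> \<alpha>)) (roots2 \<Phi> \<beta>)"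

definition D_tilde :: "root_system \<Rightarrow> root \<Rightarrow> root set \<Rightarrow> root set" where
  "D_tilde \<Phi> \<beta> D = pi_root \<Phi> \<beta> ` (D - col_set \<Phi> 1)"

definition xi_tilde :: "root_system \<Rightarrow> root \<Rightarrow> root set \<Rightarrow> (root \<Rightarrow> 'a) \<Rightarrow> root \<Rightarrow> 'a" where
  "xi_tilde \<Phi> \<beta> D \<xi> \<gamma> = \<xi> (the_inv_into (D - col_set \<Phi> 1) (pi_root \<Phi> \<beta>) \<gamma>)"


section \<open>The characters\<close>

definition chi ::
    "root_system \<Rightarrow> ('a \<Rightarrow> complex) \<Rightarrow> root set \<Rightarrow> (root \<Rightarrow> 'a) \<Rightarrow> 'a::field mat \<Rightarrow> complex" where
  "chi \<Phi> \<theta> D \<xi> = orbit_char \<Phi> \<theta> (rook_orbit \<Phi> D \<xi>)"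

definition psi ::
    "root_system \<Rightarrow> ('a \<Rightarrow> complex) \<Rightarrow> root set \<Rightarrow> (root \<Rightarrow> 'a) \<Rightarrow> 'a::field mat \<Rightarrow> complex" where
  "psi \<Phi> \<theta> D \<xi> x = \<theta> (rook_form \<Phi> D \<xi> (mat_ln \<Phi> x))"

definition chi_tilde ::
    "root_system \<Rightarrow> ('a \<Rightarrow> complex) \<Rightarrow> root \<Rightarrow> root set \<Rightarrow> (root \<Rightarrow> 'a) \<Rightarrow>
     'a::field mat \<Rightarrow> complex" where
  "chi_tilde \<Phi> \<theta> \<beta> D \<xi> g =
     orbit_sum \<theta> (rook_orbit (smaller \<Phi> \<beta>) (D_tilde \<Phi> \<beta> D) (xi_tilde \<Phi> \<beta> D \<xi>))
       (pi_lie \<Phi> \<beta> (mat_ln \<Phi> g))"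

end

(*
  The Lie algebra u consists of the strictly lower triangular matrices that are skew for the
  reflection sigma in the antidiagonal, and U = exp u of the unitriangular g with sigma g = g^-1.
  All subalgebras in sight are cut out by prescribing which matrix entries may be nonzero.

  Let k be the row of beta_1 in the first column and h = u_1 + v'; then h consists of the x in u
  whose row k vanishes outside the first column.  On h, the form f is x |-> xi x[k,1] plus the form of
  the smaller rook placement, evaluated at the submatrix tau x; on h the map tau is multiplicative,
  so the character to be induced from H = exp h is an orbit sum over the coadjoint orbit of f|h.
  Let P be the set of forms on u whose restriction to h lies in that orbit.  Conjugation by U_1 moves f
  through all of f + X, where X is the annihilator of h, so P is contained in the U-orbit of f.
  Moreover x f lies in P exactly when x lies in H.  Averaging over U then gives
  |Omega| = |Omega~| |U:H|^2 and the formula of the theorem.  If col(beta_1) > 1, then h = u.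
*)
theory Submission
  imports Defs
begin

text \<open>The only product formula for exponentials is exp (-x) exp x = 1. It needs the factorials
  below m to be invertible, which p >= m provides. Instead of the Baker-Campbell-Hausdorff formula,
  products are compared modulo ideals of matrices with prescribed support. Dimension counts become
  finite sums: theta (nu x), summed over a space S of forms and over u in both orders, gives |S|
  |S^0| = |u| for the annihilator S^0 of S. The obstacle is that the character of H has to be
  extended by zero and averaged over conjugates that leave h. The set P removes it: for every z in
  u, the sum of theta (mu z) over mu in P is |X| times the sum over the orbit of f|h if z lies in h,
  and 0 otherwise. The induced character is thus an average over U x P in which every mu contributes
  equally, since P lies in one orbit. Odd characteristic matters because a skew matrix has to vanish
  on the antidiagonal, where no root vector has an entry; a positive root forces m >= 3, so p >= m
  gives it.\<close>

section \<open>Entries and powers of square matrices\<close>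

lemma finite_carrier_mat [simp]: "finite (carrier_mat m n :: 'a::finite mat set)"
proof (rule finite_subset)
  show "carrier_mat m n \<subseteq> (\<lambda>f. mat m n f) `
      ({..<m} \<times> {..<n} \<rightarrow>\<^sub>E (UNIV :: 'a set))"
  proof
    fix x :: "'a mat"
    assume "x \<in> carrier_mat m n"
    then have x: "x = mat m n (restrict (\<lambda>ab. x $$ ab) ({..<m} \<times> {..<n}))"
      by (intro eq_matI) auto
    show "x \<in> (\<lambda>f. mat m n f) ` ({..<m} \<times> {..<n} \<rightarrow>\<^sub>E (UNIV :: 'a set))"
      by (subst x, rule imageI) (simp add: PiE_iff extensional_def)
  qed
qed (intro finite_imageI finite_PiE, auto)

lemma index_mult_sum:
  assumes "x \<in> carrier_mat m m" "y \<in> carrier_mat m m" "a < m" "b < m"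
  shows "(x * y) $$ (a, b) = (\<Sum>c<m. x $$ (a, c) * y $$ (c, b))"
  using assms by (simp add: scalar_prod_def lessThan_atLeast0)

lemma pow_mat_Suc_left:
  fixes x :: "'a::semiring_1 mat"
  assumes "x \<in> carrier_mat m m"
  shows "x ^\<^sub>m Suc i = x * x ^\<^sub>m i"
proof (induction i)
  case (Suc i)
  have "x ^\<^sub>m Suc (Suc i) = (x * x ^\<^sub>m i) * x" using Suc by simp
  also have "\<dots> = x * x ^\<^sub>m Suc i"
    using assms by (simp add: assoc_mult_mat[of _ m m _ m _ m])
  finally show ?case .
qed (use assms in auto)

lemma pow_mat_add:
  fixes x :: "'a::semiring_1 mat"
  assumes "x \<in> carrier_mat m m"
  shows "x ^\<^sub>m (i + j) = x ^\<^sub>m i * x ^\<^sub>m j"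
proof (induction j)
  case (Suc j)
  then show ?case using assms
    by (simp add: assoc_mult_mat[of _ m m _ m _ m])
qed (use assms in auto)

lemma uminus_pow_mat:
  fixes x :: "'a::comm_ring_1 mat"
  assumes "x \<in> carrier_mat m m"
  shows "(- x) ^\<^sub>m i = (- 1) ^ i \<cdot>\<^sub>m x ^\<^sub>m i"
proof (induction i)
  case (Suc i)
  have "(- x) ^\<^sub>m Suc i = (- 1) ^ i \<cdot>\<^sub>m x ^\<^sub>m i * - x" using Suc by simp
  also have "\<dots> = (- 1) ^ Suc i \<cdot>\<^sub>m (x ^\<^sub>m i * x)"
    using assms by (intro eq_matI) (auto simp: scalar_prod_def sum_distrib_left sum_negf mult.assoc)
  finally show ?case by simp
qed (use assms in auto)

section \<open>Matrices with prescribed support\<close>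

definition lower :: "nat \<Rightarrow> (nat \<times> nat) set" where
  "lower m = {(a, b). b < a \<and> a < m}"

text \<open>The support is an arbitrary relation, so that subalgebra and ideal properties become
  inclusions between relational composites such as \<open>P O P \<subseteq> P\<close>.\<close>

definition pat :: "nat \<Rightarrow> (nat \<times> nat) set \<Rightarrow> 'a::field mat set" where
  "pat m P = {x \<in> carrier_mat m m. \<forall>a<m. \<forall>b<m. (a, b) \<notin> P \<longrightarrow> x $$ (a, b) = 0}"

definition upat :: "nat \<Rightarrow> (nat \<times> nat) set \<Rightarrow> 'a::field mat set" where
  "upat m P = {g \<in> carrier_mat m m. g - 1\<^sub>m m \<in> pat m P}"

lemma patI:
  assumes "x \<in> carrier_mat m m"
    and "\<And>a b. a < m \<Longrightarrow> b < m \<Longrightarrow> (a, b) \<notin> P \<Longrightarrow> x $$ (a, b) = 0"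
  shows "x \<in> pat m P"
  using assms by (auto simp: pat_def)

lemma patD:
  assumes "x \<in> pat m P"
  shows "x \<in> carrier_mat m m"
    and "\<And>a b. a < m \<Longrightarrow> b < m \<Longrightarrow> (a, b) \<notin> P \<Longrightarrow> x $$ (a, b) = 0"
  using assms by (auto simp: pat_def)

lemma pat_mono: "P \<subseteq> Q \<Longrightarrow> pat m P \<subseteq> pat m Q"
  by (auto simp: pat_def)

lemma upat_mono: "P \<subseteq> Q \<Longrightarrow> upat m P \<subseteq> upat m Q"
  unfolding upat_def using pat_mono[of P Q m] by blast

lemma finite_pat [simp]: "finite (pat m P :: 'a::{field,finite} mat set)"
  by (rule finite_subset[of _ "carrier_mat m m"]) (auto simp: pat_def)

lemma finite_upat [simp]: "finite (upat m P :: 'a::{field,finite} mat set)"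
  by (rule finite_subset[of _ "carrier_mat m m"]) (auto simp: upat_def)

lemma upat_carrier: "g \<in> upat m P \<Longrightarrow> g \<in> carrier_mat m m"
  by (simp add: upat_def)

lemma upatD:
  assumes "g \<in> upat m P" "a < m" "b < m" "(a, b) \<notin> P"
  shows "g $$ (a, b) = (if a = b then 1 else 0)"
proof -
  have "g \<in> carrier_mat m m" "(g - 1\<^sub>m m) $$ (a, b) = 0"
    using assms by (auto simp: upat_def pat_def)
  then show ?thesis using assms by (auto split: if_splits)
qed

lemma upatI:
  assumes "g \<in> carrier_mat m m"
    and "\<And>a b. a < m \<Longrightarrow> b < m \<Longrightarrow> (a, b) \<notin> P \<Longrightarrow> g $$ (a, b) = (if a = b then 1 else 0)"
  shows "g \<in> upat m P"
  using assms by (auto simp: upat_def intro!: patI)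

lemma one_upat: "1\<^sub>m m \<in> upat m P"
  by (auto intro: upatI)

lemma zero_pat: "0\<^sub>m m m \<in> pat m P"
  by (auto intro!: patI)

lemma pat_add: "x \<in> pat m P \<Longrightarrow> y \<in> pat m P \<Longrightarrow> x + y \<in> pat m P"
  by (auto simp: pat_def)

lemma pat_diff: "x \<in> pat m P \<Longrightarrow> y \<in> pat m P \<Longrightarrow> x - y \<in> pat m P"
  by (auto simp: pat_def)

lemma pat_uminus: "x \<in> pat m P \<Longrightarrow> - x \<in> pat m P"
  by (auto simp: pat_def)

lemma pat_smult: "x \<in> pat m P \<Longrightarrow> c \<cdot>\<^sub>m x \<in> pat m P"
  by (auto simp: pat_def)

text \<open>A summand x(a,c) y(c,b) can be nonzero only if (a,c) is in A and (c,b) is in B, hence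
  only if (a,b) lies in the composite.\<close>

lemma pat_mult:
  assumes "x \<in> pat m A" "y \<in> pat m B" "A O B \<subseteq> C"
  shows "x * y \<in> pat m C"
proof (rule patI)
  show "x * y \<in> carrier_mat m m" using assms by (auto simp: pat_def)
  fix a b assume ab: "a < m" "b < m" "(a, b) \<notin> C"
  have "x $$ (a, c) * y $$ (c, b) = 0" if "c < m" for c
  proof (cases "(a, c) \<in> A \<and> (c, b) \<in> B")
    case True
    then show ?thesis using ab assms(3) by blast
  next
    case False
    then show ?thesis using patD(2)[OF assms(1)] patD(2)[OF assms(2)] ab that by auto
  qed
  then show "(x * y) $$ (a, b) = 0"
    using index_mult_sum[OF patD(1)[OF assms(1)] patD(1)[OF assms(2)]] ab
    by (metis (mono_tags, lifting) lessThan_iff sum.neutral)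
qed

text \<open>With g = 1 + u the product is x + x u, and the hypothesis on R keeps x u in R. Ideals
  for matrices supported in P are therefore also stable under the unipotent matrices built from
  P.\<close>

lemma pat_mult_left_unipotent:
  assumes "x \<in> pat m R" "g \<in> upat m P" "R O P \<subseteq> R"
  shows "x * g \<in> pat m R"
proof -
  have g: "g \<in> carrier_mat m m" "x \<in> carrier_mat m m" "g - 1\<^sub>m m \<in> pat m P"
    using assms by (auto simp: upat_def pat_def)
  have "x * g = x * (1\<^sub>m m + (g - 1\<^sub>m m))"
    using g by (intro arg_cong[of _ _ "(*) x"]) auto
  also have "\<dots> = x + x * (g - 1\<^sub>m m)"
    using g by (subst mult_add_distrib_mat[of _ m m]) auto
  finally show ?thesis
    using pat_add[OF assms(1) pat_mult[OF assms(1) g(3) assms(3)]] by simp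
qed

lemma upat_mult:
  assumes "g \<in> upat m P" "h \<in> upat m P" "trans P"
  shows "g * h \<in> upat m P"
proof -
  have c: "g \<in> carrier_mat m m" "h \<in> carrier_mat m m" "g - 1\<^sub>m m \<in> pat m P" "h - 1\<^sub>m m \<in> pat m P"
    using assms by (auto simp: upat_def)
  have "P O P \<subseteq> P" using assms(3) by (auto dest: transD)
  then have "(g - 1\<^sub>m m) * h \<in> pat m P" using c assms pat_mult_left_unipotent by blast
  then have "(g - 1\<^sub>m m) * h + (h - 1\<^sub>m m) \<in> pat m P" using c pat_add by blast
  moreover have "(g - 1\<^sub>m m) * h + (h - 1\<^sub>m m) = g * h - 1\<^sub>m m"
    using c by (subst minus_mult_distrib_mat[of _ m m]) auto
  ultimately show ?thesis using c by (auto simp: upat_def)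
qed

lemma pat_pow:
  assumes "x \<in> pat m P" "trans P" "i > 0"
  shows "x ^\<^sub>m i \<in> pat m P"
  using assms(3)
proof (induction i rule: nat_induct_non_zero)
  case 1
  then show ?case using assms patD(1)[OF assms(1)] by simp
next
  case (Suc i)
  then show ?case using assms pat_mult[of "x ^\<^sub>m i" m P x P P] by (auto dest: transD)
qed

lemma trans_lower: "trans (lower m)"
  by (auto simp: lower_def intro!: transI)

text \<open>Each factor moves at least one step away from the diagonal, so an entry of x^i survives
  only at distance a - b >= i.\<close>

lemma lower_pow_eq_0:
  assumes "x \<in> pat m (lower m)" "a < m" "b < m" "a < b + i"
  shows "(x ^\<^sub>m i) $$ (a, b) = 0"
  using assms(2-)
proof (induction i arbitrary: b)
  case 0
  then show ?case using patD(1)[OF assms(1)] by simp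
next
  case (Suc i)
  have "(x ^\<^sub>m i) $$ (a, c) * x $$ (c, b) = 0" if "c < m" for c
  proof (cases "b < c")
    case True
    then show ?thesis using Suc that by simp
  next
    case False
    then show ?thesis using patD(2)[OF assms(1), of c b] Suc that by (simp add: lower_def)
  qed
  then have "(\<Sum>c<m. (x ^\<^sub>m i) $$ (a, c) * x $$ (c, b)) = 0" by (intro sum.neutral) blast
  then show ?case
    using Suc patD(1)[OF assms(1)] by (simp add: index_mult_sum[of _ m] del: index_mult_mat)
qed

section \<open>The truncated exponential\<close>

definition mexp :: "nat \<Rightarrow> 'a::field mat \<Rightarrow> 'a mat" where
  "mexp m x = mat_sum m (\<lambda>i. (1 / of_nat (fact i)) \<cdot>\<^sub>m (x ^\<^sub>m i)) {..<m}"

lemma mexp_carrier [simp]: "mexp m x \<in> carrier_mat m m"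
  by (simp add: mexp_def mat_sum_def)

lemma mexp_dim [simp]: "dim_row (mexp m x) = m" "dim_col (mexp m x) = m"
  using carrier_matD[OF mexp_carrier[of m x]] by auto

lemma mexp_index:
  assumes "x \<in> carrier_mat m m" "a < m" "b < m"
  shows "mexp m x $$ (a, b) = (\<Sum>i<m. 1 / of_nat (fact i) * (x ^\<^sub>m i) $$ (a, b))"
  using assms by (simp add: mexp_def mat_sum_def)

text \<open>Powers with a < b + i vanish at (a,b), so every cut-off beyond that distance gives the
  same entry as the cut-off m. This allows comparing exponentials of different sizes and peeling off
  the constant and linear terms however small m is.\<close>

lemma mexp_index_bound:
  assumes x: "x \<in> pat m (lower m)" and ab: "a < m" "b < m" and n: "a < b + n" 
  shows "mexp m x $$ (a, b) = (\<Sum>i<n. 1 / of_nat (fact i) * (x ^\<^sub>m i) $$ (a, b))"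
proof -
  note xc = patD(1)[OF x]
  let ?h = "\<lambda>i. 1 / of_nat (fact i) * (x ^\<^sub>m i) $$ (a, b)"
  have "sum ?h {..<m} = sum ?h {..<max m n}"
    using ab lower_pow_eq_0[OF x ab] by (intro sum.mono_neutral_left) auto
  also have "\<dots> = sum ?h {..<n}"
    using ab n lower_pow_eq_0[OF x ab] by (intro sum.mono_neutral_right) auto
  finally show ?thesis using mexp_index[OF xc ab] by simp
qed

text \<open>Modulo the ideal R the matrices x and y agree, hence so do their powers, by the
  telescoping identity x^(i+1) - y^(i+1) = x^i (x - y) + (x^i - y^i) y. The case i = 0 is separate
  because the identity matrix need not be supported in P.\<close>

lemma mexp_diff_pat:
  fixes x y :: "'a::field mat"
  assumes x: "x \<in> pat m P" and y: "y \<in> pat m P" and xy: "x - y \<in> pat m R"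
    and P: "trans P" "R \<subseteq> P" "R O P \<subseteq> R" "P O R \<subseteq> R"
  shows "mexp m x - mexp m y \<in> pat m R"
proof -
  note c = patD(1)[OF x] patD(1)[OF y]
  have pw: "x ^\<^sub>m i - y ^\<^sub>m i \<in> pat m R" for i
  proof (induction i)
    case 0
    have "x ^\<^sub>m 0 - y ^\<^sub>m 0 = 0\<^sub>m m m" using c by (intro eq_matI) auto
    then show ?case using zero_pat[of m R] by metis
  next
    case (Suc i)
    have 1: "(x ^\<^sub>m i - y ^\<^sub>m i) * y \<in> pat m R"
      using pat_mult[OF Suc y P(3)] .
    have 2: "x ^\<^sub>m i * (x - y) \<in> pat m R"
    proof (cases "i = 0")
      case True
      then show ?thesis using xy c by (simp add: left_mult_one_mat')
    next
      case False
      then show ?thesis using pat_mult[OF pat_pow[OF x P(1)] xy P(4)] by simp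
    qed
    have "x ^\<^sub>m Suc i - y ^\<^sub>m Suc i = x ^\<^sub>m i * (x - y) + (x ^\<^sub>m i - y ^\<^sub>m i) * y"
      using c by (simp add: mult_minus_distrib_mat[of _ m m] minus_mult_distrib_mat[of _ m m])
         (intro eq_matI, auto)
    then show ?case using pat_add[OF 2 1] by simp
  qed
  show ?thesis
  proof (rule patI)
    fix a b assume ab: "a < m" "b < m" "(a, b) \<notin> R"
    have "(x ^\<^sub>m i) $$ (a, b) = (y ^\<^sub>m i) $$ (a, b)" for i
      using patD(2)[OF pw ab, of i] ab c by simp
    then show "(mexp m x - mexp m y) $$ (a, b) = 0"
      using c ab by (simp add: mexp_index)
  qed (use c in auto)
qed

lemma mexp_zero: "mexp m (0\<^sub>m m m) = (1\<^sub>m m :: 'a::field mat)"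
proof (rule eq_matI)
  fix a b assume "a < dim_row (1\<^sub>m m :: 'a mat)" "b < dim_col (1\<^sub>m m :: 'a mat)"
  then have ab: "a < m" "b < m" by auto
  have "(0\<^sub>m m m ^\<^sub>m Suc i :: 'a mat) $$ (a, b) = 0" for i
    using ab by (simp add: index_mult_sum[of _ m] del: index_mult_mat)
  then have z: "(0\<^sub>m m m ^\<^sub>m i :: 'a mat) $$ (a, b) = 0" if "i > 0" for i
    using that by (cases i) auto
  have "mexp m (0\<^sub>m m m :: 'a mat) $$ (a, b) = (\<Sum>i\<in>{0}. 1 / of_nat (fact i) * (0\<^sub>m m m ^\<^sub>m i :: 'a mat) $$ (a, b))"
  proof -
    have "(\<Sum>i<m. 1 / of_nat (fact i) * (0\<^sub>m m m ^\<^sub>m i :: 'a mat) $$ (a, b))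
        = (\<Sum>i\<in>{0}. 1 / of_nat (fact i) * (0\<^sub>m m m ^\<^sub>m i :: 'a mat) $$ (a, b))"
      using ab z by (intro sum.mono_neutral_right) auto
    then show ?thesis using ab by (simp add: mexp_index)
  qed
  then show "mexp m (0\<^sub>m m m) $$ (a, b) = (1\<^sub>m m :: 'a mat) $$ (a, b)" by simp
qed auto

lemma mexp_upat:
  assumes "x \<in> pat m P" "trans P"
  shows "mexp m x \<in> upat m P"
  using mexp_diff_pat[OF assms(1) zero_pat, of P] assms
  by (auto simp: upat_def mexp_zero intro: pat_diff zero_pat dest: transD)

text \<open>The characteristic of a finite field is a prime p, and p does not divide i! for i <
  p.\<close>

lemma fact_nonzero:
  assumes "i < CHAR('a::{field,finite})"
  shows "(of_nat (fact i) :: 'a) \<noteq> 0"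
proof -
  have "prime CHAR('a)" using prime_CHAR_semidom[where ?'a = 'a] finite_imp_CHAR_pos[where ?'a = 'a] by simp
  then show ?thesis using assms by (simp add: of_nat_eq_0_iff_char_dvd prime_dvd_fact_iff)
qed

text \<open>Cauchy product: x^m = 0 leaves only the pairs with i + j < m, and the coefficient of x^k
  is the alternating sum of the binomial coefficients of k, divided by k!, which vanishes for k >
  0.\<close>

lemma mexp_uminus_mult:
  fixes x :: "'a::{field,finite} mat"
  assumes x: "x \<in> pat m (lower m)" and m: "m \<le> CHAR('a)"
  shows "mexp m (- x) * mexp m x = 1\<^sub>m m"
proof (rule eq_matI)
  note xc = patD(1)[OF x]
  fix a b assume "a < dim_row (1\<^sub>m m :: 'a mat)" "b < dim_col (1\<^sub>m m :: 'a mat)"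
  then have ab: "a < m" "b < m" by auto
  define e :: "nat \<Rightarrow> 'a" where "e i = 1 / of_nat (fact i)" for i
  define X where "X i = (x ^\<^sub>m i) $$ (a, b)" for i
  define w where "w i j = (- 1) ^ i * e i * e j * X (i + j)" for i j
  have X0: "X i = 0" if "i \<ge> m" for i
    unfolding X_def using that ab by (intro lower_pow_eq_0[OF x]) auto
  have "(mexp m (- x) * mexp m x) $$ (a, b)
      = (\<Sum>c<m. (\<Sum>i<m. ((- 1) ^ i * e i) * (x ^\<^sub>m i) $$ (a, c)) * (\<Sum>j<m. e j * (x ^\<^sub>m j) $$ (c, b)))"
    using ab xc by (simp add: index_mult_sum[of _ m] mexp_index uminus_pow_mat[of _ m] e_def mult_ac del: index_mult_mat)
  also have "\<dots> = (\<Sum>c<m. \<Sum>i<m. \<Sum>j<m. (- 1) ^ i * e i * e j * ((x ^\<^sub>m i) $$ (a, c) * (x ^\<^sub>m j) $$ (c, b)))"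
    unfolding sum_product by (intro sum.cong refl) (simp only: mult_ac)
  also have "\<dots> = (\<Sum>i<m. \<Sum>c<m. \<Sum>j<m. (- 1) ^ i * e i * e j * ((x ^\<^sub>m i) $$ (a, c) * (x ^\<^sub>m j) $$ (c, b)))"
    by (rule sum.swap)
  also have "\<dots> = (\<Sum>i<m. \<Sum>j<m. \<Sum>c<m. (- 1) ^ i * e i * e j * ((x ^\<^sub>m i) $$ (a, c) * (x ^\<^sub>m j) $$ (c, b)))"
    by (intro sum.cong refl sum.swap)
  also have "\<dots> = (\<Sum>i<m. \<Sum>j<m. w i j)"
    using ab xc by (simp add: w_def X_def pow_mat_add[OF xc] index_mult_sum[of _ m] sum_distrib_left del: index_mult_mat)
  also have "\<dots> = (\<Sum>(i, j)\<in>{..<m} \<times> {..<m}. w i j)"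
    by (simp add: sum.cartesian_product)
  also have "\<dots> = (\<Sum>(i, j)\<in>{(i, j). i + j < m}. w i j)"
  proof (rule sum.mono_neutral_right)
    have "w i j = 0" if "\<not> i + j < m" for i j using X0[of "i + j"] that by (simp add: w_def)
    then show "\<forall>p\<in>{..<m} \<times> {..<m} - {(i, j). i + j < m}. (case p of (i, j) \<Rightarrow> w i j) = 0"
      by auto
  qed auto
  also have "\<dots> = (\<Sum>k<m. \<Sum>i\<le>k. w i (k - i))"
    by (rule sum.triangle_reindex)
  also have "\<dots> = (\<Sum>k<m. if k = 0 then X 0 else 0)"
  proof (rule sum.cong[OF refl])
    fix k assume "k \<in> {..<m}"
    then have k: "k < m" by simp
    have nz: "(of_nat (fact i) :: 'a) \<noteq> 0" if "i < m" for i
      using that m by (intro fact_nonzero) auto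
    have "w i (k - i) = (- 1) ^ i * of_nat (k choose i) * (e k * X k)" if "i \<le> k" for i
    proof -
      have "of_nat (fact k) = (of_nat (fact i) * of_nat (fact (k - i)) * of_nat (k choose i) :: 'a)"
        using binomial_fact_lemma[OF that] by (metis of_nat_mult)
      then show ?thesis using nz[of k] nz[of i] nz[of "k - i"] k that
        by (simp add: w_def e_def field_simps del: of_nat_fact)
    qed
    then have "(\<Sum>i\<le>k. w i (k - i)) = (\<Sum>i\<le>k. (- 1) ^ i * of_nat (k choose i)) * (e k * X k)"
      by (simp add: sum_distrib_right)
    also have "\<dots> = (if k = 0 then X 0 else 0)"
      using choose_alternating_sum[of k, where ?'a = 'a] by (auto simp: e_def)
    finally show "(\<Sum>i\<le>k. w i (k - i)) = (if k = 0 then X 0 else 0)" .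
  qed
  also have "\<dots> = 1\<^sub>m m $$ (a, b)" using ab xc by (simp add: X_def)
  finally show "(mexp m (- x) * mexp m x) $$ (a, b) = 1\<^sub>m m $$ (a, b)" .
qed auto

lemma mexp_mult_uminus:
  fixes x :: "'a::{field,finite} mat"
  assumes x: "x \<in> pat m (lower m)" and m: "m \<le> CHAR('a)"
  shows "mexp m x * mexp m (- x) = 1\<^sub>m m"
  using mexp_uminus_mult[OF pat_uminus[OF x] m] patD(1)[OF x] by (simp add: uminus_uminus_mat)

text \<open>Agreement at distance less than d from the diagonal gains one step per additional
  factor, because each of the other i - 1 factors already uses up at least one step.\<close>

lemma lower_pow_agree:
  assumes x: "x \<in> pat m (lower m)" and y: "y \<in> pat m (lower m)"
    and eq: "\<And>a b. a < m \<Longrightarrow> b < m \<Longrightarrow> a < b + d \<Longrightarrow> x $$ (a, b) = y $$ (a, b)"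
    and ab: "a < m" "b < m" 
  shows "a < b + d + i - 1 \<Longrightarrow> i > 0 \<Longrightarrow> (x ^\<^sub>m i) $$ (a, b) = (y ^\<^sub>m i) $$ (a, b)"
  using ab
proof (induction i arbitrary: b)
  case (Suc i)
  note c = patD(1)[OF x] patD(1)[OF y]
  show ?case
  proof (cases "i = 0")
    case True
    then show ?thesis using Suc c eq by simp
  next
    case False
    have "(x ^\<^sub>m i) $$ (a, c) * x $$ (c, b) = (y ^\<^sub>m i) $$ (a, c) * y $$ (c, b)" if "c < m" for c
    proof (cases "b < c")
      case True
      have "(x ^\<^sub>m i) $$ (a, c) = (y ^\<^sub>m i) $$ (a, c)"
        using Suc True False that by (intro Suc.IH) auto
      \<comment> \<open>A nonzero entry of x^i at (a,c) forces a >= c + i, which leaves a distance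
        less than d for the last factor at (c,b).\<close>
      moreover have "x $$ (c, b) = y $$ (c, b)" if "(x ^\<^sub>m i) $$ (a, c) \<noteq> 0"
      proof -
        have "\<not> a < c + i" using lower_pow_eq_0[OF x, of a c i] Suc \<open>c < m\<close> that by auto
        then show ?thesis using Suc \<open>c < m\<close> by (intro eq) auto
      qed
      ultimately show ?thesis by auto
    next
      case False
      then show ?thesis
        using patD(2)[OF x, of c b] patD(2)[OF y, of c b] Suc that by (simp add: lower_def)
    qed
    then show ?thesis
      using Suc c by (simp add: index_mult_sum[of _ m] del: index_mult_mat)
  qed
qed simp

text \<open>Induction on the distance from the diagonal: exp x is 1 + x plus higher powers, and at a
  given distance the higher powers depend only on entries of x at smaller distance.\<close>

lemma inj_on_mexp: "inj_on (mexp m) (pat m (lower m) :: 'a::field mat set)"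
proof (rule inj_onI)
  fix x y :: "'a mat"
  assume x: "x \<in> pat m (lower m)" and y: "y \<in> pat m (lower m)" and e: "mexp m x = mexp m y"
  note c = patD(1)[OF x] patD(1)[OF y]
  have "x $$ (a, b) = y $$ (a, b)" if "a < m" "b < m" "a < b + d" for a b d
    using that
  proof (induction d arbitrary: a b)
    case 0
    then show ?case using patD(2)[OF x, of a b] patD(2)[OF y, of a b] by (simp add: lower_def)
  next
    case (Suc d)
    let ?h = "\<lambda>z i. 1 / of_nat (fact i) * (z ^\<^sub>m i) $$ (a, b)"
    have *: "mexp m z $$ (a, b) = ?h z 0 + z $$ (a, b) + (\<Sum>i<m. ?h z (i + 2))"
      if z: "z \<in> pat m (lower m)" for z :: "'a mat"
    proof -
      have "mexp m z $$ (a, b) = (\<Sum>i<Suc (Suc m). ?h z i)"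
        using Suc z by (intro mexp_index_bound) auto
      also have "\<dots> = ?h z 0 + z $$ (a, b) + (\<Sum>i<m. ?h z (i + 2))"
        unfolding sum.lessThan_Suc_shift using patD(1)[OF z] Suc by (simp add: add.assoc)
      finally show ?thesis .
    qed
    have "(x ^\<^sub>m (i + 2)) $$ (a, b) = (y ^\<^sub>m (i + 2)) $$ (a, b)" for i
      using Suc by (intro lower_pow_agree[OF x y, of d]) auto
    then show ?case using *[OF x] *[OF y] e c Suc by simp
  qed
  from this[of _ _ m] show "x = y" using c by (intro eq_matI) auto
qed

text \<open>The exponential is injective, so counting replaces the logarithm series.\<close>

lemma mexp_pat_image:
  assumes "trans P" "P \<subseteq> lower m"
  shows "mexp m ` pat m P = (upat m P :: 'a::{field,finite} mat set)"
proof
  show "mexp m ` pat m P \<subseteq> (upat m P :: 'a mat set)" using mexp_upat assms by blast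
  \<comment> \<open>Subtracting the identity makes the exponential a map of \<open>pat m P\<close>
    to itself, so that injectivity on a finite set yields surjectivity.\<close>
  let ?f = "\<lambda>x. mexp m x - 1\<^sub>m m"
  have sub: "?f ` (pat m P :: 'a mat set) \<subseteq> pat m P"
    using mexp_upat assms by (fastforce simp: upat_def)
  have "inj_on ?f (pat m P :: 'a mat set)"
  proof (rule inj_onI)
    fix x y :: "'a mat" assume xy: "x \<in> pat m P" "y \<in> pat m P" "?f x = ?f y"
    have "?f x + 1\<^sub>m m = mexp m x" "?f y + 1\<^sub>m m = mexp m y"
      by (intro eq_matI, auto)+
    then have "mexp m x = mexp m y" using xy by metis
    then show "x = y" using inj_onD[OF inj_on_mexp] xy pat_mono[OF assms(2)] by blast
  qed
  then have surj: "?f ` (pat m P :: 'a mat set) = pat m P"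
    using endo_inj_surj[OF finite_pat sub] by blast
  show "(upat m P :: 'a mat set) \<subseteq> mexp m ` pat m P"
  proof
    fix g :: "'a mat" assume g: "g \<in> upat m P"
    then obtain x where x: "x \<in> pat m P" "?f x = g - 1\<^sub>m m"
      using surj unfolding upat_def by (metis (no_types, lifting) imageE mem_Collect_eq)
    have "?f x + 1\<^sub>m m = mexp m x" "(g - 1\<^sub>m m) + 1\<^sub>m m = g"
      using upat_carrier[OF g] by (intro eq_matI, auto)+
    then have "g = mexp m x" using x by metis
    then show "g \<in> mexp m ` pat m P" using x by blast
  qed
qed

lemma pat_mult_right_unipotent:
  assumes "x \<in> pat m R" "g \<in> upat m P" "P O R \<subseteq> R"
  shows "g * x \<in> pat m R"
proof -
  have g: "g \<in> carrier_mat m m" "x \<in> carrier_mat m m" "g - 1\<^sub>m m \<in> pat m P"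
    using assms by (auto simp: upat_def pat_def)
  have "g * x = (1\<^sub>m m + (g - 1\<^sub>m m)) * x"
    using g by (intro arg_cong[of _ _ "\<lambda>h. h * x"]) auto
  also have "\<dots> = x + (g - 1\<^sub>m m) * x"
    using g by (subst add_mult_distrib_mat[of _ m m]) auto
  finally show ?thesis
    using pat_add[OF assms(1) pat_mult[OF g(3) assms(1,3)]] by simp
qed

section \<open>The orthogonal group of unitriangular matrices\<close>

text \<open>In the order $1, \ldots, n, (0), -n, \ldots, -1$ the index $-i$ sits at the position mirror to
  that of $i$, so \<open>sigma\<close> is the adjoint for the invariant symmetric form.\<close>

definition sigma :: "nat \<Rightarrow> 'a mat \<Rightarrow> 'a mat" where
  "sigma m x = mat m m (\<lambda>(a, b). x $$ (m - 1 - b, m - 1 - a))"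

definition skew :: "nat \<Rightarrow> 'a::field mat set" where
  "skew m = {x \<in> pat m (lower m). sigma m x = - x}"

definition UG :: "nat \<Rightarrow> 'a::field mat set" where
  "UG m = {g \<in> upat m (lower m). sigma m g * g = 1\<^sub>m m}"

lemma sigma_carrier [simp]: "sigma m x \<in> carrier_mat m m"
  by (simp add: sigma_def)

lemma sigma_dim [simp]: "dim_row (sigma m x) = m" "dim_col (sigma m x) = m"
  by (simp_all add: sigma_def)

lemma sigma_index [simp]:
  "a < m \<Longrightarrow> b < m \<Longrightarrow> sigma m x $$ (a, b) = x $$ (m - 1 - b, m - 1 - a)"
  by (simp add: sigma_def)

lemma sigma_sigma: "x \<in> carrier_mat m m \<Longrightarrow> sigma m (sigma m x) = x"
  by (intro eq_matI) auto

lemma sigma_uminus: "x \<in> carrier_mat m m \<Longrightarrow> sigma m (- x) = - sigma m x"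
  by (intro eq_matI) auto

lemma sigma_one: "sigma m (1\<^sub>m m :: 'a::{zero,one} mat) = 1\<^sub>m m"
  by (intro eq_matI) auto

lemma sum_reflect:
  fixes m :: nat
  shows "(\<Sum>c<m. F (m - 1 - c)) = (\<Sum>c<m. F c)"
  using sum.nat_diff_reindex[of F m] by simp

lemma sigma_mult:
  fixes x y :: "'a::comm_semiring_0 mat"
  assumes "x \<in> carrier_mat m m" "y \<in> carrier_mat m m"
  shows "sigma m (x * y) = sigma m y * sigma m x"
proof (rule eq_matI)
  fix a b assume "a < dim_row (sigma m y * sigma m x)" "b < dim_col (sigma m y * sigma m x)"
  then have ab: "a < m" "b < m" by auto
  let ?F = "\<lambda>c. x $$ (m - 1 - b, c) * y $$ (c, m - 1 - a)"
  have "sigma m (x * y) $$ (a, b) = (\<Sum>c<m. ?F c)"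
    using ab assms by (simp add: index_mult_sum[of _ m] del: index_mult_mat)
  also have "\<dots> = (\<Sum>c<m. ?F (m - 1 - c))" by (rule sum_reflect[symmetric])
  also have "\<dots> = (sigma m y * sigma m x) $$ (a, b)"
    using ab by (simp add: index_mult_sum[of _ m] mult.commute del: index_mult_mat)
  finally show "sigma m (x * y) $$ (a, b) = (sigma m y * sigma m x) $$ (a, b)" .
qed auto

lemma sigma_pow:
  fixes x :: "'a::comm_semiring_1 mat"
  assumes "x \<in> carrier_mat m m"
  shows "sigma m (x ^\<^sub>m i) = sigma m x ^\<^sub>m i"
proof (induction i)
  case 0
  show ?case using assms by (simp add: sigma_one)
next
  case (Suc i)
  have "sigma m (x ^\<^sub>m Suc i) = sigma m x * sigma m (x ^\<^sub>m i)"
    using sigma_mult[of "x ^\<^sub>m i" m x] assms by simp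
  then show ?case using Suc pow_mat_Suc_left[of "sigma m x" m i] by simp
qed

lemma sigma_mexp:
  assumes "x \<in> carrier_mat m m"
  shows "sigma m (mexp m x) = mexp m (sigma m x)"
  using assms by (intro eq_matI) (auto simp: mexp_index simp flip: sigma_pow)

lemma sigma_lower:
  assumes "x \<in> pat m (lower m)"
  shows "sigma m x \<in> pat m (lower m)"
proof (rule patI)
  fix a b assume "a < m" "b < m" "(a, b) \<notin> lower m"
  then show "sigma m x $$ (a, b) = 0"
    using patD(2)[OF assms, of "m - 1 - b" "m - 1 - a"] by (simp add: lower_def)
qed simp

lemma sigma_upat_lower:
  assumes "g \<in> upat m (lower m)"
  shows "sigma m g \<in> upat m (lower m)"
proof (rule upatI)
  fix a b assume ab: "a < m" "b < m" "(a, b) \<notin> lower m"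
  then have "(m - 1 - b, m - 1 - a) \<notin> lower m" by (auto simp: lower_def)
  moreover have "(m - 1 - b = m - 1 - a) = (a = b)" using ab by auto
  ultimately show "sigma m g $$ (a, b) = (if a = b then 1 else 0)"
    using upatD[OF assms, of "m - 1 - b" "m - 1 - a"] ab by simp
qed simp

lemma skewD:
  assumes "x \<in> skew m"
  shows "x \<in> pat m (lower m)" "x \<in> carrier_mat m m" "sigma m x = - x"
    "\<And>a b. a < m \<Longrightarrow> b < m \<Longrightarrow> x $$ (m - 1 - b, m - 1 - a) = - x $$ (a, b)"
    "\<And>a b. a < m \<Longrightarrow> b < m \<Longrightarrow> a \<le> b \<Longrightarrow> x $$ (a, b) = 0"
proof -
  show *: "x \<in> pat m (lower m)" "sigma m x = - x" using assms by (auto simp: skew_def)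
  then show "x \<in> carrier_mat m m" using patD by blast
  then show "x $$ (m - 1 - b, m - 1 - a) = - x $$ (a, b)" if "a < m" "b < m" for a b
    using arg_cong[OF *(2), of "\<lambda>z. z $$ (a, b)"] that by simp
  show "x $$ (a, b) = 0" if "a < m" "b < m" "a \<le> b" for a b
    using patD(2)[OF *(1) that(1,2)] that by (auto simp: lower_def)
qed

lemma finite_skew [simp]: "finite (skew m :: 'a::{field,finite} mat set)"
  by (rule finite_subset[of _ "pat m (lower m)"]) (auto simp: skew_def)

lemma finite_UG [simp]: "finite (UG m :: 'a::{field,finite} mat set)"
  by (rule finite_subset[of _ "upat m (lower m)"]) (auto simp: UG_def)

lemma skew_add: "x \<in> skew m \<Longrightarrow> y \<in> skew m \<Longrightarrow> x + y \<in> skew m"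
proof -
  assume x: "x \<in> skew m" and y: "y \<in> skew m"
  have "sigma m (x + y) = - (x + y)"
    using skewD(2,4)[OF x] skewD(2,4)[OF y] by (intro eq_matI) auto
  then show ?thesis using pat_add[OF skewD(1)[OF x] skewD(1)[OF y]] by (simp add: skew_def)
qed

lemma skew_uminus:
  assumes "x \<in> skew m"
  shows "- x \<in> skew m"
  using skewD(3)[OF assms] pat_uminus[OF skewD(1)[OF assms]]
  by (simp add: skew_def sigma_uminus[OF skewD(2)[OF assms]])

lemma skew_smult: "x \<in> skew m \<Longrightarrow> c \<cdot>\<^sub>m x \<in> skew m"
proof -
  assume x: "x \<in> skew m"
  have "sigma m (c \<cdot>\<^sub>m x) = - (c \<cdot>\<^sub>m x)"
    using skewD(2,4)[OF x] by (intro eq_matI) auto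
  then show ?thesis using pat_smult[OF skewD(1)[OF x]] by (simp add: skew_def)
qed

lemma zero_skew: "0\<^sub>m m m \<in> skew m"
proof -
  have "sigma m (0\<^sub>m m m :: 'a mat) = - 0\<^sub>m m m" by (intro eq_matI) auto
  then show ?thesis by (simp add: skew_def zero_pat)
qed

lemma UG_carrier: "g \<in> UG m \<Longrightarrow> g \<in> carrier_mat m m"
  by (auto simp: UG_def upat_def)

lemma one_UG: "1\<^sub>m m \<in> UG m"
  by (auto simp: UG_def one_upat sigma_one)

lemma UG_mult:
  assumes "g \<in> UG m" "h \<in> UG m"
  shows "g * h \<in> UG m"
proof -
  note c = UG_carrier[OF assms(1)] UG_carrier[OF assms(2)]
  have "sigma m (g * h) * (g * h) = sigma m h * (sigma m g * g) * h"
    using c by (simp add: sigma_mult assoc_mult_mat[of _ m m _ m _ m] mult_carrier_mat[of _ m m _ m])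
  also have "\<dots> = 1\<^sub>m m" using assms by (simp add: UG_def)
  finally show ?thesis using assms upat_mult[OF _ _ trans_lower] by (auto simp: UG_def)
qed

section \<open>The exponential from skew matrices onto the group\<close>

context
  fixes m :: nat
  assumes char: "m \<le> CHAR('a::{field,finite})"
begin

text \<open>Support and skewness are matched separately. Any g in \<open>upat m P\<close> is exp x
  with x in \<open>pat m P\<close>; then \<open>sigma m g * g = 1\<^sub>m m\<close> says that exp
  (sigma x) is a left inverse of exp x, hence equal to exp (-x), and injectivity gives sigma x =
  -x.\<close>

lemma mexp_skew_image:
  assumes "trans P" "P \<subseteq> lower m"
  shows "mexp m ` (skew m \<inter> pat m P) = (UG m \<inter> upat m P :: 'a mat set)"
proof (intro equalityI subsetI)
  fix g :: "'a mat" assume "g \<in> mexp m ` (skew m \<inter> pat m P)"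
  then obtain x where x: "x \<in> skew m" "x \<in> pat m P" "g = mexp m x" by blast
  have "sigma m g * g = 1\<^sub>m m"
    using mexp_uminus_mult[OF _ char] skewD(1-3)[OF x(1)] x(3) by (simp add: sigma_mexp)
  then show "g \<in> UG m \<inter> upat m P"
    using mexp_upat[OF x(2) assms(1)] mexp_upat[OF skewD(1)[OF x(1)] trans_lower] x(3)
    by (simp add: UG_def)
next
  fix g :: "'a mat" assume g: "g \<in> UG m \<inter> upat m P"
  then obtain x where x: "x \<in> pat m P" "mexp m x = g"
    using mexp_pat_image[OF assms, where ?'a = 'a] by (metis Int_iff imageE)
  have xl: "x \<in> pat m (lower m)" using x pat_mono[OF assms(2)] by blast
  note xc = patD(1)[OF xl]
  have 1: "mexp m (sigma m x) * mexp m x = 1\<^sub>m m"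
    using g x xc by (simp add: UG_def flip: sigma_mexp)
  have "mexp m (sigma m x) = mexp m (sigma m x) * (mexp m x * mexp m (- x))"
    using mexp_mult_uminus[OF xl char] right_mult_one_mat[OF mexp_carrier] by simp
  also have "\<dots> = mexp m (- x)"
    using 1 assoc_mult_mat[OF mexp_carrier mexp_carrier mexp_carrier, of m "sigma m x" x "- x"]
      left_mult_one_mat[OF mexp_carrier] by metis
  finally have "sigma m x = - x"
    using inj_onD[OF inj_on_mexp] sigma_lower[OF xl] pat_uminus[OF xl] by blast
  then show "g \<in> mexp m ` (skew m \<inter> pat m P)" using x xl by (auto simp: skew_def)
qed

lemma mexp_skew: "mexp m ` skew m = (UG m :: 'a mat set)"
proof -
  have "skew m \<inter> pat m (lower m) = (skew m :: 'a mat set)"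
    "UG m \<inter> upat m (lower m) = (UG m :: 'a mat set)"
    by (auto simp: skew_def UG_def)
  then show ?thesis using mexp_skew_image[OF trans_lower order_refl] by simp
qed

lemma inj_on_mexp_skew: "inj_on (mexp m) (skew m :: 'a mat set)"
  by (rule inj_on_subset[OF inj_on_mexp]) (auto simp: skew_def)

lemma sigma_mexp_skew:
  fixes x :: "'a mat"
  assumes "x \<in> skew m"
  shows "sigma m (mexp m x) = mexp m (- x)"
  using skewD(2,3)[OF assms] by (simp add: sigma_mexp)

lemma sigma_UG:
  fixes g :: "'a mat"
  assumes "g \<in> UG m"
  shows "sigma m g \<in> UG m" "sigma m g * g = 1\<^sub>m m" "g * sigma m g = 1\<^sub>m m"
proof -
  obtain x where x: "x \<in> skew m" "g = mexp m x" using assms mexp_skew by blast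
  have s: "sigma m g = mexp m (- x)" using x sigma_mexp_skew by simp
  then show "sigma m g \<in> UG m" using skew_uminus[OF x(1)] mexp_skew by blast
  show "sigma m g * g = 1\<^sub>m m" using assms by (simp add: UG_def)
  show "g * sigma m g = 1\<^sub>m m"
    using s x mexp_mult_uminus[OF skewD(1)[OF x(1)] char] by simp
qed

text \<open>P need not be symmetric under the reflection: for g = exp x the matrix
  \<open>sigma m g\<close> is exp (-x), and -x has the same support as x.\<close>

lemma sigma_UG_upat:
  fixes g :: "'a mat"
  assumes "g \<in> UG m" "g \<in> upat m P" "trans P" "P \<subseteq> lower m"
  shows "sigma m g \<in> upat m P"
proof -
  obtain x where x: "x \<in> skew m" "x \<in> pat m P" "g = mexp m x"
    using assms mexp_skew_image[OF assms(3,4)] by blast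
  then show ?thesis using sigma_mexp_skew mexp_upat[OF pat_uminus[OF x(2)] assms(3)] by simp
qed

lemma group_UG: "group \<lparr>carrier = (UG m :: 'a mat set), monoid.mult = (*), one = 1\<^sub>m m\<rparr>"
proof (rule groupI)
  fix x y z :: "'a mat"
  let ?G = "\<lparr>carrier = (UG m :: 'a mat set), monoid.mult = (*), one = 1\<^sub>m m\<rparr>"
  assume x: "x \<in> carrier ?G"
  show "\<exists>y\<in>carrier ?G. y \<otimes>\<^bsub>?G\<^esub> x = \<one>\<^bsub>?G\<^esub>"
    using sigma_UG[of x] x by auto
  show "\<one>\<^bsub>?G\<^esub> \<otimes>\<^bsub>?G\<^esub> x = x"
    using x UG_carrier[of x m] by simp
  assume y: "y \<in> carrier ?G"
  then show "x \<otimes>\<^bsub>?G\<^esub> y \<in> carrier ?G" using x UG_mult by auto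
  assume z: "z \<in> carrier ?G"
  then show "x \<otimes>\<^bsub>?G\<^esub> y \<otimes>\<^bsub>?G\<^esub> z = x \<otimes>\<^bsub>?G\<^esub> (y \<otimes>\<^bsub>?G\<^esub> z)"
    using x y by (simp add: assoc_mult_mat[of _ m m _ m _ m] mult_carrier_mat[of _ m m _ m] UG_carrier)
qed (simp add: one_UG)

lemma inv_UG:
  fixes g :: "'a mat"
  assumes "g \<in> UG m"
  shows "inv\<^bsub>\<lparr>carrier = UG m, monoid.mult = (*), one = 1\<^sub>m m\<rparr>\<^esub> g = sigma m g"
  using group.inv_equality[OF group_UG, of "sigma m g" g] sigma_UG[OF assms] assms by simp

lemma conj_skew:
  fixes g x :: "'a mat"
  assumes "g \<in> UG m" "x \<in> skew m"
  shows "sigma m g * x * g \<in> skew m"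
proof -
  note c = UG_carrier[OF assms(1)] skewD(2)[OF assms(2)]
  have u: "g \<in> upat m (lower m)" "sigma m g \<in> upat m (lower m)"
    using assms(1) sigma_upat_lower by (auto simp: UG_def)
  have "sigma m g * x * g \<in> pat m (lower m)"
    using pat_mult_left_unipotent[OF pat_mult_right_unipotent[OF skewD(1)[OF assms(2)] u(2)] u(1)]
      trans_O_subset[OF trans_lower] by blast
  moreover have "sigma m (sigma m g * x * g) = sigma m g * (- x) * g"
    using c skewD(3)[OF assms(2)]
    by (simp add: sigma_mult[of _ m] sigma_sigma assoc_mult_mat[of _ m m _ m _ m] mult_carrier_mat[of _ m m _ m])
  moreover have "sigma m g * (- x) * g = - (sigma m g * x * g)"
    using c by simp
  ultimately show ?thesis by (simp add: skew_def)
qed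

end

lemma pow_conj_mat:
  fixes x :: "'a::semiring_1 mat"
  assumes "s \<in> carrier_mat m m" "g \<in> carrier_mat m m" "x \<in> carrier_mat m m"
    and "g * s = 1\<^sub>m m" "s * g = 1\<^sub>m m"
  shows "(s * x * g) ^\<^sub>m i = s * x ^\<^sub>m i * g"
proof (induction i)
  case (Suc i)
  have "(s * x * g) ^\<^sub>m Suc i = s * x ^\<^sub>m i * (g * s) * x * g"
    using assms(1-3) Suc by (simp add: assoc_mult_mat[of _ m m _ m _ m] mult_carrier_mat[of _ m m _ m])
  then show ?case using assms by (simp add: assoc_mult_mat[of _ m m _ m _ m] mult_carrier_mat[of _ m m _ m])
qed (use assms in simp)

lemma index_mult3_sum:
  assumes "x \<in> carrier_mat m m" "y \<in> carrier_mat m m" "z \<in> carrier_mat m m" "a < m" "b < m"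
  shows "(x * y * z) $$ (a, b) = (\<Sum>d<m. \<Sum>c<m. x $$ (a, c) * y $$ (c, d) * z $$ (d, b))"
  using assms by (simp add: index_mult_sum[of _ m] sum_distrib_right mult.assoc del: index_mult_mat assoc_mult_mat)

lemma mexp_conj:
  assumes "s \<in> carrier_mat m m" "g \<in> carrier_mat m m" "x \<in> carrier_mat m m"
    and "g * s = 1\<^sub>m m" "s * g = 1\<^sub>m m"
  shows "mexp m (s * x * g) = s * mexp m x * g"
proof (rule eq_matI)
  fix a b assume "a < dim_row (s * mexp m x * g)" "b < dim_col (s * mexp m x * g)"
  then have ab: "a < m" "b < m" using assms by auto
  let ?e = "\<lambda>i. 1 / of_nat (fact i)"
  have "mexp m (s * x * g) $$ (a, b) = (\<Sum>i<m. ?e i * (s * x ^\<^sub>m i * g) $$ (a, b))"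
    using ab assms
    by (simp add: mexp_index[of _ m] mult_carrier_mat[of _ m m _ m] pow_conj_mat[of _ m]
        del: index_mult_mat assoc_mult_mat)
  also have "\<dots> = (\<Sum>i<m. \<Sum>d<m. \<Sum>c<m. s $$ (a, c) * (?e i * (x ^\<^sub>m i) $$ (c, d)) * g $$ (d, b))"
    using ab assms by (simp add: index_mult3_sum[of _ m] sum_distrib_left mult_ac del: index_mult_mat assoc_mult_mat)
  also have "\<dots> = (\<Sum>d<m. \<Sum>i<m. \<Sum>c<m. s $$ (a, c) * (?e i * (x ^\<^sub>m i) $$ (c, d)) * g $$ (d, b))"
    by (rule sum.swap)
  also have "\<dots> = (\<Sum>d<m. \<Sum>c<m. \<Sum>i<m. s $$ (a, c) * (?e i * (x ^\<^sub>m i) $$ (c, d)) * g $$ (d, b))"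
    by (intro sum.cong refl sum.swap)
  also have "\<dots> = (s * mexp m x * g) $$ (a, b)"
    using ab assms by (simp add: index_mult3_sum[of _ m] mexp_index sum_distrib_left sum_distrib_right del: index_mult_mat assoc_mult_mat)
  finally show "mexp m (s * x * g) $$ (a, b) = (s * mexp m x * g) $$ (a, b)" .
qed (use assms in auto)

section \<open>Semidirect decompositions\<close>

text \<open>Substitute for the Baker-Campbell-Hausdorff formula: exp x - exp y lies in the ideal R,
  and multiplying by exp (-y) turns this into exp x exp (-y) - 1 in R.\<close>

lemma mexp_quotient_upat:
  fixes x y :: "'a::{field,finite} mat"
  assumes x: "x \<in> pat m P" and y: "y \<in> pat m P" and xy: "x - y \<in> pat m R"
    and P: "trans P" "P \<subseteq> lower m" "R \<subseteq> P" "R O P \<subseteq> R" "P O R \<subseteq> R" and char: "m \<le> CHAR('a)"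
  shows "mexp m x * mexp m (- y) \<in> upat m R"
proof -
  have 1: "(mexp m x - mexp m y) * mexp m (- y) \<in> pat m R"
    using mexp_diff_pat[OF x y xy P(1,3-5)] mexp_upat[OF pat_uminus[OF y] P(1)] P(4)
    by (rule pat_mult_left_unipotent)
  have "(mexp m x - mexp m y) * mexp m (- y) = mexp m x * mexp m (- y) - 1\<^sub>m m"
    using mexp_mult_uminus[OF _ char, of y] y pat_mono[OF P(2), of m]
    by (subst minus_mult_distrib_mat[of _ m m]) auto
  then show ?thesis using 1 mult_carrier_mat[OF mexp_carrier mexp_carrier] by (simp add: upat_def)
qed

text \<open>If y represents x modulo the ideal R and has support Q disjoint from R, then (exp x exp
  (-y)) exp y decomposes exp x along A and B. Together with uniqueness this evaluates the
  descriptions in \<open>semi_left\<close> and \<open>semi_right\<close>.\<close>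

lemma semidirect_components:
  fixes x y :: "'a::{field,finite} mat"
  assumes x: "x \<in> skew m \<inter> pat m P" and y: "y \<in> skew m \<inter> pat m Q" and xy: "x - y \<in> pat m R"
    and P: "trans P" "P \<subseteq> lower m" "R \<subseteq> P" "R O P \<subseteq> R" "P O R \<subseteq> R"
    and Q: "trans Q" "Q \<subseteq> P" "Q \<inter> R = {}" and char: "m \<le> CHAR('a)"
    and G: "G = \<lparr>carrier = (UG m :: 'a mat set), monoid.mult = (*), one = 1\<^sub>m m\<rparr>"
    and A: "A = UG m \<inter> upat m R" and B: "B = UG m \<inter> upat m Q"
  shows "semi_left G A B (mexp m x) = mexp m x * mexp m (- y)"
    and "semi_right G A B (mexp m x) = mexp m y"
    and "mexp m x * mexp m (- y) \<in> A" and "mexp m y \<in> B"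
proof -
  let ?a = "mexp m x * mexp m (- y)" and ?b = "mexp m y"
  have QL: "Q \<subseteq> lower m" and R: "trans R" "R \<subseteq> lower m" using P Q by (auto intro!: transI)
  have yP: "y \<in> pat m P" using y pat_mono[OF Q(2)] by blast
  have "?a \<in> UG m"
    using UG_mult mexp_skew[OF char] x y skew_uminus by blast
  then show a: "?a \<in> A" using mexp_quotient_upat[OF _ yP xy P char] x A by simp
  show b: "?b \<in> B" using mexp_skew_image[OF char Q(1) QL] y B by blast
  have prod: "mexp m x = ?a * ?b"
    using mexp_uminus_mult[OF _ char, of y] y
    by (simp add: assoc_mult_mat[of _ m m _ m _ m] mult_carrier_mat[of _ m m _ m] skewD(1))
  have uniq: "a' = ?a \<and> b' = ?b" if "a' \<in> A" "b' \<in> B" "mexp m x = a' * b'" for a' b'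
  proof -
    have U: "a' \<in> UG m" "b' \<in> UG m" "?a \<in> UG m" "?b \<in> UG m" using that a b A B by auto
    note c = UG_carrier[OF U(1)] UG_carrier[OF U(2)] UG_carrier[OF U(3)] UG_carrier[OF U(4)]
    \<comment> \<open>From a' b' = a b one gets a'^(-1) a = b' b^(-1). The left side lies in
      \<open>upat m R\<close> and the right side in \<open>upat m Q\<close>; as R and Q are
      disjoint, both are 1.\<close>
    let ?d = "sigma m a' * ?a"
    have eq: "?d * ?b = b'"
    proof -
      have "?d * ?b = sigma m a' * (?a * ?b)" using c by (simp add: assoc_mult_mat[of _ m m _ m _ m] mult_carrier_mat[of _ m m _ m])
      also have "\<dots> = sigma m a' * (a' * b')" using prod that(3) by metis
      also have "\<dots> = (sigma m a' * a') * b'" using c by (simp add: assoc_mult_mat[of _ m m _ m _ m] mult_carrier_mat[of _ m m _ m])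
      finally show ?thesis using sigma_UG[OF char U(1)] c by simp
    qed
    have "?d = ?d * (?b * sigma m ?b)" using sigma_UG[OF char U(4)] c by simp
    also have "\<dots> = (?d * ?b) * sigma m ?b"
      by (rule assoc_mult_mat[symmetric, of _ m m _ m _ m]) (use c in auto)
    also have "\<dots> = b' * sigma m ?b" using eq by simp
    finally have d: "?d = b' * sigma m ?b" .
    have dR: "?d \<in> upat m R"
      using that(1) a A U(1) sigma_UG_upat[OF char U(1) _ R] upat_mult[OF _ _ R(1)] by blast
    have dQ: "?d \<in> upat m Q"
      unfolding d using that(2) b B U(4) sigma_UG_upat[OF char U(4) _ Q(1) QL] upat_mult[OF _ _ Q(1)] by blast
    have "?d = 1\<^sub>m m"
    proof (rule eq_matI)
      fix i j assume "i < dim_row (1\<^sub>m m :: 'a mat)" "j < dim_col (1\<^sub>m m :: 'a mat)"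
      then have ij: "i < m" "j < m" by auto
      have "(i, j) \<notin> R \<or> (i, j) \<notin> Q" using Q(3) by blast
      then show "?d $$ (i, j) = 1\<^sub>m m $$ (i, j)"
        using upatD[OF dR ij] upatD[OF dQ ij] ij by auto
    qed (use c in auto)
    then have bb: "b' = ?b" using eq c by simp
    have "a' = a' * ?d" using \<open>?d = 1\<^sub>m m\<close> c by simp
    also have "\<dots> = (a' * sigma m a') * ?a" using c by (simp add: assoc_mult_mat[of _ m m _ m _ m] mult_carrier_mat[of _ m m _ m])
    also have "\<dots> = ?a" using sigma_UG[OF char U(1)] c by simp
    finally show ?thesis using bb by simp
  qed
  show "semi_left G A B (mexp m x) = ?a"
    unfolding semi_left_def
  proof (rule the_equality)
    show "?a \<in> A \<and> (\<exists>b\<in>B. mexp m x = ?a \<otimes>\<^bsub>G\<^esub> b)"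
      using a b prod by (auto simp: G)
    show "\<And>a. a \<in> A \<and> (\<exists>b\<in>B. mexp m x = a \<otimes>\<^bsub>G\<^esub> b) \<Longrightarrow> a = ?a"
      using uniq by (auto simp: G)
  qed
  show "semi_right G A B (mexp m x) = ?b"
    unfolding semi_right_def
  proof (rule the_equality)
    show "?b \<in> B \<and> (\<exists>a\<in>A. mexp m x = a \<otimes>\<^bsub>G\<^esub> ?b)"
      using a b prod by (auto simp: G)
    show "\<And>b. b \<in> B \<and> (\<exists>a\<in>A. mexp m x = a \<otimes>\<^bsub>G\<^esub> b) \<Longrightarrow> b = ?b"
      using uniq by (auto simp: G)
  qed
qed

section \<open>Linear forms and the coadjoint action\<close>

definition form :: "nat \<Rightarrow> ('a::field mat \<Rightarrow> 'a) \<Rightarrow> bool" where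
  "form m \<mu> \<longleftrightarrow> \<mu> \<in> extensional (skew m) \<and>
     (\<forall>x\<in>skew m. \<forall>y\<in>skew m. \<mu> (x + y) = \<mu> x + \<mu> y) \<and>
     (\<forall>x\<in>skew m. \<forall>a. \<mu> (a \<cdot>\<^sub>m x) = a * \<mu> x)"

definition form_add :: "nat \<Rightarrow> ('a::field mat \<Rightarrow> 'a) \<Rightarrow> ('a mat \<Rightarrow> 'a) \<Rightarrow> 'a mat \<Rightarrow> 'a" where
  "form_add m \<mu> \<nu> = (\<lambda>x\<in>skew m. \<mu> x + \<nu> x)"

definition form_smult :: "nat \<Rightarrow> 'a \<Rightarrow> ('a::field mat \<Rightarrow> 'a) \<Rightarrow> 'a mat \<Rightarrow> 'a" where
  "form_smult m a \<mu> = (\<lambda>x\<in>skew m. a * \<mu> x)"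

text \<open>On \<open>UG m\<close> the reflection \<open>sigma m g\<close> is the inverse of g, so
  this is the coadjoint action without reference to a group record.\<close>

definition coad :: "nat \<Rightarrow> 'a mat \<Rightarrow> ('a mat \<Rightarrow> 'a) \<Rightarrow> 'a::field mat \<Rightarrow> 'a" where
  "coad m g \<mu> = (\<lambda>x\<in>skew m. \<mu> (sigma m g * x * g))"

definition orb :: "nat \<Rightarrow> ('a mat \<Rightarrow> 'a) \<Rightarrow> ('a::field mat \<Rightarrow> 'a) set" where
  "orb m \<mu> = (\<lambda>g. coad m g \<mu>) ` UG m"

lemma formI:
  assumes "\<mu> \<in> extensional (skew m)"
    and "\<And>x y. x \<in> skew m \<Longrightarrow> y \<in> skew m \<Longrightarrow> \<mu> (x + y) = \<mu> x + \<mu> y"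
    and "\<And>x a. x \<in> skew m \<Longrightarrow> \<mu> (a \<cdot>\<^sub>m x) = a * \<mu> x"
  shows "form m \<mu>"
  using assms by (simp add: form_def)

lemma formD:
  assumes "form m \<mu>"
  shows "\<mu> \<in> extensional (skew m)"
    and "\<And>x y. x \<in> skew m \<Longrightarrow> y \<in> skew m \<Longrightarrow> \<mu> (x + y) = \<mu> x + \<mu> y"
    and "\<And>x a. x \<in> skew m \<Longrightarrow> \<mu> (a \<cdot>\<^sub>m x) = a * \<mu> x"
  using assms by (simp_all add: form_def)

lemma form_eqI:
  assumes "form m \<mu>" "form m \<nu>" "\<And>x. x \<in> skew m \<Longrightarrow> \<mu> x = \<nu> x"
  shows "\<mu> = \<nu>"
  using assms formD(1) by (blast intro: extensionalityI)

lemma finite_forms: "finite {\<mu> :: 'a::{field,finite} mat \<Rightarrow> 'a. form m \<mu>}"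
proof (rule finite_subset)
  show "{\<mu> :: 'a mat \<Rightarrow> 'a. form m \<mu>} \<subseteq> skew m \<rightarrow>\<^sub>E UNIV"
    by (auto simp: form_def PiE_def)
qed (auto intro: finite_PiE)

lemma form_add_apply: "x \<in> skew m \<Longrightarrow> form_add m \<mu> \<nu> x = \<mu> x + \<nu> x"
  by (simp add: form_add_def)

lemma form_smult_apply: "x \<in> skew m \<Longrightarrow> form_smult m a \<mu> x = a * \<mu> x"
  by (simp add: form_smult_def)

lemma form_form_add: "form m \<mu> \<Longrightarrow> form m \<nu> \<Longrightarrow> form m (form_add m \<mu> \<nu>)"
  by (rule formI)
    (auto simp: form_add_def formD(2,3)[of m] skew_add skew_smult algebra_simps)

lemma form_form_smult: "form m \<mu> \<Longrightarrow> form m (form_smult m a \<mu>)"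
  by (rule formI)
    (auto simp: form_smult_def formD(2,3)[of m] skew_add skew_smult algebra_simps)

lemma conj_add:
  fixes s x y g :: "'a::field mat"
  assumes "s \<in> carrier_mat m m" "g \<in> carrier_mat m m" "x \<in> carrier_mat m m" "y \<in> carrier_mat m m"
  shows "s * (x + y) * g = s * x * g + s * y * g"
  using assms
  by (simp add: mult_add_distrib_mat[of _ m m] add_mult_distrib_mat[of _ m m]
      mult_carrier_mat[of _ m m _ m] del: assoc_mult_mat)

lemma conj_smult:
  fixes s x g :: "'a::field mat"
  assumes "s \<in> carrier_mat m m" "g \<in> carrier_mat m m" "x \<in> carrier_mat m m"
  shows "s * (a \<cdot>\<^sub>m x) * g = a \<cdot>\<^sub>m (s * x * g)"
  using assms
  by (simp add: mult_smult_distrib[of _ m m] mult_smult_assoc_mat[of _ m m]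
      mult_carrier_mat[of _ m m _ m] del: assoc_mult_mat)

context
  fixes m :: nat
  assumes char: "m \<le> CHAR('a::{field,finite})"
begin

lemma form_coad:
  fixes \<mu> :: "'a mat \<Rightarrow> 'a"
  assumes g: "g \<in> UG m" and \<mu>: "form m \<mu>"
  shows "form m (coad m g \<mu>)"
proof (rule formI)
  show "coad m g \<mu> \<in> extensional (skew m)" by (simp add: coad_def)
next
  fix x y :: "'a mat" assume xy: "x \<in> skew m" "y \<in> skew m"
  show "coad m g \<mu> (x + y) = coad m g \<mu> x + coad m g \<mu> y"
    using xy formD(2)[OF \<mu> conj_skew[OF char g xy(1)] conj_skew[OF char g xy(2)]]
    by (simp add: coad_def skew_add conj_add[of _ m] UG_carrier[OF g] skewD(2) del: assoc_mult_mat)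
next
  fix x :: "'a mat" and a assume x: "x \<in> skew m"
  show "coad m g \<mu> (a \<cdot>\<^sub>m x) = a * coad m g \<mu> x"
    using x formD(3)[OF \<mu> conj_skew[OF char g x]]
    by (simp add: coad_def skew_smult conj_smult[of _ m] UG_carrier[OF g] skewD(2) del: assoc_mult_mat)
qed

lemma coad_mult:
  fixes g h :: "'a mat"
  assumes "g \<in> UG m" "h \<in> UG m"
  shows "coad m (g * h) \<mu> = coad m g (coad m h \<mu>)"
proof
  fix x
  note c = UG_carrier[OF assms(1)] UG_carrier[OF assms(2)]
  show "coad m (g * h) \<mu> x = coad m g (coad m h \<mu>) x"
  proof (cases "x \<in> skew m")
    case True
    have "sigma m (g * h) * x * (g * h) = sigma m h * (sigma m g * x * g) * h"
      using c skewD(2)[OF True]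
      by (simp add: sigma_mult[of _ m] assoc_mult_mat[of _ m m _ m _ m] mult_carrier_mat[of _ m m _ m])
    then show ?thesis
      using True conj_skew[OF char assms(1) True] by (simp add: coad_def del: assoc_mult_mat)
  qed (simp add: coad_def)
qed

lemma coad_one:
  fixes \<mu> :: "'a mat \<Rightarrow> 'a"
  assumes "form m \<mu>"
  shows "coad m (1\<^sub>m m) \<mu> = \<mu>"
proof
  fix x
  show "coad m (1\<^sub>m m) \<mu> x = \<mu> x"
  proof (cases "x \<in> skew m")
    case True
    then show ?thesis using skewD(2)[OF True]
      by (simp add: coad_def sigma_one left_mult_one_mat[of _ m m] right_mult_one_mat[of _ m m])
  next
    case False
    then show ?thesis using formD(1)[OF assms] by (simp add: coad_def extensional_def)
  qed
qed

lemma coad_sigma: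
  fixes \<mu> :: "'a mat \<Rightarrow> 'a"
  assumes "form m \<mu>" "g \<in> UG m"
  shows "coad m (sigma m g) (coad m g \<mu>) = \<mu>" "coad m g (coad m (sigma m g) \<mu>) = \<mu>"
  using sigma_UG[OF char assms(2)] assms coad_mult[of "sigma m g" g \<mu>] coad_mult[of g "sigma m g" \<mu>]
    coad_one[OF assms(1)] by simp_all

lemma orb_form:
  fixes \<mu> :: "'a mat \<Rightarrow> 'a"
  assumes "form m \<mu>" "\<nu> \<in> orb m \<mu>"
  shows "form m \<nu>"
  using assms form_coad by (auto simp: orb_def)

lemma orb_refl:
  fixes \<mu> :: "'a mat \<Rightarrow> 'a"
  assumes "form m \<mu>"
  shows "\<mu> \<in> orb m \<mu>"
  using coad_one[OF assms] one_UG by (force simp: orb_def)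

lemma orb_coad:
  fixes \<mu> :: "'a mat \<Rightarrow> 'a"
  assumes "\<nu> \<in> orb m \<mu>" "g \<in> UG m"
  shows "coad m g \<nu> \<in> orb m \<mu>"
proof -
  obtain h where h: "h \<in> UG m" "\<nu> = coad m h \<mu>" using assms(1) by (auto simp: orb_def)
  then show ?thesis
    using coad_mult[OF assms(2) h(1), of \<mu>] UG_mult[OF assms(2) h(1)]
    unfolding orb_def by (metis imageI)
qed

lemma finite_orb: "finite (orb m (\<mu> :: 'a mat \<Rightarrow> 'a))"
  by (simp add: orb_def)

section \<open>Averages over the group and over orbits\<close>

lemma sum_UG_mult_right:
  fixes g :: "'a mat" and F :: "'a mat \<Rightarrow> 'b::comm_monoid_add"
  assumes "g \<in> UG m"
  shows "(\<Sum>x\<in>UG m. F (x * g)) = (\<Sum>x\<in>UG m. F x)"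
proof (rule sum.reindex_bij_witness[of _ "\<lambda>x. x * sigma m g" "\<lambda>x. x * g"])
  fix a :: "'a mat" assume a: "a \<in> UG m"
  note c = UG_carrier[OF a] UG_carrier[OF assms]
  show "a * g * sigma m g = a" "a * sigma m g * g = a"
    using sigma_UG[OF char assms] c by (simp_all add: assoc_mult_mat[of _ m m _ m _ m])
  show "a * g \<in> UG m" "a * sigma m g \<in> UG m"
    using UG_mult a assms sigma_UG[OF char assms] by blast+
qed simp

text \<open>Replacing f by g.f amounts to a right translation of the summation variable x.\<close>

lemma sum_coad_orb:
  fixes f :: "'a mat \<Rightarrow> 'a" and F :: "('a mat \<Rightarrow> 'a) \<Rightarrow> complex"
  assumes "\<mu> \<in> orb m f"
  shows "(\<Sum>x\<in>UG m. F (coad m x \<mu>)) = (\<Sum>x\<in>UG m. F (coad m x f))"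
proof -
  obtain g where g: "g \<in> UG m" "\<mu> = coad m g f" using assms by (auto simp: orb_def)
  have "(\<Sum>x\<in>UG m. F (coad m x \<mu>)) = (\<Sum>x\<in>UG m. F (coad m (x * g) f))"
    using g coad_mult by (intro sum.cong) auto
  then show ?thesis using sum_UG_mult_right[OF g(1), of "\<lambda>x. F (coad m x f)"] by simp
qed

text \<open>Double count of F (x.\<mu>) over group elements x and orbit elements \<mu>: for fixed
  \<mu> the sum over x does not depend on \<mu>, and for fixed x the action permutes the orbit. This
  takes the role of the orbit-stabilizer theorem.\<close>

lemma card_orb_sum:
  fixes f :: "'a mat \<Rightarrow> 'a" and F :: "('a mat \<Rightarrow> 'a) \<Rightarrow> complex"
  assumes f: "form m f"
  shows "of_nat (card (orb m f)) * (\<Sum>x\<in>UG m. F (coad m x f))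
    = of_nat (card (UG m :: 'a mat set)) * (\<Sum>\<nu>\<in>orb m f. F \<nu>)"
proof -
  have 1: "(\<Sum>x\<in>UG m. F (coad m x \<mu>)) = (\<Sum>x\<in>UG m. F (coad m x f))" if "\<mu> \<in> orb m f" for \<mu>
    using that by (rule sum_coad_orb)
  have 2: "(\<Sum>\<mu>\<in>orb m f. F (coad m x \<mu>)) = (\<Sum>\<mu>\<in>orb m f. F \<mu>)" if x: "x \<in> UG m" for x
    using coad_sigma[OF orb_form[OF f] x] orb_coad sigma_UG(1)[OF char x] x
    by (intro sum.reindex_bij_witness[of _ "coad m (sigma m x)" "coad m x"]) auto
  have "of_nat (card (orb m f)) * (\<Sum>x\<in>UG m. F (coad m x f)) = (\<Sum>\<mu>\<in>orb m f. \<Sum>x\<in>UG m. F (coad m x \<mu>))"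
    using 1 by simp
  also have "\<dots> = (\<Sum>x\<in>UG m. \<Sum>\<mu>\<in>orb m f. F (coad m x \<mu>))" by (rule sum.swap)
  also have "\<dots> = of_nat (card (UG m :: 'a mat set)) * (\<Sum>\<nu>\<in>orb m f. F \<nu>)" using 2 by simp
  finally show ?thesis .
qed

end

section \<open>Additive characters and annihilators\<close>

context
  fixes \<theta> :: "'a::{field,finite} \<Rightarrow> complex"
  assumes nonzero: "\<And>a. \<theta> a \<noteq> 0" and add: "\<And>a b. \<theta> (a + b) = \<theta> a * \<theta> b"
    and nontrivial: "\<exists>a. \<theta> a \<noteq> 1"
begin

lemma additive_char_zero: "\<theta> 0 = 1"
  using add[of 0 0] nonzero[of 0] by simp

text \<open>The shift s permutes S and multiplies the sum by \<theta> a, which is not 1. The shift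
  is kept abstract so that the argument serves sums over forms as well as sums over
  matrices.\<close>

lemma additive_char_shift_zero:
  assumes "finite S" "inj_on s S" "s ` S \<subseteq> S" "\<And>x. x \<in> S \<Longrightarrow> v (s x) = v x + a" "\<theta> a \<noteq> 1"
  shows "(\<Sum>x\<in>S. \<theta> (v x)) = 0"
proof -
  have "s ` S = S" using assms endo_inj_surj by blast
  then have "(\<Sum>x\<in>S. \<theta> (v x)) = (\<Sum>x\<in>S. \<theta> (v (s x)))"
    using sum.reindex[OF assms(2), of "\<lambda>x. \<theta> (v x)"] by simp
  also have "\<dots> = \<theta> a * (\<Sum>x\<in>S. \<theta> (v x))"
    using assms(4) by (simp add: add sum_distrib_left mult.commute)
  finally show ?thesis using assms(5) by simp
qed

lemma additive_char_scale:
  assumes "v \<noteq> 0"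
  shows "\<exists>a. \<theta> (a * v) \<noteq> 1"
proof -
  obtain b where "\<theta> b \<noteq> 1" using nontrivial by blast
  then show ?thesis using assms by (intro exI[of _ "b / v"]) simp
qed

lemma sum_additive_char_forms:
  fixes S :: "('a mat \<Rightarrow> 'a) set"
  assumes S: "S \<subseteq> {\<mu>. form m \<mu>}" and x: "x \<in> skew m"
    and cl: "\<And>\<mu> \<nu>. \<mu> \<in> S \<Longrightarrow> \<nu> \<in> S \<Longrightarrow> form_add m \<mu> \<nu> \<in> S"
      "\<And>\<mu> a. \<mu> \<in> S \<Longrightarrow> form_smult m a \<mu> \<in> S"
  shows "(\<Sum>\<nu>\<in>S. \<theta> (\<nu> x)) = (if \<forall>\<nu>\<in>S. \<nu> x = 0 then of_nat (card S) else 0)"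
proof (cases "\<forall>\<nu>\<in>S. \<nu> x = 0")
  case True
  then have "(\<Sum>\<nu>\<in>S. \<theta> (\<nu> x)) = (\<Sum>\<nu>\<in>S. 1)"
    by (intro sum.cong) (auto simp: additive_char_zero)
  then show ?thesis using True by simp
next
  case False
  then obtain \<mu> where \<mu>: "\<mu> \<in> S" "\<mu> x \<noteq> 0" by blast
  obtain a where a: "\<theta> (a * \<mu> x) \<noteq> 1" using additive_char_scale[OF \<mu>(2)] by blast
  let ?\<mu> = "form_smult m a \<mu>"
  have "(\<Sum>\<nu>\<in>S. \<theta> (\<nu> x)) = 0"
  proof (rule additive_char_shift_zero[where s = "\<lambda>\<nu>. form_add m \<nu> ?\<mu>" and v = "\<lambda>\<nu>. \<nu> x"])
    show "finite S" using S finite_forms finite_subset by blast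
    show "inj_on (\<lambda>\<nu>. form_add m \<nu> ?\<mu>) S"
    proof (rule inj_onI)
      fix \<nu> \<nu>' assume n: "\<nu> \<in> S" "\<nu>' \<in> S" "form_add m \<nu> ?\<mu> = form_add m \<nu>' ?\<mu>"
      have "\<nu> y = \<nu>' y" if "y \<in> skew m" for y
        using fun_cong[OF n(3), of y] that by (simp add: form_add_def)
      then show "\<nu> = \<nu>'" using n S by (intro form_eqI[of m]) auto
    qed
    show "(\<lambda>\<nu>. form_add m \<nu> ?\<mu>) ` S \<subseteq> S" using cl \<mu> by blast
    show "form_add m \<nu> ?\<mu> x = \<nu> x + a * \<mu> x" for \<nu>
      using x by (simp add: form_add_def form_smult_def)
  qed (rule a)
  then show ?thesis using False by argo
qed

lemma sum_additive_char_skew: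
  fixes \<nu> :: "'a mat \<Rightarrow> 'a"
  assumes \<nu>: "form m \<nu>"
  shows "(\<Sum>x\<in>skew m. \<theta> (\<nu> x))
    = (if \<forall>x\<in>skew m. \<nu> x = 0 then of_nat (card (skew m :: 'a mat set)) else 0)"
proof (cases "\<forall>x\<in>skew m. \<nu> x = 0")
  case True
  then show ?thesis by (simp add: additive_char_zero)
next
  case False
  then obtain x where x: "x \<in> skew m" "\<nu> x \<noteq> 0" by blast
  obtain a where a: "\<theta> (a * \<nu> x) \<noteq> 1" using additive_char_scale[OF x(2)] by blast
  let ?x = "a \<cdot>\<^sub>m x"
  have sx: "?x \<in> skew m" using x skew_smult by blast
  have "(\<Sum>x\<in>skew m. \<theta> (\<nu> x)) = 0"
  proof (rule additive_char_shift_zero[where s = "\<lambda>y. y + ?x"])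
    show "inj_on (\<lambda>y. y + ?x) (skew m)"
    proof (rule inj_onI)
      fix y z assume yz: "y \<in> skew m" "z \<in> skew m" "y + ?x = z + ?x"
      note c = skewD(2)[OF yz(1)] skewD(2)[OF yz(2)] skewD(2)[OF sx]
      have "y $$ (i, j) = z $$ (i, j)" if "i < m" "j < m" for i j
        using arg_cong[OF yz(3), of "\<lambda>w. w $$ (i, j)"] that c by (simp del: index_smult_mat)
      then show "y = z" using c by (intro eq_matI) auto
    qed
    show "(\<lambda>y. y + ?x) ` skew m \<subseteq> skew m" using sx skew_add by blast
    show "\<And>y. y \<in> skew m \<Longrightarrow> \<nu> (y + ?x) = \<nu> y + a * \<nu> x"
      using formD(2,3)[OF \<nu>] sx x by simp
  qed (use a in auto)
  then show ?thesis using False by argo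
qed

text \<open>The sum of \<theta> (\<nu> x) over S and u is evaluated in both orders. Summing over S
  first leaves |S| for each annihilated x; summing over u first leaves |u| for the zero form
  alone.\<close>

lemma card_annihilator:
  fixes S :: "('a mat \<Rightarrow> 'a) set"
  assumes S: "S \<subseteq> {\<mu>. form m \<mu>}" "S \<noteq> {}"
    and cl: "\<And>\<mu> \<nu>. \<mu> \<in> S \<Longrightarrow> \<nu> \<in> S \<Longrightarrow> form_add m \<mu> \<nu> \<in> S"
      "\<And>\<mu> a. \<mu> \<in> S \<Longrightarrow> form_smult m a \<mu> \<in> S"
  shows "card S * card {x \<in> skew m. \<forall>\<nu>\<in>S. \<nu> x = 0} = card (skew m :: 'a mat set)"
proof -
  let ?A = "{x \<in> skew m. \<forall>\<nu>\<in>S. \<nu> x = 0}"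
  let ?z = "\<lambda>x\<in>skew m. 0 :: 'a"
  obtain \<mu> where \<mu>: "\<mu> \<in> S" using S by blast
  have "form_smult m 0 \<mu> = ?z" by (auto simp: form_smult_def)
  then have z: "?z \<in> S" using cl(2)[OF \<mu>, of 0] by simp
  have fin: "finite S" using S finite_forms finite_subset by blast
  have "(\<Sum>x\<in>skew m. \<Sum>\<nu>\<in>S. \<theta> (\<nu> x)) = (\<Sum>x\<in>skew m. if x \<in> ?A then of_nat (card S) else 0)"
    using sum_additive_char_forms[OF S(1) _ cl] by (intro sum.cong) auto
  also have "\<dots> = (\<Sum>x\<in>?A. of_nat (card S))"
    by (intro sum.mono_neutral_cong_right) auto
  finally have 1: "(\<Sum>x\<in>skew m. \<Sum>\<nu>\<in>S. \<theta> (\<nu> x)) = of_nat (card S * card ?A)" by simp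
  have eq: "(\<forall>x\<in>skew m. \<nu> x = 0) \<longleftrightarrow> \<nu> = ?z" if "\<nu> \<in> S" for \<nu>
  proof
    assume "\<forall>x\<in>skew m. \<nu> x = 0"
    then show "\<nu> = ?z" using that z S by (intro form_eqI[of m]) auto
  qed auto
  have "(\<Sum>\<nu>\<in>S. \<Sum>x\<in>skew m. \<theta> (\<nu> x))
      = (\<Sum>\<nu>\<in>S. if \<nu> = ?z then of_nat (card (skew m :: 'a mat set)) else 0)"
  proof (rule sum.cong[OF refl])
    fix \<nu> assume n: "\<nu> \<in> S"
    then have "form m \<nu>" using S(1) by blast
    then show "(\<Sum>x\<in>skew m. \<theta> (\<nu> x)) = (if \<nu> = ?z then of_nat (card (skew m :: 'a mat set)) else 0)"
      using sum_additive_char_skew[of m \<nu>] eq[OF n] by argo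
  qed
  also have "\<dots> = of_nat (card (skew m :: 'a mat set))" using z fin by simp
  finally have "(of_nat (card S * card ?A) :: complex) = of_nat (card (skew m :: 'a mat set))"
    using 1 sum.swap[of "\<lambda>x \<nu>. \<theta> (\<nu> x)" S "skew m"] by simp
  then show ?thesis using of_nat_eq_iff by blast
qed

end

section \<open>The inductive step for orbits\<close>

text \<open>Positions are counted from 0, so 0 and m - 1 carry the indices 1 and -1. With K = {k}
  the position k and its mirror image go as well; for beta_1 = eps_1 these two coincide in the
  middle, so that B_n loses three positions and becomes D_(n-1).\<close>

definition kept :: "nat \<Rightarrow> nat set \<Rightarrow> nat set" where
  "kept m K = {a. 1 \<le> a \<and> a < m - 1 \<and> a \<notin> K \<and> m - 1 - a \<notin> K}"

definition row_pat :: "nat \<Rightarrow> nat set \<Rightarrow> (nat \<times> nat) set" where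
  "row_pat m K = {(a, b). b < a \<and> a < m \<and> (a \<in> K \<longrightarrow> b = 0)}"

text \<open>\<open>row_pat\<close> intersected with its mirror image and enlarged by the diagonal.
  It contains the supports of the Lie algebra elements and of the group elements, so that one
  multiplicativity statement for \<open>tau\<close> covers both.\<close>

definition sym_pat :: "nat \<Rightarrow> nat set \<Rightarrow> (nat \<times> nat) set" where
  "sym_pat m K = {(a, b). b \<le> a \<and> a < m \<and> (a \<in> K \<longrightarrow> b = 0 \<or> b = a) \<and>
     (m - 1 - b \<in> K \<longrightarrow> a = m - 1 \<or> b = a)}"

text \<open>The support of u_1: a root vector of column 1 has its entry 1 in the first column and
  its mirror entry in the last row. The corner (m - 1, 0) is included, but skew matrices vanish
  there in odd characteristic.\<close>

definition edge_pat :: "nat \<Rightarrow> (nat \<times> nat) set" where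
  "edge_pat m = {(a, b). b < a \<and> a < m \<and> (b = 0 \<or> a = m - 1)}"

text \<open>\<open>K\<close> is empty or consists of the row of the first root; \<open>tau\<close> extracts the submatrix on the
  positions kept in the smaller root system, enumerated by \<open>\<iota>\<close>.\<close>

definition tau :: "nat \<Rightarrow> (nat \<Rightarrow> nat) \<Rightarrow> 'a mat \<Rightarrow> 'a mat" where
  "tau n \<iota> x = mat n n (\<lambda>(a, b). x $$ (\<iota> a, \<iota> b))"

lemma trans_row_pat: "trans (row_pat m K)"
  by (auto simp: row_pat_def intro!: transI)

lemma row_pat_lower: "row_pat m K \<subseteq> lower m"
  by (auto simp: row_pat_def lower_def)

lemma trans_sym_pat: "trans (sym_pat m K)"
  by (force simp: sym_pat_def intro!: transI)

lemma trans_edge_pat: "trans (edge_pat m)"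
  by (auto simp: edge_pat_def intro!: transI)

lemma edge_pat_lower: "edge_pat m \<subseteq> lower m"
  by (auto simp: edge_pat_def lower_def)

lemma tau_carrier [simp]: "tau n \<iota> x \<in> carrier_mat n n"
  by (simp add: tau_def)

lemma tau_dim [simp]: "dim_row (tau n \<iota> x) = n" "dim_col (tau n \<iota> x) = n"
  by (simp_all add: tau_def)

lemma tau_index [simp]: "a < n \<Longrightarrow> b < n \<Longrightarrow> tau n \<iota> x $$ (a, b) = x $$ (\<iota> a, \<iota> b)"
  by (simp add: tau_def)

text \<open>Row k of x^(i+2) is x(k,0) times row 0 of x^(i+1), and the first row of a strictly lower
  triangular matrix is zero.\<close>

lemma pow_single_row:
  fixes x :: "'a::field mat"
  assumes x: "x \<in> pat m (lower m)" and k: "k < m" "\<And>l. 1 \<le> l \<Longrightarrow> l < m \<Longrightarrow> x $$ (k, l) = 0"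
    and b: "b < m"
  shows "(x ^\<^sub>m Suc (Suc i)) $$ (k, b) = 0"
proof -
  note c = patD(1)[OF x]
  have z: "x $$ (0, b) = 0" if "b < m" for b
    using patD(2)[OF x, of 0 b] that by (simp add: lower_def)
  have z': "(x ^\<^sub>m Suc j) $$ (0, b) = 0" if "b < m" for j b
    using lower_pow_eq_0[OF x, of 0 b "Suc j"] that by simp
  have "(x ^\<^sub>m Suc (Suc i)) $$ (k, b) = (\<Sum>c<m. x $$ (k, c) * (x ^\<^sub>m Suc i) $$ (c, b))"
    using c k(1) b by (subst pow_mat_Suc_left[OF c], subst index_mult_sum[of _ m]) auto
  also have "\<dots> = 0"
  proof (rule sum.neutral, rule ballI)
    fix d assume "d \<in> {..<m}"
    then show "x $$ (k, d) * (x ^\<^sub>m Suc i) $$ (d, b) = 0"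
      using k(2)[of d] z'[OF b, of i] by (cases "d = 0") auto
  qed
  finally show ?thesis .
qed

text \<open>On such a row exp x is 1 + x, so entries of a Lie algebra element can be read off the
  group element.\<close>

lemma mexp_single_row:
  fixes x :: "'a::field mat"
  assumes x: "x \<in> pat m (lower m)" and k: "k < m" "\<And>l. 1 \<le> l \<Longrightarrow> l < m \<Longrightarrow> x $$ (k, l) = 0"
    and b: "b < m" "k \<noteq> b"
  shows "mexp m x $$ (k, b) = x $$ (k, b)"
proof -
  have "mexp m x $$ (k, b) = (\<Sum>i<Suc (Suc m). 1 / of_nat (fact i) * (x ^\<^sub>m i) $$ (k, b))"
    using x k b by (intro mexp_index_bound) auto
  also have "\<dots> = x $$ (k, b)"
    unfolding sum.lessThan_Suc_shift using pow_single_row[OF x k b(1)] patD(1)[OF x] k b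
    by (simp del: pow_mat.simps(2)) simp
  finally show ?thesis .
qed

text \<open>What the orbit argument has to know of the root system: K is empty or a single row k,
  \<iota> enumerates the kept positions increasingly and commutes with the reflection, c stands for
  the coefficient of beta_1, and \<open>ft\<close> is the form of the smaller placement. Both cases
  for col(beta_1) are thus treated at once.\<close>

locale induction_step =
  fixes m n :: nat and \<iota> :: "nat \<Rightarrow> nat" and K :: "nat set"
    and c :: "'a::{field,finite}" and ft :: "'a mat \<Rightarrow> 'a" and \<theta> :: "'a \<Rightarrow> complex"
  assumes char: "m \<le> CHAR('a)" and char2: "2 < CHAR('a)"
    and nm: "n \<le> m" and m2: "2 \<le> m"
    and K: "K = {} \<or> (\<exists>k. K = {k} \<and> 1 \<le> k \<and> k < m - 1)"
    and bij: "bij_betw \<iota> {..<n} (kept m K)"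
    and mono: "\<And>a b. a < b \<Longrightarrow> b < n \<Longrightarrow> \<iota> a < \<iota> b"
    and refl: "\<And>a. a < n \<Longrightarrow> \<iota> (n - 1 - a) = m - 1 - \<iota> a"
    and c: "c \<noteq> 0" and ft: "form n ft"
    and nonzero: "\<And>a. \<theta> a \<noteq> 0" and add: "\<And>a b. \<theta> (a + b) = \<theta> a * \<theta> b"
    and nontrivial: "\<exists>a. \<theta> a \<noteq> 1"
begin

abbreviation T :: "'a mat \<Rightarrow> 'a mat" where
  "T \<equiv> tau n \<iota>"

lemma charn: "n \<le> CHAR('a)" using char nm by simp

text \<open>A sum over K, which has at most one element, replaces a case distinction.\<close>

definition f1 :: "'a mat \<Rightarrow> 'a" where
  "f1 x = (\<Sum>k\<in>K. c * x $$ (k, 0))"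

definition f :: "'a mat \<Rightarrow> 'a" where
  "f = (\<lambda>x\<in>skew m. f1 x + ft (T x))"

definition h :: "'a mat set" where
  "h = skew m \<inter> pat m (row_pat m K)"

definition H :: "'a mat set" where
  "H = UG m \<inter> upat m (row_pat m K)"

definition X :: "('a mat \<Rightarrow> 'a) set" where
  "X = {\<nu>. form m \<nu> \<and> (\<forall>x\<in>h. \<nu> x = 0)}"

definition P :: "('a mat \<Rightarrow> 'a) set" where
  "P = {\<mu>. form m \<mu> \<and> (\<exists>\<rho>\<in>orb n ft. \<forall>x\<in>h. \<mu> x = f1 x + \<rho> (T x))}"

section \<open>The submatrix map on h and H\<close>

lemma Kd: "k \<in> K \<Longrightarrow> 1 \<le> k \<and> k < m - 1 \<and> k < m" using K by auto

lemma iota_kept: "a < n \<Longrightarrow> \<iota> a \<in> kept m K"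
  using bij by (auto simp: bij_betw_def)

lemma iota_lt: "a < n \<Longrightarrow> \<iota> a < m" "a < n \<Longrightarrow> 1 \<le> \<iota> a" "a < n \<Longrightarrow> \<iota> a < m - 1"
  using iota_kept[of a] by (auto simp: kept_def)

lemma iota_notin: "a < n \<Longrightarrow> \<iota> a \<notin> K" "a < n \<Longrightarrow> m - 1 - \<iota> a \<notin> K"
  using iota_kept by (auto simp: kept_def)

lemma iota_eq: "a < n \<Longrightarrow> b < n \<Longrightarrow> \<iota> a = \<iota> b \<longleftrightarrow> a = b"
  using mono by (metis linorder_neq_iff less_irrefl)

lemma iota_less: "a < n \<Longrightarrow> b < n \<Longrightarrow> \<iota> a < \<iota> b \<longleftrightarrow> a < b"
  using mono by (metis linorder_neq_iff less_asym less_irrefl)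

lemma sum_iota: "(\<Sum>a<n. F (\<iota> a)) = (\<Sum>a\<in>kept m K. F a)"
  using sum.reindex_bij_betw[OF bij] by simp

lemma h_subset: "h \<subseteq> skew m" "h \<subseteq> pat m (row_pat m K)" by (auto simp: h_def)

lemma h_sym:
  assumes "x \<in> h"
  shows "x \<in> pat m (sym_pat m K)"
proof (rule patI)
  have x: "x \<in> skew m" "x \<in> pat m (row_pat m K)" using assms by (auto simp: h_def)
  show "x \<in> carrier_mat m m" using skewD(2)[OF x(1)] .
  fix a b assume ab: "a < m" "b < m" "(a, b) \<notin> sym_pat m K"
  then have "(a, b) \<notin> row_pat m K \<or> (m - 1 - b, m - 1 - a) \<notin> row_pat m K"
    by (auto simp: sym_pat_def row_pat_def)
  then show "x $$ (a, b) = 0"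
  proof
    assume "(m - 1 - b, m - 1 - a) \<notin> row_pat m K"
    then have "x $$ (m - 1 - b, m - 1 - a) = 0" using ab by (intro patD(2)[OF x(2)]) auto
    then show ?thesis using skewD(4)[OF x(1) ab(1,2)] by simp
  qed (use patD(2)[OF x(2)] ab in auto)
qed

text \<open>\<open>H\<close> is a group in which the inverse is the reflection, so the zeros imposed
  on row k recur in mirror image.\<close>

lemma H_sym:
  assumes "g \<in> H"
  shows "g \<in> pat m (sym_pat m K)" "sigma m g \<in> H" "sigma m g \<in> pat m (sym_pat m K)"
proof -
  have s: "sigma m g \<in> H" if "g \<in> H" for g
    using that sigma_UG(1)[OF char, of g] sigma_UG_upat[OF char, of g, OF _ _ trans_row_pat row_pat_lower]
    by (auto simp: H_def)
  have p: "g \<in> pat m (sym_pat m K)" if "g \<in> H" for g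
  proof (rule patI)
    show "g \<in> carrier_mat m m" using that UG_carrier by (auto simp: H_def)
    fix a b assume ab: "a < m" "b < m" "(a, b) \<notin> sym_pat m K"
    then have "a \<noteq> b" "(a, b) \<notin> row_pat m K \<or> (m - 1 - b, m - 1 - a) \<notin> row_pat m K"
      by (auto simp: sym_pat_def row_pat_def)
    moreover have "g $$ (a, b) = 0" if "(a, b) \<notin> row_pat m K"
      using upatD[of g m "row_pat m K" a b] \<open>g \<in> H\<close> ab \<open>a \<noteq> b\<close> that by (auto simp: H_def)
    moreover have "g $$ (a, b) = 0" if r: "(m - 1 - b, m - 1 - a) \<notin> row_pat m K"
    proof -
      have "sigma m g \<in> upat m (row_pat m K)" using s[OF \<open>g \<in> H\<close>] by (simp add: H_def)
      moreover have "m - 1 - b < m" "m - 1 - a < m" "m - 1 - b \<noteq> m - 1 - a"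
        "m - 1 - (m - 1 - a) = a" "m - 1 - (m - 1 - b) = b"
        using ab \<open>a \<noteq> b\<close> by linarith+
      ultimately show ?thesis using upatD[of "sigma m g" m "row_pat m K", OF _ _ _ r] sigma_index[of "m - 1 - b" m "m - 1 - a" g] by metis
    qed
    ultimately show "g $$ (a, b) = 0" by blast
  qed
  show "g \<in> pat m (sym_pat m K)" "sigma m g \<in> H" "sigma m g \<in> pat m (sym_pat m K)"
    using assms s p by blast+
qed

lemma mexp_h: "mexp m ` h = H"
  unfolding h_def H_def by (rule mexp_skew_image[OF char trans_row_pat row_pat_lower])

lemma finite_h [simp]: "finite h" by (rule finite_subset[of _ "skew m"]) (auto simp: h_def)

lemma finite_H [simp]: "finite H" by (rule finite_subset[of _ "UG m"]) (auto simp: H_def)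

lemma card_H: "card H = card h" "card (UG m :: 'a mat set) = card (skew m :: 'a mat set)"
proof -
  show "card H = card h"
  proof -
    have "inj_on (mexp m) h" by (rule inj_on_subset[OF inj_on_mexp_skew[OF char]]) (auto simp: h_def)
    then show ?thesis using card_image mexp_h by metis
  qed
  show "card (UG m :: 'a mat set) = card (skew m :: 'a mat set)"
    using card_image[OF inj_on_mexp_skew[OF char]] mexp_skew[OF char] by metis
qed

lemma H_UG: "g \<in> H \<Longrightarrow> g \<in> UG m" by (simp add: H_def)

lemma H_mult: "g \<in> H \<Longrightarrow> g' \<in> H \<Longrightarrow> g * g' \<in> H"
  using UG_mult upat_mult[OF _ _ trans_row_pat] by (auto simp: H_def)

text \<open>In the sum for an entry of x y every middle index d outside the kept set contributes
  zero: for d = 0 or d in K the right factor vanishes, for d = m - 1 or d the mirror image of an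
  element of K the left one.\<close>

lemma tau_mult:
  fixes x y :: "'a mat"
  assumes x: "x \<in> pat m (sym_pat m K)" and y: "y \<in> pat m (sym_pat m K)"
  shows "T (x * y) = T x * T y"
proof (rule eq_matI)
  fix a b assume "a < dim_row (T x * T y)" "b < dim_col (T x * T y)"
  then have ab: "a < n" "b < n" by auto
  have z: "x $$ (\<iota> a, d) * y $$ (d, \<iota> b) = 0" if "d \<in> {..<m} - kept m K" for d
  proof -
    have "d < m" "d = 0 \<or> d = m - 1 \<or> d \<in> K \<or> m - 1 - d \<in> K" using that by (auto simp: kept_def)
    then have "(\<iota> a, d) \<notin> sym_pat m K \<or> (d, \<iota> b) \<notin> sym_pat m K"
      using iota_lt[OF ab(1)] iota_lt[OF ab(2)] iota_notin[OF ab(1)] iota_notin[OF ab(2)]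
      by (auto simp: sym_pat_def)
    then show ?thesis using patD(2)[OF x, of "\<iota> a" d] patD(2)[OF y, of d "\<iota> b"] iota_lt ab \<open>d < m\<close> by auto
  qed
  have "T (x * y) $$ (a, b) = (\<Sum>d<m. x $$ (\<iota> a, d) * y $$ (d, \<iota> b))"
    using ab iota_lt patD(1)[OF x] patD(1)[OF y] by (simp add: index_mult_sum[of _ m] del: index_mult_mat)
  also have "\<dots> = (\<Sum>d\<in>kept m K. x $$ (\<iota> a, d) * y $$ (d, \<iota> b))"
    using z by (intro sum.mono_neutral_right) (auto simp: kept_def)
  also have "\<dots> = (\<Sum>d<n. x $$ (\<iota> a, \<iota> d) * y $$ (\<iota> d, \<iota> b))"
    by (rule sum_iota[symmetric])
  also have "\<dots> = (T x * T y) $$ (a, b)"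
    using ab by (simp add: index_mult_sum[of _ n] del: index_mult_mat)
  finally show "T (x * y) $$ (a, b) = (T x * T y) $$ (a, b)" .
qed auto

lemma tau_one: "T (1\<^sub>m m :: 'a mat) = 1\<^sub>m n"
  using iota_lt iota_eq by (intro eq_matI) auto

lemma tau_sigma: "T (sigma m x) = sigma n (T (x :: 'a mat))"
proof (rule eq_matI)
  fix a b assume "a < dim_row (sigma n (T x))" "b < dim_col (sigma n (T x))"
  then have ab: "a < n" "b < n" by auto
  then show "T (sigma m x) $$ (a, b) = sigma n (T x) $$ (a, b)"
    using iota_lt refl[of a] refl[of b] by simp
qed auto

lemma tau_skew:
  assumes "(x :: 'a mat) \<in> skew m"
  shows "T x \<in> skew n"
proof -
  have "T x \<in> pat n (lower n)"
  proof (rule patI)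
    fix a b assume ab: "a < n" "b < n" "(a, b) \<notin> lower n"
    then show "T x $$ (a, b) = 0"
      using skewD(5)[OF assms, of "\<iota> a" "\<iota> b"] iota_lt iota_less[of b a] by (auto simp: lower_def)
  qed simp
  moreover have "sigma n (T x) = - T x"
    unfolding tau_sigma[symmetric] skewD(3)[OF assms] using skewD(2)[OF assms] iota_lt
    by (intro eq_matI) auto
  ultimately show ?thesis by (simp add: skew_def)
qed

lemma tau_add: "x \<in> carrier_mat m m \<Longrightarrow> y \<in> carrier_mat m m \<Longrightarrow>
    T (x + y :: 'a mat) = T x + T y"
  using iota_lt by (intro eq_matI) auto

lemma tau_smult: "x \<in> carrier_mat m m \<Longrightarrow> T (a \<cdot>\<^sub>m x :: 'a mat) = a \<cdot>\<^sub>m T x"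
  using iota_lt by (intro eq_matI) auto

lemma tau_UG:
  assumes "g \<in> H"
  shows "T g \<in> UG n"
proof -
  have "T g \<in> upat n (lower n)"
  proof (rule upatI)
    fix a b assume ab: "a < n" "b < n" "(a, b) \<notin> lower n"
    then have "(\<iota> a, \<iota> b) \<notin> lower m" using iota_less[of b a] by (auto simp: lower_def)
    moreover have "g \<in> upat m (lower m)" using H_UG[OF assms] by (simp add: UG_def)
    ultimately show "T g $$ (a, b) = (if a = b then 1 else 0)"
      using upatD[of g m "lower m" "\<iota> a" "\<iota> b"] ab iota_lt iota_eq by simp
  qed simp
  moreover have "sigma n (T g) * T g = 1\<^sub>m n"
    using tau_mult[OF H_sym(3)[OF assms] H_sym(1)[OF assms]] sigma_UG(2)[OF char H_UG[OF assms]]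
    by (simp add: tau_sigma tau_one)
  ultimately show ?thesis by (simp add: UG_def)
qed

lemma pat_sym_mult: "x \<in> pat m (sym_pat m K) \<Longrightarrow> y \<in> pat m (sym_pat m K) \<Longrightarrow> x * y \<in> pat m (sym_pat m K)"
  using trans_sym_pat by (intro pat_mult) (auto dest: transD)

lemma tau_conj:
  assumes "g \<in> H" "x \<in> h"
  shows "T (sigma m g * x * g) = sigma n (T g) * T x * T g"
  using H_sym[OF assms(1)] h_sym[OF assms(2)]
  by (simp add: tau_mult pat_sym_mult tau_sigma del: assoc_mult_mat)

text \<open>Powers pass through the submatrix map by multiplicativity. The truncations at m and at n
  agree because the n-th power of a strictly lower triangular matrix of size n is already
  zero.\<close>

lemma tau_mexp:
  assumes "x \<in> h"
  shows "T (mexp m x) = mexp n (T x)"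
proof -
  have x: "x \<in> skew m" using assms by (simp add: h_def)
  have p: "T (x ^\<^sub>m i) = T x ^\<^sub>m i \<and> (i > 0 \<longrightarrow> x ^\<^sub>m i \<in> pat m (sym_pat m K))" for i
  proof (induction i)
    case 0
    then show ?case using skewD(2)[OF x] tau_one by simp
  next
    case (Suc i)
    show ?case
    proof (cases "i = 0")
      case True
      then show ?thesis using h_sym[OF assms] skewD(2)[OF x] by simp
    next
      case False
      then show ?thesis using Suc h_sym[OF assms] by (simp add: tau_mult pat_sym_mult)
    qed
  qed
  show ?thesis
  proof (rule eq_matI)
    fix a b assume "a < dim_row (mexp n (T x))" "b < dim_col (mexp n (T x))"
    then have ab: "a < n" "b < n" by auto
    have "T (mexp m x) $$ (a, b) = (\<Sum>i<m. 1 / of_nat (fact i) * (x ^\<^sub>m i) $$ (\<iota> a, \<iota> b))"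
      using ab iota_lt skewD(2)[OF x] by (simp add: mexp_index)
    also have "\<dots> = (\<Sum>i<m. 1 / of_nat (fact i) * (T x ^\<^sub>m i) $$ (a, b))"
    proof (rule sum.cong[OF HOL.refl])
      fix i
      have "(x ^\<^sub>m i) $$ (\<iota> a, \<iota> b) = T (x ^\<^sub>m i) $$ (a, b)" using ab by simp
      then show "1 / of_nat (fact i) * (x ^\<^sub>m i) $$ (\<iota> a, \<iota> b)
          = 1 / of_nat (fact i) * (T x ^\<^sub>m i) $$ (a, b)" using p[of i] by simp
    qed
    also have "\<dots> = mexp n (T x) $$ (a, b)"
      using ab nm skewD(1)[OF tau_skew[OF x]] by (intro mexp_index_bound[symmetric]) auto
    finally show "T (mexp m x) $$ (a, b) = mexp n (T x) $$ (a, b)" .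
  qed auto
qed

text \<open>The lift is the extension by zero to all positions. It is skew because \<iota> respects
  the reflection, and its row k is zero because k is not kept.\<close>

lemma tau_surj:
  assumes "yt \<in> skew n"
  shows "\<exists>y\<in>h. T y = yt"
proof -
  define j where "j = the_inv_into {..<n} \<iota>"
  have inj: "inj_on \<iota> {..<n}" and im: "\<iota> ` {..<n} = kept m K" using bij by (auto simp: bij_betw_def)
  have j: "j (\<iota> a) = a" if "a < n" for a
    unfolding j_def using the_inv_into_f_f[OF inj] that by simp
  define y where "y = mat m m (\<lambda>(a, b). if a \<in> kept m K \<and> b \<in> kept m K then yt $$ (j a, j b) else 0)"
  have ex: "\<exists>a'<n. a = \<iota> a'" if "a \<in> kept m K" for a using that im by (metis imageE lessThan_iff)
  have kb: "m - 1 - a \<in> kept m K \<longleftrightarrow> a \<in> kept m K" if "a < m" for a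
    using that by (auto simp: kept_def)
  have "y \<in> pat m (row_pat m K)"
  proof (rule patI)
    show "y \<in> carrier_mat m m" by (simp add: y_def)
    fix a b assume ab: "a < m" "b < m" "(a, b) \<notin> row_pat m K"
    show "y $$ (a, b) = 0"
    proof (cases "a \<in> kept m K \<and> b \<in> kept m K")
      case True
      then obtain a' b' where *: "a = \<iota> a'" "b = \<iota> b'" "a' < n" "b' < n" using ex by blast
      have "a \<notin> K" using True by (auto simp: kept_def)
      then have "\<not> b' < a'" using ab * mono by (auto simp: row_pat_def)
      then show ?thesis using * ab skewD(5)[OF assms, of a' b'] by (simp add: y_def j)
    qed (use ab in \<open>auto simp: y_def\<close>)
  qed
  then have yr: "y \<in> pat m (row_pat m K)" .
  have "sigma m y = - y"
  proof (rule eq_matI)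
    fix a b assume "a < dim_row (- y)" "b < dim_col (- y)"
    then have ab: "a < m" "b < m" by (auto simp: y_def)
    show "sigma m y $$ (a, b) = (- y) $$ (a, b)"
    proof (cases "a \<in> kept m K \<and> b \<in> kept m K")
      case True
      then obtain a' b' where *: "a = \<iota> a'" "b = \<iota> b'" "a' < n" "b' < n" using ex by blast
      then have "m - 1 - a = \<iota> (n - 1 - a')" "m - 1 - b = \<iota> (n - 1 - b')" using refl by auto
      then show ?thesis using True * ab skewD(4)[OF assms, of a' b'] kb[OF ab(1)] kb[OF ab(2)]
        by (simp add: y_def j del: One_nat_def)
    next
      case False
      then show ?thesis using ab kb[OF ab(1)] kb[OF ab(2)] by (auto simp: y_def)
    qed
  qed (auto simp: y_def)
  then have "y \<in> h" using yr pat_mono[OF row_pat_lower] by (auto simp: h_def skew_def)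
  moreover have "T y = yt"
    using skewD(2)[OF assms] iota_kept iota_lt by (intro eq_matI) (auto simp: y_def j)
  ultimately show ?thesis by blast
qed

lemma tau_H_surj:
  assumes "gt \<in> UG n"
  shows "\<exists>g\<in>H. T g = gt"
proof -
  obtain yt where yt: "yt \<in> skew n" "gt = mexp n yt" using assms mexp_skew[OF charn] by blast
  obtain y where y: "y \<in> h" "T y = yt" using tau_surj[OF yt(1)] by blast
  then have "mexp m y \<in> H" "T (mexp m y) = gt" using mexp_h tau_mexp yt by auto
  then show ?thesis by blast
qed

end

text \<open>Off the diagonal, row k of s can be nonzero only in column 0, where it meets row 0 of z,
  which is zero.\<close>

lemma index_mult_single_row:
  fixes s z :: "'a::field mat"
  assumes s: "s \<in> carrier_mat m m" "s $$ (k, k) = 1" "\<And>d. 1 \<le> d \<Longrightarrow> d < m \<Longrightarrow> d \<noteq> k \<Longrightarrow> s $$ (k, d) = 0"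
    and z: "z \<in> pat m (lower m)" and k: "1 \<le> k" "k < m" and b: "b < m"
  shows "(s * z) $$ (k, b) = z $$ (k, b)"
proof -
  have "(s * z) $$ (k, b) = (\<Sum>d<m. s $$ (k, d) * z $$ (d, b))"
    using s(1) patD(1)[OF z] k b by (intro index_mult_sum) auto
  also have "\<dots> = (\<Sum>d\<in>{k}. s $$ (k, d) * z $$ (d, b))"
  proof (rule sum.mono_neutral_right)
    show "\<forall>d\<in>{..<m} - {k}. s $$ (k, d) * z $$ (d, b) = 0"
    proof
      fix d assume d: "d \<in> {..<m} - {k}"
      then show "s $$ (k, d) * z $$ (d, b) = 0"
        using s(3)[of d] patD(2)[OF z, of 0 b] b by (cases "d = 0") (auto simp: lower_def)
    qed
  qed (use k in auto)
  finally show ?thesis using s(2) by simp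
qed

text \<open>Rows of z above the last have entries in column 0 only, so right multiplication by g
  does not change their entry in column 0. The last row of z is not reached, since s is lower
  triangular and k < m - 1.\<close>

lemma edge_conj_index:
  fixes s z g :: "'a::field mat"
  assumes s: "s \<in> upat m (lower m)" and g: "g \<in> upat m (lower m)"
    and z: "z \<in> pat m (edge_pat m)" and k: "k < m - 1"
  shows "(s * z * g) $$ (k, 0) = (\<Sum>d<m - 1. s $$ (k, d) * z $$ (d, 0))"
proof -
  note c = upat_carrier[OF s] upat_carrier[OF g] patD(1)[OF z]
  have zg: "(z * g) $$ (d, 0) = z $$ (d, 0)" if "d < m - 1" for d
  proof -
    have "(z * g) $$ (d, 0) = (\<Sum>b<m. z $$ (d, b) * g $$ (b, 0))"
      using c that by (intro index_mult_sum) auto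
    also have "\<dots> = (\<Sum>b\<in>{0}. z $$ (d, b) * g $$ (b, 0))"
    proof (rule sum.mono_neutral_right)
      show "\<forall>b\<in>{..<m} - {0}. z $$ (d, b) * g $$ (b, 0) = 0"
        using patD(2)[OF z, of d] that by (auto simp: edge_pat_def)
    qed (use that in auto)
    also have "\<dots> = z $$ (d, 0)" using upatD[OF g, of 0 0] that by (simp add: lower_def)
    finally show ?thesis .
  qed
  have "(s * z * g) $$ (k, 0) = (s * (z * g)) $$ (k, 0)"
    using c by (simp add: assoc_mult_mat[of _ m m _ m _ m])
  also have "\<dots> = (\<Sum>d<m. s $$ (k, d) * (z * g) $$ (d, 0))"
    using c k by (intro index_mult_sum) auto
  also have "\<dots> = (\<Sum>d<m - 1. s $$ (k, d) * (z * g) $$ (d, 0))"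
  proof (rule sum.mono_neutral_right)
    show "\<forall>d\<in>{..<m} - {..<m - 1}. s $$ (k, d) * (z * g) $$ (d, 0) = 0"
      using upatD[OF s, of k] k by (auto simp: lower_def)
  qed auto
  finally show ?thesis using zg by simp
qed

context induction_step
begin

section \<open>The action of H on forms, and the group elements that move f into P\<close>

lemma conj_h:
  assumes g: "g \<in> H" and x: "x \<in> h"
  shows "sigma m g * x * g \<in> h"
proof -
  have "sigma m g * x * g \<in> pat m (row_pat m K)"
    using H_sym(2)[OF g] g x trans_O_subset[OF trans_row_pat]
    by (intro pat_mult_left_unipotent[where P = "row_pat m K"] pat_mult_right_unipotent[where P = "row_pat m K"])
      (auto simp: h_def H_def)
  then show ?thesis using conj_skew[OF char H_UG[OF g]] x by (auto simp: h_def)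
qed

text \<open>Off the diagonal, row k of \<open>sigma m g\<close> is confined to column 0, and so is
  row k of x; hence the entry x(k,0) survives the conjugation. Thus \<open>f1\<close> restricted to
  \<open>h\<close> is fixed by the coadjoint action of \<open>H\<close>.\<close>

lemma f1_conj:
  assumes g: "g \<in> H" and x: "x \<in> h"
  shows "f1 (sigma m g * x * g) = f1 x"
proof -
  let ?s = "sigma m g"
  have s: "?s \<in> upat m (row_pat m K)" "g \<in> upat m (row_pat m K)"
    using g H_sym(2)[OF g] by (auto simp: H_def)
  note xr = h_subset(2)[THEN subsetD, OF x]
  have xs: "x \<in> skew m" using x by (auto simp: h_def)
  have "(?s * x * g) $$ (k, 0) = x $$ (k, 0)" if k: "k \<in> K" for k
  proof -
    have k': "1 \<le> k" "k < m" "k < m - 1" using Kd[OF k] by auto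
    have sx: "(?s * x) $$ (k, d) = x $$ (k, d)" if "d < m" for d
    proof (rule index_mult_single_row[OF sigma_carrier _ _ skewD(1)[OF xs] k'(1,2) that])
      show "?s $$ (k, k) = 1" using upatD[OF s(1) k'(2,2)] by (simp add: row_pat_def)
      show "\<And>d. 1 \<le> d \<Longrightarrow> d < m \<Longrightarrow> d \<noteq> k \<Longrightarrow> ?s $$ (k, d) = 0"
        using upatD[OF s(1) k'(2)] k by (auto simp: row_pat_def)
    qed
    have "(?s * x * g) $$ (k, 0) = (\<Sum>d<m. (?s * x) $$ (k, d) * g $$ (d, 0))"
      using UG_carrier[OF H_UG[OF g]] skewD(2)[OF xs] k' m2
      by (intro index_mult_sum) (auto simp: mult_carrier_mat[of _ m m _ m])
    also have "\<dots> = (\<Sum>d<m. x $$ (k, d) * g $$ (d, 0))" using sx by simp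
    also have "\<dots> = (\<Sum>d\<in>{0}. x $$ (k, d) * g $$ (d, 0))"
      using patD(2)[OF xr k'(2)] k k' by (intro sum.mono_neutral_right) (auto simp: row_pat_def)
    also have "\<dots> = x $$ (k, 0)"
      using upatD[OF s(2), of 0 0] m2 by (simp add: row_pat_def)
    finally show ?thesis .
  qed
  then show ?thesis by (simp add: f1_def)
qed

lemma f1_add: "x \<in> carrier_mat m m \<Longrightarrow> y \<in> carrier_mat m m \<Longrightarrow> f1 (x + y) = f1 x + f1 y"
proof -
  assume "x \<in> carrier_mat m m" "y \<in> carrier_mat m m"
  then have "(x + y) $$ (k, 0) = x $$ (k, 0) + y $$ (k, 0)" if "k \<in> K" for k
    using Kd[OF that] by simp
  then show ?thesis by (simp add: f1_def sum.distrib algebra_simps)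
qed

lemma f1_smult: "x \<in> carrier_mat m m \<Longrightarrow> f1 (a \<cdot>\<^sub>m x) = a * f1 x"
proof -
  assume "x \<in> carrier_mat m m"
  then have "(a \<cdot>\<^sub>m x) $$ (k, 0) = a * x $$ (k, 0)" if "k \<in> K" for k
    using Kd[OF that] by simp
  then show ?thesis by (simp add: f1_def sum_distrib_left algebra_simps)
qed

text \<open>\<open>f1\<close> and \<open>T\<close> are linear on all of u, so \<open>f1\<close> plus
  \<rho> composed with \<open>T\<close> is a distinguished extension of its restriction to
  \<open>h\<close>. All other extensions differ from it by some \<nu> in \<open>X\<close>.\<close>

abbreviation (input) glue :: "('a mat \<Rightarrow> 'a) \<Rightarrow> ('a mat \<Rightarrow> 'a) \<Rightarrow> 'a mat \<Rightarrow> 'a" where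
  "glue \<rho> \<nu> \<equiv> (\<lambda>x\<in>skew m. f1 x + \<rho> (T x) + \<nu> x)"

lemma form_glue:
  assumes r: "form n \<rho>" and n: "form m \<nu>"
  shows "form m (glue \<rho> \<nu>)"
proof (rule formI)
  fix x y :: "'a mat" assume xy: "x \<in> skew m" "y \<in> skew m"
  note c = skewD(2)[OF xy(1)] skewD(2)[OF xy(2)]
  show "(glue \<rho> \<nu>) (x + y)
      = (glue \<rho> \<nu>) x + (glue \<rho> \<nu>) y"
    using xy skew_add[OF xy] f1_add[OF c] tau_add[OF c] formD(2)[OF n xy]
      formD(2)[OF r tau_skew[OF xy(1)] tau_skew[OF xy(2)]]
    by simp
next
  fix x :: "'a mat" and a assume x: "x \<in> skew m"
  note c = skewD(2)[OF x]
  show "(glue \<rho> \<nu>) (a \<cdot>\<^sub>m x)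
      = a * (glue \<rho> \<nu>) x"
    using x skew_smult[OF x, of a] f1_smult[OF c] tau_smult[OF c] formD(3)[OF n x]
      formD(3)[OF r tau_skew[OF x]]
    by (simp add: algebra_simps)
qed auto

lemma zero_form: "form k (\<lambda>x\<in>skew k. 0 :: 'a)"
  by (rule formI) (auto simp: skew_add skew_smult)

lemma form_f: "form m f"
  using form_glue[OF ft zero_form] by (simp add: f_def cong: restrict_cong)

lemma form_zero:
  assumes "form k \<mu>"
  shows "\<mu> (0\<^sub>m k k) = (0 :: 'a)"
proof -
  have "(0 :: 'a) \<cdot>\<^sub>m 0\<^sub>m k k = 0\<^sub>m k k" by (intro eq_matI) auto
  then show ?thesis using formD(3)[OF assms zero_skew, of 0] by simp
qed

lemma f_in_P: "f \<in> P"
proof -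
  have "\<forall>x\<in>h. f x = f1 x + ft (T x)" by (auto simp: f_def h_def)
  then show ?thesis using form_f orb_refl[OF charn ft] by (auto simp: P_def)
qed

lemma coad_on_h:
  assumes g: "g \<in> H" and \<mu>: "\<And>x. x \<in> h \<Longrightarrow> \<mu> x = f1 x + \<rho> (T x)" and x: "x \<in> h"
  shows "coad m g \<mu> x = f1 x + coad n (T g) \<rho> (T x)"
proof -
  have xs: "x \<in> skew m" using x by (auto simp: h_def)
  have "coad m g \<mu> x = \<mu> (sigma m g * x * g)" using xs by (simp add: coad_def)
  also have "\<dots> = f1 x + \<rho> (T (sigma m g * x * g))"
    using \<mu>[OF conj_h[OF g x]] f1_conj[OF g x] by simp
  also have "\<rho> (T (sigma m g * x * g)) = coad n (T g) \<rho> (T x)"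
    using tau_conj[OF g x] tau_skew[OF xs] by (simp add: coad_def)
  finally show ?thesis .
qed

lemma coad_P:
  assumes g: "g \<in> H" and \<mu>: "\<mu> \<in> P"
  shows "coad m g \<mu> \<in> P"
proof -
  obtain \<rho> where r: "\<rho> \<in> orb n ft" "\<And>x. x \<in> h \<Longrightarrow> \<mu> x = f1 x + \<rho> (T x)" "form m \<mu>"
    using \<mu> by (auto simp: P_def)
  then show ?thesis
    using coad_on_h[OF g r(2)] orb_coad[OF charn r(1) tau_UG[OF g]] form_coad[OF char H_UG[OF g] r(3)]
    by (auto simp: P_def)
qed

lemma edge_h:
  assumes "z \<in> skew m" "z \<in> pat m (edge_pat m)"
  shows "z \<in> h"
proof -
  have "edge_pat m \<subseteq> row_pat m K" using Kd by (force simp: edge_pat_def row_pat_def)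
  then show ?thesis using assms pat_mono[of "edge_pat m" "row_pat m K" m] by (auto simp: h_def)
qed

lemma tau_edge:
  assumes "(z :: 'a mat) \<in> pat m (edge_pat m)"
  shows "T z = 0\<^sub>m n n"
proof (rule eq_matI)
  fix a b assume "a < dim_row (0\<^sub>m n n :: 'a mat)" "b < dim_col (0\<^sub>m n n :: 'a mat)"
  then have ab: "a < n" "b < n" by auto
  have "(\<iota> a, \<iota> b) \<notin> edge_pat m" using iota_lt[OF ab(1)] iota_lt[OF ab(2)] by (auto simp: edge_pat_def)
  then show "T z $$ (a, b) = 0\<^sub>m n n $$ (a, b)"
    using patD(2)[OF assms, of "\<iota> a" "\<iota> b"] ab iota_lt by simp
qed auto

lemma edge_ideal: "lower m O edge_pat m \<subseteq> edge_pat m" "edge_pat m O lower m \<subseteq> edge_pat m"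
  by (auto simp: edge_pat_def lower_def)

text \<open>Testing on u_1 suffices. The map \<open>T\<close> kills u_1 and its conjugates, so
  membership in \<open>P\<close> says that \<open>f1\<close> on u_1 does not change under
  conjugation by x. This confines row k of the inverse of x to column 0 and the diagonal.\<close>

lemma stabilizer:
  assumes x: "x \<in> UG m" and xP: "coad m x f \<in> P"
  shows "x \<in> H"
proof -
  let ?s = "sigma m x"
  note s = sigma_UG(1)[OF char x]
  have u: "x \<in> upat m (lower m)" "?s \<in> upat m (lower m)" using x s by (auto simp: UG_def)
  obtain \<rho> where r: "\<rho> \<in> orb n ft" "\<And>z. z \<in> h \<Longrightarrow> coad m x f z = f1 z + \<rho> (T z)"
    using xP by (auto simp: P_def)
  have fr: "form n \<rho>" using orb_form[OF charn ft r(1)] .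
  have e: "f1 (?s * z * x) = f1 z" if z: "z \<in> skew m" "z \<in> pat m (edge_pat m)" for z
  proof -
    have sz: "?s * z * x \<in> pat m (edge_pat m)"
      using pat_mult_left_unipotent[OF pat_mult_right_unipotent[OF z(2) u(2) edge_ideal(1)] u(1) edge_ideal(2)] .
    have "coad m x f z = f1 (?s * z * x) + ft (T (?s * z * x))"
      using z conj_skew[OF char x z(1)] by (simp add: coad_def f_def)
    then show ?thesis
      using r(2)[OF edge_h[OF z]] tau_edge[OF z(2)] tau_edge[OF sz] form_zero[OF fr] form_zero[OF ft] by simp
  qed
  have "?s $$ (k, a) = 0" if k: "k \<in> K" and a: "1 \<le> a" "a < m - 1" "a \<noteq> k" for k a
  proof -
    have Kk: "K = {k}" using K k by auto
    have k': "1 \<le> k" "k < m - 1" using Kd[OF k] by auto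
    \<comment> \<open>The element of u_1 with entry 1 at (a,0), completed by its mirror image. As a
      differs from k, \<open>f1 z\<close> is 0, while the conjugate of z has the entry of
      \<open>sigma m x\<close> at (k,a) in position (k,0); since c is nonzero, that entry is
      0.\<close>
    define z where "z = mat m m (\<lambda>(i, j). if i = a \<and> j = 0 then 1
      else if i = m - 1 \<and> j = m - 1 - a then - 1 else (0 :: 'a))"
    have zc: "z \<in> carrier_mat m m" by (simp add: z_def)
    have zp: "z \<in> pat m (edge_pat m)"
      using a by (intro patI) (auto simp: z_def edge_pat_def)
    moreover have "sigma m z = - z"
    proof (rule eq_matI)
      fix i j assume "i < dim_row (- z)" "j < dim_col (- z)"
      then have ij: "i < m" "j < m" by (auto simp: z_def)
      have "m - 1 - j = a \<longleftrightarrow> j = m - 1 - a" "m - 1 - i = 0 \<longleftrightarrow> i = m - 1"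
        "m - 1 - j = m - 1 \<longleftrightarrow> j = 0" "m - 1 - i = m - 1 - a \<longleftrightarrow> i = a"
        using ij a by linarith+
      then show "sigma m z $$ (i, j) = (- z) $$ (i, j)"
        using ij a by (auto simp: z_def simp del: One_nat_def)
    qed (auto simp: z_def)
    ultimately have zs: "z \<in> skew m" using pat_mono[OF edge_pat_lower] by (auto simp: skew_def)
    have z0: "z $$ (d, 0) = (if d = a then 1 else 0)" if "d < m" for d
      using that a by (simp add: z_def)
    have "(?s * z * x) $$ (k, 0) = (\<Sum>d<m - 1. ?s $$ (k, d) * z $$ (d, 0))"
      using edge_conj_index[OF u(2,1) zp k'(2)] .
    also have "\<dots> = (\<Sum>d<m - 1. if d = a then ?s $$ (k, d) else 0)"
      using z0 by (intro sum.cong) auto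
    also have "\<dots> = ?s $$ (k, a)" using a by simp
    finally have "(?s * z * x) $$ (k, 0) = ?s $$ (k, a)" .
    moreover have f1k: "f1 w = c * w $$ (k, 0)" for w unfolding f1_def by (subst Kk) simp
    moreover have "f1 z = 0" using a k' z0[of k] by (simp add: f1k)
    ultimately show ?thesis using e[OF zs zp] c by simp
  qed
  note * = this
  have "?s \<in> upat m (row_pat m K)"
  proof (rule upatI)
    fix a b assume ab: "a < m" "b < m" "(a, b) \<notin> row_pat m K"
    show "?s $$ (a, b) = (if a = b then 1 else 0)"
    proof (cases "(a, b) \<in> lower m")
      case True
      then have "a \<in> K" "1 \<le> b" "b < a" using ab by (auto simp: row_pat_def lower_def)
      then show ?thesis using *[of a b] Kd[of a] by auto
    next
      case False
      then show ?thesis using upatD[OF u(2) ab(1,2)] by simp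
    qed
  qed simp
  then have "?s \<in> H" using s by (simp add: H_def)
  then show ?thesis using H_sym(2)[of ?s] sigma_sigma[OF UG_carrier[OF x]] by simp
qed

lemma stabilizer_eq: "{x \<in> UG m. coad m x f \<in> P} = H"
  using stabilizer coad_P[OF _ f_in_P] H_UG by auto

text \<open>The forms obtained from \<open>f\<close> by conjugation with $U_1$ differ from \<open>f\<close> by elements of \<open>Z\<close>.
  Since \<open>Z\<close> and \<open>X\<close> have the same annihilator \<open>h\<close>, they have the same cardinality.\<close>

abbreviation (input) row_form :: "(nat \<Rightarrow> 'a) \<Rightarrow> 'a mat \<Rightarrow> 'a" where
  "row_form d \<equiv> (\<lambda>x\<in>skew m. \<Sum>k\<in>K. \<Sum>b\<in>{1..<k}. x $$ (k, b) * d b)"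

definition Z :: "('a mat \<Rightarrow> 'a) set" where
  "Z = range (\<lambda>d. row_form d)"

section \<open>The forms that vanish on h\<close>

lemma X_forms: "X \<subseteq> {\<mu>. form m \<mu>}" by (auto simp: X_def)

lemma Z_X: "Z \<subseteq> X"
proof
  fix \<nu> assume "\<nu> \<in> Z"
  then obtain d where d: "\<nu> = row_form d"
    by (auto simp: Z_def)
  have "form m \<nu>"
  proof (rule formI)
    fix x y :: "'a mat" assume xy: "x \<in> skew m" "y \<in> skew m"
    have "(x + y) $$ (k, b) = x $$ (k, b) + y $$ (k, b)" if "k \<in> K" "b < k" for k b
      using Kd[OF that(1)] that(2) skewD(2)[OF xy(1)] skewD(2)[OF xy(2)] by simp
    then show "\<nu> (x + y) = \<nu> x + \<nu> y"
      using xy skew_add[OF xy] by (simp add: d distrib_right sum.distrib)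
  next
    fix x :: "'a mat" and a assume x: "x \<in> skew m"
    have "(a \<cdot>\<^sub>m x) $$ (k, b) = a * x $$ (k, b)" if "k \<in> K" "b < k" for k b
      using Kd[OF that(1)] that(2) skewD(2)[OF x] by simp
    then show "\<nu> (a \<cdot>\<^sub>m x) = a * \<nu> x"
      using x skew_smult[OF x, of a] by (simp add: d sum_distrib_left mult.assoc)
  qed (simp add: d)
  moreover have "\<nu> x = 0" if x: "x \<in> h" for x
  proof -
    have "x $$ (k, b) = 0" if "k \<in> K" "1 \<le> b" "b < k" for k b
      using Kd[OF that(1)] that patD(2)[OF h_subset(2)[THEN subsetD, OF x], of k b] by (simp add: row_pat_def)
    then show ?thesis using x by (simp add: d h_def)
  qed
  ultimately show "\<nu> \<in> X" by (simp add: X_def)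
qed

lemma Z_add: "\<mu> \<in> Z \<Longrightarrow> \<nu> \<in> Z \<Longrightarrow> form_add m \<mu> \<nu> \<in> Z"
proof -
  assume "\<mu> \<in> Z" "\<nu> \<in> Z"
  then obtain d e where d: "\<mu> = row_form d"
    and e: "\<nu> = row_form e"
    by (auto simp: Z_def)
  have "form_add m \<mu> \<nu> = row_form (\<lambda>b. d b + e b)"
    by (rule ext) (simp add: d e form_add_def distrib_left sum.distrib)
  then show ?thesis unfolding Z_def by (intro range_eqI[where x = "\<lambda>b. d b + e b"]) simp
qed

lemma Z_smult: "\<mu> \<in> Z \<Longrightarrow> form_smult m a \<mu> \<in> Z"
proof -
  assume "\<mu> \<in> Z"
  then obtain d where d: "\<mu> = row_form d"
    by (auto simp: Z_def)
  have "form_smult m a \<mu> = row_form (\<lambda>b. a * d b)"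
    by (rule ext) (simp add: d form_smult_def sum_distrib_left mult_ac)
  then show ?thesis unfolding Z_def by (intro range_eqI[where x = "\<lambda>b. a * d b"]) simp
qed

lemma Z_annihilator:
  assumes x: "x \<in> skew m" "\<And>\<nu>. \<nu> \<in> Z \<Longrightarrow> \<nu> x = 0"
  shows "x \<in> h"
proof -
  have z: "x $$ (k, b) = 0" if k: "k \<in> K" and b: "1 \<le> b" "b < k" for k b
  proof -
    have Kk: "K = {k}" using K k by auto
    \<comment> \<open>The indicator of b as coefficient function isolates the entry x(k,b).\<close>
    let ?\<nu> = "\<lambda>x\<in>skew m. \<Sum>k\<in>K. \<Sum>b'\<in>{1..<k}. x $$ (k, b') * (if b' = b then 1 else 0 :: 'a)"
    have "?\<nu> \<in> Z" unfolding Z_def by (rule range_eqI[of _ _ "\<lambda>b'. if b' = b then 1 else 0"]) simp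
    then have "?\<nu> x = 0" using x(2) by blast
    moreover have "?\<nu> x = (\<Sum>b'\<in>{1..<k}. x $$ (k, b') * (if b' = b then 1 else 0))"
      using x(1) by (simp add: Kk)
    moreover have "\<dots> = (\<Sum>b'\<in>{1..<k}. if b' = b then x $$ (k, b') else 0)"
      by (intro sum.cong) auto
    ultimately show ?thesis using b by simp
  qed
  have "x \<in> pat m (row_pat m K)"
  proof (rule patI)
    fix a b assume ab: "a < m" "b < m" "(a, b) \<notin> row_pat m K"
    show "x $$ (a, b) = 0"
      using z[of a b] skewD(5)[OF x(1) ab(1,2)] ab by (cases "b < a") (auto simp: row_pat_def)
  qed (rule skewD(2)[OF x(1)])
  then show ?thesis using x(1) by (simp add: h_def)
qed

lemma X_add: "\<mu> \<in> X \<Longrightarrow> \<nu> \<in> X \<Longrightarrow> form_add m \<mu> \<nu> \<in> X"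
  using h_subset(1) by (auto simp: X_def form_form_add form_add_apply subset_iff)

lemma X_smult: "\<mu> \<in> X \<Longrightarrow> form_smult m a \<mu> \<in> X"
  using h_subset(1) by (auto simp: X_def form_form_smult form_smult_apply subset_iff)

lemma annihilators:
  "{x \<in> skew m. \<forall>\<nu>\<in>X. \<nu> x = 0} = h" "{x \<in> skew m. \<forall>\<nu>\<in>Z. \<nu> x = 0} = h"
  using Z_annihilator Z_X h_subset(1) by (auto simp: X_def subset_iff)

lemma finite_X: "finite X" using X_forms finite_forms finite_subset by blast

lemma Z_nonempty: "Z \<noteq> {}" by (auto simp: Z_def)

text \<open>Since the exponential is bijective, |u| = |U| and |h| = |H|, so |X| is the index of
  \<open>H\<close> in U.\<close>

lemma card_X: "card X * card h = card (skew m :: 'a mat set)"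
  using card_annihilator[OF nonzero add nontrivial X_forms _ X_add X_smult] Z_nonempty Z_X annihilators(1) by auto

lemma card_h_pos: "card h > 0"
  using zero_skew zero_pat finite_h by (auto simp: card_gt_0_iff h_def)

lemma X_eq_Z: "X = Z"
proof -
  have "card Z * card h = card (skew m :: 'a mat set)"
    using card_annihilator[OF nonzero add nontrivial _ Z_nonempty Z_add Z_smult] Z_X X_forms annihilators(2) by auto
  then have "card Z = card X" using card_X card_h_pos by (metis mult_cancel2 neq0_conv)
  then show ?thesis using card_subset_eq[OF finite_X Z_X] by simp
qed

text \<open>For z in u_1, conjugation by exp z adds to column 0 of x the other columns with
  coefficients z(b,0), in every row strictly between the first and the last, and it preserves the
  kept submatrix. Prescribing the coefficients yields every form in \<open>Z\<close>, that is, in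
  \<open>X\<close>.\<close>

lemma translate_f:
  assumes "\<nu> \<in> X"
  shows "\<exists>g\<in>UG m. coad m g f = form_add m f \<nu>"
proof -
  obtain d where d: "\<nu> = row_form d"
    using assms unfolding X_eq_Z by (auto simp: Z_def)
  \<comment> \<open>Division by c compensates the factor c in \<open>f1\<close>; the last row is the
    mirror image that makes z skew.\<close>
  define z where "z = mat m m (\<lambda>(i, j). if j = 0 \<and> 1 \<le> i \<and> i < m - 1 then d i / c
      else if i = m - 1 \<and> 1 \<le> j \<and> j < m - 1 then - d (m - 1 - j) / c else (0 :: 'a))"
  have zc: "z \<in> carrier_mat m m" by (simp add: z_def)
  have zp: "z \<in> pat m (edge_pat m)"
    by (intro patI) (auto simp: z_def edge_pat_def)
  moreover have "sigma m z = - z"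
  proof (rule eq_matI)
    fix i j assume "i < dim_row (- z)" "j < dim_col (- z)"
    then have ij: "i < m" "j < m" by (auto simp: z_def)
    have "m - 1 - i = 0 \<longleftrightarrow> i = m - 1" "m - 1 - j = m - 1 \<longleftrightarrow> j = 0"
      "1 \<le> m - 1 - j \<and> m - 1 - j < m - 1 \<longleftrightarrow> 1 \<le> j \<and> j < m - 1"
      "1 \<le> m - 1 - i \<and> m - 1 - i < m - 1 \<longleftrightarrow> 1 \<le> i \<and> i < m - 1"
      "m - 1 - (m - 1 - i) = i"
      using ij m2 by linarith+
    then show "sigma m z $$ (i, j) = (- z) $$ (i, j)"
      using ij by (simp add: z_def del: One_nat_def)
  qed (auto simp: z_def)
  ultimately have zs: "z \<in> skew m" using pat_mono[OF edge_pat_lower] by (auto simp: skew_def)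
  let ?g = "mexp m z" and ?s = "sigma m (mexp m z)"
  have g: "?g \<in> UG m" "?g \<in> upat m (edge_pat m)"
    using mexp_skew_image[OF char trans_edge_pat edge_pat_lower] zs zp by blast+
  have s: "?s \<in> upat m (edge_pat m)" using sigma_UG_upat[OF char g trans_edge_pat edge_pat_lower] .
  have g0: "?g $$ (b, 0) = d b / c" if "1 \<le> b" "b < m - 1" for b
  proof -
    have "?g $$ (b, 0) = z $$ (b, 0)"
    proof (rule mexp_single_row[OF skewD(1)[OF zs]])
      show "\<And>l. 1 \<le> l \<Longrightarrow> l < m \<Longrightarrow> z $$ (b, l) = 0" using that by (auto simp: z_def)
    qed (use that in auto)
    then show ?thesis using that by (simp add: z_def)
  qed
  have row: "(?s * x * ?g) $$ (a, b) = (\<Sum>e<m. x $$ (a, e) * ?g $$ (e, b))"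
    if x: "x \<in> skew m" and a: "1 \<le> a" "a < m - 1" and b: "b < m" for x a b
  proof -
    have a': "a < m" using a by simp
    have sx: "(?s * x) $$ (a, e) = x $$ (a, e)" if "e < m" for e
    proof (rule index_mult_single_row[OF sigma_carrier _ _ skewD(1)[OF x] a(1) a' that])
      show "?s $$ (a, a) = 1" using upatD[OF s a' a'] by (simp add: edge_pat_def)
      show "\<And>e. 1 \<le> e \<Longrightarrow> e < m \<Longrightarrow> e \<noteq> a \<Longrightarrow> ?s $$ (a, e) = 0"
        using upatD[OF s a'] a by (auto simp: edge_pat_def)
    qed
    have "(?s * x * ?g) $$ (a, b) = (\<Sum>e<m. (?s * x) $$ (a, e) * ?g $$ (e, b))"
      using skewD(2)[OF x] a' b by (intro index_mult_sum) (auto simp: mult_carrier_mat[of _ m m _ m])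
    then show ?thesis using sx by simp
  qed
  have "coad m ?g f = form_add m f \<nu>"
  proof (rule form_eqI[of m])
    show "form m (coad m ?g f)" using form_coad[OF char g(1) form_f] .
    show "form m (form_add m f \<nu>)" using assms form_f by (auto simp: X_def form_form_add)
    fix x :: "'a mat" assume x: "x \<in> skew m"
    \<comment> \<open>Off the diagonal, a kept column of exp z can be nonzero only in the last row,
      where it meets an entry of x above the diagonal.\<close>
    have "T (?s * x * ?g) = T x"
    proof (rule eq_matI)
      fix a b assume "a < dim_row (T x)" "b < dim_col (T x)"
      then have ab: "a < n" "b < n" by auto
      have "(?s * x * ?g) $$ (\<iota> a, \<iota> b) = (\<Sum>e<m. x $$ (\<iota> a, e) * ?g $$ (e, \<iota> b))"
        using row[OF x, of "\<iota> a" "\<iota> b"] iota_lt ab by simp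
      also have "\<dots> = (\<Sum>e\<in>{\<iota> b}. x $$ (\<iota> a, e) * ?g $$ (e, \<iota> b))"
      proof (rule sum.mono_neutral_right)
        show "\<forall>e\<in>{..<m} - {\<iota> b}. x $$ (\<iota> a, e) * ?g $$ (e, \<iota> b) = 0"
        proof
          fix e assume e: "e \<in> {..<m} - {\<iota> b}"
          show "x $$ (\<iota> a, e) * ?g $$ (e, \<iota> b) = 0"
          proof (cases "e = m - 1")
            case True
            then show ?thesis using skewD(5)[OF x, of "\<iota> a" e] iota_lt[OF ab(1)] e by auto
          next
            case False
            then show ?thesis using upatD[OF g(2), of e "\<iota> b"] iota_lt[OF ab(2)] e by (auto simp: edge_pat_def)
          qed
        qed
      qed (use iota_lt ab in auto)
      also have "\<dots> = x $$ (\<iota> a, \<iota> b)"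
        using upatD[OF g(2), of "\<iota> b" "\<iota> b"] iota_lt ab by (simp add: edge_pat_def)
      finally show "T (?s * x * ?g) $$ (a, b) = T x $$ (a, b)" using ab by simp
    qed auto
    moreover have "f1 (?s * x * ?g) = f1 x + (\<Sum>k\<in>K. \<Sum>b\<in>{1..<k}. x $$ (k, b) * d b)"
    proof -
      have "c * (?s * x * ?g) $$ (k, 0) = c * x $$ (k, 0) + (\<Sum>b\<in>{1..<k}. x $$ (k, b) * d b)"
        if k: "k \<in> K" for k
      proof -
        have k': "1 \<le> k" "k < m - 1" using Kd[OF k] by auto
        have "(?s * x * ?g) $$ (k, 0) = (\<Sum>e<m. x $$ (k, e) * ?g $$ (e, 0))"
          using row[OF x k'] m2 by simp
        also have "\<dots> = (\<Sum>e\<in>insert 0 {1..<k}. x $$ (k, e) * ?g $$ (e, 0))"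
          using skewD(5)[OF x] k' by (intro sum.mono_neutral_right) auto
        also have "\<dots> = x $$ (k, 0) + (\<Sum>e\<in>{1..<k}. x $$ (k, e) * ?g $$ (e, 0))"
          using upatD[OF g(2), of 0 0] m2 by (simp add: edge_pat_def)
        also have "(\<Sum>e\<in>{1..<k}. x $$ (k, e) * ?g $$ (e, 0)) = (\<Sum>e\<in>{1..<k}. x $$ (k, e) * (d e / c))"
          using g0 k' by (intro sum.cong) auto
        finally show ?thesis using c by (simp add: distrib_left sum_distrib_left)
      qed
      then show ?thesis by (simp add: f1_def sum.distrib)
    qed
    ultimately show "coad m ?g f x = form_add m f \<nu> x"
      using x conj_skew[OF char g(1) x] by (simp add: coad_def form_add_def f_def d)
  qed
  then show ?thesis using g by blast
qed

text \<open>Translating f by \<open>X\<close> reaches exactly the forms that agree with f on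
  \<open>h\<close>. For general \<mu> in \<open>P\<close> with associated form \<rho>, an element of
  the smaller group that carries \<open>ft\<close> to \<rho> is lifted to \<open>H\<close>; the
  inverse of the lift moves \<mu> to a form agreeing with f on \<open>h\<close>.\<close>

lemma P_orb: "P \<subseteq> orb m f"
proof
  fix \<mu> assume "\<mu> \<in> P"
  then obtain \<rho> where r: "\<rho> \<in> orb n ft" "\<And>x. x \<in> h \<Longrightarrow> \<mu> x = f1 x + \<rho> (T x)" "form m \<mu>"
    by (auto simp: P_def)
  obtain gt where gt: "gt \<in> UG n" "\<rho> = coad n gt ft" using r(1) by (auto simp: orb_def)
  obtain g where g: "g \<in> H" "T g = gt" using tau_H_surj[OF gt(1)] by blast
  let ?\<mu> = "coad m (sigma m g) \<mu>"
  have sg: "sigma m g \<in> UG m" using sigma_UG(1)[OF char H_UG[OF g(1)]] .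
  have fm: "form m ?\<mu>" using form_coad[OF char sg r(3)] .
  have eq: "?\<mu> x = f x" if x: "x \<in> h" for x
  proof -
    have "?\<mu> x = f1 x + coad n (T (sigma m g)) \<rho> (T x)"
      using coad_on_h[OF H_sym(2)[OF g(1)] r(2) x] .
    also have "coad n (T (sigma m g)) \<rho> = ft"
      using coad_sigma(1)[OF charn ft gt(1)] gt g by (simp add: tau_sigma)
    finally show ?thesis using x by (simp add: f_def h_def)
  qed
  let ?\<nu> = "form_add m ?\<mu> (form_smult m (- 1) f)"
  have "?\<nu> \<in> X"
    using fm form_f eq h_subset(1)
    by (auto simp: X_def form_form_add form_form_smult form_add_apply form_smult_apply subset_iff)
  then obtain g' where g': "g' \<in> UG m" "coad m g' f = form_add m f ?\<nu>" using translate_f by blast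
  have "form_add m f ?\<nu> = ?\<mu>"
    using fm form_f
    by (intro form_eqI[of m]) (auto simp: form_form_add form_form_smult form_add_apply form_smult_apply)
  then have "?\<mu> \<in> orb m f" using g' unfolding orb_def by (metis imageI)
  then have "coad m g ?\<mu> \<in> orb m f" using orb_coad[OF char _ H_UG[OF g(1)]] by blast
  then show "\<mu> \<in> orb m f" using coad_sigma(2)[OF char r(3) H_UG[OF g(1)]] by simp
qed

section \<open>The parametrisation of P and the induced character\<close>

text \<open>Restriction to \<open>h\<close> removes \<nu> and determines \<rho>, because
  \<open>T\<close> maps \<open>h\<close> onto the smaller Lie algebra; \<nu> is then recovered as a
  difference.\<close>

lemma bij_P: "bij_betw (\<lambda>(\<rho>, \<nu>). glue \<rho> \<nu>) (orb n ft \<times> X) P"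
proof (rule bij_betwI')
  let ?F = "\<lambda>(\<rho>, \<nu>). glue \<rho> \<nu>"
  have fo: "form n \<rho>" if "\<rho> \<in> orb n ft" for \<rho> using orb_form[OF charn ft that] .
  have fh: "?F (\<rho>, \<nu>) x = f1 x + \<rho> (T x)" if "\<nu> \<in> X" "x \<in> h" for \<rho> \<nu> x
    using that h_subset(1) by (auto simp: X_def)
  {
    fix p q assume p: "p \<in> orb n ft \<times> X" and q: "q \<in> orb n ft \<times> X"
    obtain \<rho> \<nu> \<rho>' \<nu>' where pq: "p = (\<rho>, \<nu>)" "q = (\<rho>', \<nu>')" by (cases p, cases q) blast
    show "(?F p = ?F q) = (p = q)"
    proof
      assume eq: "?F p = ?F q"
      have "\<rho> y = \<rho>' y" if y: "y \<in> skew n" for y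
      proof -
        obtain x where x: "x \<in> h" "T x = y" using tau_surj[OF y] by blast
        then show ?thesis using fun_cong[OF eq, of x] fh[of \<nu> x \<rho>] fh[of \<nu>' x \<rho>'] p q pq by auto
      qed
      then have r: "\<rho> = \<rho>'" using p q pq fo by (intro form_eqI[of n]) auto
      have "\<nu> x = \<nu>' x" if "x \<in> skew m" for x
        using fun_cong[OF eq, of x] that r pq by simp
      then have "\<nu> = \<nu>'" using p q pq by (intro form_eqI[of m]) (auto simp: X_def)
      then show "p = q" using r pq by simp
    qed simp
  }
  {
    fix p assume p: "p \<in> orb n ft \<times> X"
    obtain \<rho> \<nu> where pq: "p = (\<rho>, \<nu>)" "\<rho> \<in> orb n ft" "\<nu> \<in> X" using p by (cases p) auto
    have "form m (?F p)" using form_glue[of \<rho> \<nu>] pq fo by (simp add: X_def)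
    moreover have "\<forall>x\<in>h. ?F p x = f1 x + \<rho> (T x)" using fh pq by blast
    ultimately show "?F p \<in> P" unfolding P_def using pq by blast
  }
  {
    fix \<mu> assume "\<mu> \<in> P"
    then obtain \<rho> where r: "\<rho> \<in> orb n ft" "\<And>x. x \<in> h \<Longrightarrow> \<mu> x = f1 x + \<rho> (T x)" "form m \<mu>"
      by (auto simp: P_def)
    let ?\<mu>0 = "?F (\<rho>, \<lambda>x\<in>skew m. 0)"
    let ?\<nu> = "form_add m \<mu> (form_smult m (- 1) ?\<mu>0)"
    have f0: "form m ?\<mu>0" using form_glue[OF fo[OF r(1)] zero_form] by simp
    have n: "?\<nu> \<in> X"
      unfolding X_def
    proof (intro CollectI conjI ballI)
      show "form m ?\<nu>" using r(3) f0 by (intro form_form_add form_form_smult)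
      fix x assume x: "x \<in> h"
      then have "x \<in> skew m" using h_subset(1) by blast
      then show "?\<nu> x = 0" using r(2)[OF x] by (simp add: form_add_def form_smult_def)
    qed
    have "\<mu> = ?F (\<rho>, ?\<nu>)"
    proof (rule form_eqI[OF r(3)])
      show "form m (?F (\<rho>, ?\<nu>))" using form_glue[OF fo[OF r(1)], of ?\<nu>] n by (simp add: X_def)
    qed (simp add: form_add_def form_smult_def)
    then show "\<exists>p\<in>orb n ft \<times> X. \<mu> = ?F p" using r(1) n by blast
  }
qed

lemma card_P: "card P = card (orb n ft) * card X"
  using bij_betw_same_card[OF bij_P] by (simp add: card_cartesian_product)

text \<open>By orthogonality the inner sum over \<open>X\<close> is |X| times the indicator function
  of \<open>h\<close>, since \<open>h\<close> is the annihilator of \<open>X\<close>. This produces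
  the extension by zero in the formula for induced characters.\<close>

lemma sum_P:
  assumes z: "z \<in> skew m"
  shows "(\<Sum>\<mu>\<in>P. \<theta> (\<mu> z)) = (if z \<in> h
    then of_nat (card X) * (\<theta> (f1 z) * (\<Sum>\<rho>\<in>orb n ft. \<theta> (\<rho> (T z)))) else 0)"
proof -
  have "(\<Sum>\<mu>\<in>P. \<theta> (\<mu> z)) = (\<Sum>p\<in>orb n ft \<times> X. \<theta> ((case p of (\<rho>, \<nu>) \<Rightarrow> glue \<rho> \<nu>) z))"
    using sum.reindex_bij_betw[OF bij_P, of "\<lambda>\<mu>. \<theta> (\<mu> z)"] by simp
  also have "\<dots> = (\<Sum>(\<rho>, \<nu>)\<in>orb n ft \<times> X. \<theta> (f1 z) * \<theta> (\<rho> (T z)) * \<theta> (\<nu> z))"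
    using z by (intro sum.cong) (auto simp: add)
  also have "\<dots> = (\<Sum>\<rho>\<in>orb n ft. \<Sum>\<nu>\<in>X. \<theta> (f1 z) * \<theta> (\<rho> (T z)) * \<theta> (\<nu> z))"
    by (rule sum.cartesian_product[symmetric])
  also have "\<dots> = \<theta> (f1 z) * (\<Sum>\<rho>\<in>orb n ft. \<theta> (\<rho> (T z))) * (\<Sum>\<nu>\<in>X. \<theta> (\<nu> z))"
    unfolding sum_distrib_left[of _ _ "orb n ft"] sum_product ..
  also have "(\<Sum>\<nu>\<in>X. \<theta> (\<nu> z)) = (if z \<in> h then of_nat (card X) else 0)"
    using sum_additive_char_forms[OF nonzero add nontrivial X_forms z X_add X_smult] annihilators(1) z by auto
  finally show ?thesis by simp
qed

text \<open>Counts the pairs of $x \in U$ and $\mu$ in the orbit with $x.\mu \in P$ in two ways.\<close>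

lemma card_orb_eq: "card (orb m f) = card (orb n ft) * card X ^ 2"
proof -
  have P: "orb m f \<inter> P = P" using P_orb by blast
  have "(\<Sum>x\<in>UG m. if coad m x f \<in> P then 1 else 0 :: complex) = of_nat (card H)"
    unfolding stabilizer_eq[symmetric] by (simp add: sum.If_cases Int_def)
  moreover have "(\<Sum>\<nu>\<in>orb m f. if \<nu> \<in> P then 1 else 0 :: complex) = of_nat (card P)"
    using P finite_orb[OF char, of f] by (simp add: sum.If_cases)
  ultimately have "(of_nat (card (orb m f) * card H) :: complex) = of_nat (card (UG m :: 'a mat set) * card P)"
    using card_orb_sum[OF char form_f, of "\<lambda>\<nu>. if \<nu> \<in> P then 1 else 0"] by simp
  then have "card (orb m f) * card H = card (UG m :: 'a mat set) * card P"
    using of_nat_eq_iff by blast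
  also have "\<dots> = card (orb n ft) * card X ^ 2 * card H"
    using card_P card_X card_H by (simp add: power2_eq_square mult_ac flip: card_X)
  finally show ?thesis using card_h_pos card_H by (auto simp: card_gt_0_iff)
qed

text \<open>Each term of the induced sum is a sum over \<open>P\<close>, up to a constant. After
  exchanging sums the average over U is the same for all \<mu> in \<open>P\<close>, because
  \<open>P\<close> lies in the orbit of f; only the normalisation remains.\<close>

theorem orbit_sum_induced:
  assumes y: "y \<in> skew m"
  shows "1 / of_nat (card H) * (\<Sum>x | x \<in> UG m \<and> sigma m x * y * x \<in> h.
      \<theta> (f1 (sigma m x * y * x)) * orbit_sum \<theta> (orb n ft) (T (sigma m x * y * x)))
    = orbit_sum \<theta> (orb m f) y"
proof -
  define r where "r = complex_of_real (real (card (orb n ft)) powr (- 1 / 2))"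
  define S where "S = (\<Sum>\<nu>\<in>orb m f. \<theta> (\<nu> y))"
  let ?z = "\<lambda>x. sigma m x * y * x"
  have zs: "?z x \<in> skew m" if "x \<in> UG m" for x using conj_skew[OF char that y] .
  have pos: "card X > 0" "card (orb n ft) > 0" "card H > 0" "card (orb m f) > 0"
    using finite_X Z_nonempty Z_X orb_refl[OF charn ft] orb_refl[OF char form_f] card_h_pos card_H
      finite_orb[OF char, of f] finite_orb[OF charn, of ft] by (auto simp: card_gt_0_iff)
  have "(\<Sum>x | x \<in> UG m \<and> ?z x \<in> h. \<theta> (f1 (?z x)) * orbit_sum \<theta> (orb n ft) (T (?z x)))
    = (\<Sum>x\<in>UG m. if ?z x \<in> h then r * (\<theta> (f1 (?z x)) * (\<Sum>\<rho>\<in>orb n ft. \<theta> (\<rho> (T (?z x))))) else 0)"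
    by (intro sum.mono_neutral_cong_left) (auto simp: orbit_sum_def r_def)
  also have "\<dots> = (\<Sum>x\<in>UG m. r / of_nat (card X) * (\<Sum>\<mu>\<in>P. \<theta> (\<mu> (?z x))))"
    using sum_P[OF zs] pos(1) by (intro sum.cong) auto
  also have "\<dots> = r / of_nat (card X) * (\<Sum>x\<in>UG m. \<Sum>\<mu>\<in>P. \<theta> (\<mu> (?z x)))"
    by (simp add: sum_distrib_left)
  also have "(\<Sum>x\<in>UG m. \<Sum>\<mu>\<in>P. \<theta> (\<mu> (?z x))) = (\<Sum>\<mu>\<in>P. \<Sum>x\<in>UG m. \<theta> (coad m x \<mu> y))"
    using y by (subst sum.swap) (simp add: coad_def)
  also have "\<dots> = (\<Sum>\<mu>\<in>P. \<Sum>x\<in>UG m. \<theta> (coad m x f y))"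
  proof (rule sum.cong[OF HOL.refl])
    fix \<mu> assume "\<mu> \<in> P"
    then have "\<mu> \<in> orb m f" using P_orb by blast
    then show "(\<Sum>x\<in>UG m. \<theta> (coad m x \<mu> y)) = (\<Sum>x\<in>UG m. \<theta> (coad m x f y))"
      by (rule sum_coad_orb[OF char])
  qed
  also have "\<dots> = of_nat (card P) * (of_nat (card (UG m :: 'a mat set)) * S / of_nat (card (orb m f)))"
    using card_orb_sum[OF char form_f, of "\<lambda>\<nu>. \<theta> (\<nu> y)"] pos(4)
    by (simp add: S_def field_simps)
  finally have "1 / of_nat (card H) * (\<Sum>x | x \<in> UG m \<and> ?z x \<in> h.
        \<theta> (f1 (?z x)) * orbit_sum \<theta> (orb n ft) (T (?z x)))
      = 1 / of_nat (card H) * (r / of_nat (card X) * (of_nat (card P) *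
          (of_nat (card (UG m :: 'a mat set)) * S / of_nat (card (orb m f)))))" by simp
  \<comment> \<open>The group orders cancel by |U| = |X| |H| and by |P| = |X| times the size of the
    orbit of \<open>ft\<close>.\<close>
  also have "\<dots> = r * of_nat (card (orb n ft)) * of_nat (card X) / of_nat (card (orb m f)) * S"
  proof -
    have "card (UG m :: 'a mat set) = card X * card H" using card_X card_H by simp
    moreover have "(of_nat (card H) :: complex) \<noteq> 0" "(of_nat (card X) :: complex) \<noteq> 0"
      using pos by (metis less_irrefl of_nat_eq_0_iff)+
    ultimately show ?thesis by (simp add: card_P del: of_nat_eq_0_iff)
  qed
  \<comment> \<open>With |Omega| = |Omega~| |X|^2 the left side is |Omega~|^(-1/2) / |X|, the
    inverse square root of |Omega|.\<close>
  also have "r * of_nat (card (orb n ft)) * of_nat (card X) / of_nat (card (orb m f))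
      = complex_of_real (real (card (orb m f)) powr (- 1 / 2))"
  proof -
    define o1 where "o1 = real (card (orb n ft))"
    define o2 where "o2 = real (card X)"
    have o: "o1 > 0" "o2 > 0" using pos by (auto simp: o1_def o2_def)
    have om: "real (card (orb m f)) = o1 * o2 ^ 2" by (simp add: card_orb_eq o1_def o2_def)
    have p: "(o1 * o2 ^ 2) powr (- 1 / 2) = o1 powr (- 1 / 2) / o2"
    proof -
      have "(o2 ^ 2) powr (- 1 / 2) = (o2 powr 2) powr (- 1 / 2)" using o by (simp add: powr_numeral)
      also have "\<dots> = 1 / o2" using o by (simp add: powr_powr powr_minus_divide)
      finally show ?thesis using o by (simp add: powr_mult)
    qed
    have "o1 powr (- 1 / 2) * o1 * o2 / (o1 * o2 ^ 2) = (o1 * o2 ^ 2) powr (- 1 / 2)"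
      using o unfolding p by (simp add: power2_eq_square field_simps)
    moreover have "r * of_nat (card (orb n ft)) * of_nat (card X) / of_nat (card (orb m f))
        = complex_of_real (o1 powr (- 1 / 2) * o1 * o2 / real (card (orb m f)))"
      by (simp add: r_def o1_def o2_def)
    ultimately show ?thesis unfolding om by simp
  qed
  finally show ?thesis by (simp add: orbit_sum_def S_def)
qed

end

section \<open>The projections onto the factors\<close>

text \<open>Support of v': off the edge, away from row k and from the mirrored column m - 1 - k,
  which are the positions that S^-(beta_1) occupies.\<close>

definition v_pat :: "nat \<Rightarrow> nat set \<Rightarrow> (nat \<times> nat) set" where
  "v_pat m K = {(a, b). 1 \<le> b \<and> b < a \<and> a < m - 1 \<and> a \<notin> K \<and> m - 1 - b \<notin> K}"

text \<open>Within \<open>v_pat\<close>, the positions of S^- for the root of column 1 with the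
  opposite sign, whose row is m - 1 - k. For beta_1 = eps_1 nothing is left, as k is its own mirror
  image.\<close>

definition v1_pat :: "nat \<Rightarrow> nat set \<Rightarrow> (nat \<times> nat) set" where
  "v1_pat m K = {(a, b) \<in> v_pat m K. m - 1 - a \<in> K \<or> b \<in> K}"

definition u_pat :: "nat \<Rightarrow> nat set \<Rightarrow> (nat \<times> nat) set" where
  "u_pat m K = {(a, b) \<in> v_pat m K. m - 1 - a \<notin> K \<and> b \<notin> K}"

text \<open>Truncation to a support. It represents the linear projections of h onto v' and onto the
  span of the roots in \<Phi>_2^+, from which the group projections are computed.\<close>

definition restr :: "nat \<Rightarrow> (nat \<times> nat) set \<Rightarrow> 'a::zero mat \<Rightarrow> 'a mat" where
  "restr m Q x = mat m m (\<lambda>ab. if ab \<in> Q then x $$ ab else 0)"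

lemma restr_pat: "restr m Q x \<in> pat m Q"
  by (rule patI) (auto simp: restr_def)

lemma restr_skew:
  assumes x: "x \<in> skew m" and Q: "Q \<subseteq> lower m"
    and sym: "\<And>a b. a < m \<Longrightarrow> b < m \<Longrightarrow> (m - 1 - b, m - 1 - a) \<in> Q \<longleftrightarrow> (a, b) \<in> Q"
  shows "restr m Q x \<in> skew m"
proof -
  have "sigma m (restr m Q x) = - restr m Q x"
    using skewD(4)[OF x] sym by (intro eq_matI) (auto simp: restr_def simp del: One_nat_def)
  then show ?thesis using restr_pat[of m Q x] pat_mono[OF Q] by (auto simp: skew_def)
qed

lemma trans_v_pat: "trans (v_pat m K)"
  by (auto simp: v_pat_def intro!: transI)

lemma v_pat_lower: "v_pat m K \<subseteq> lower m"
  by (auto simp: v_pat_def lower_def)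

lemma trans_u_pat: "trans (u_pat m K)"
  by (auto simp: u_pat_def v_pat_def intro!: transI)

lemma trans_v1_pat: "trans (v1_pat m K)"
  by (auto simp: v1_pat_def v_pat_def intro!: transI)

lemma v1_pat_lower: "v1_pat m K \<subseteq> lower m"
  using v_pat_lower by (auto simp: v1_pat_def)

lemma u_pat_lower: "u_pat m K \<subseteq> lower m"
  using v_pat_lower by (auto simp: u_pat_def)

lemma v_pat_sym: "a < m \<Longrightarrow> b < m \<Longrightarrow> (m - 1 - b, m - 1 - a) \<in> v_pat m K \<longleftrightarrow> (a, b) \<in> v_pat m K"
proof -
  assume ab: "a < m" "b < m"
  have "1 \<le> m - 1 - a \<longleftrightarrow> a < m - 1" "m - 1 - a < m - 1 - b \<longleftrightarrow> b < a"
    "m - 1 - b < m - 1 \<longleftrightarrow> 1 \<le> b" "m - 1 - (m - 1 - a) = a"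
    using ab by linarith+
  then show ?thesis by (auto simp: v_pat_def simp del: One_nat_def)
qed

lemma u_pat_sym: "a < m \<Longrightarrow> b < m \<Longrightarrow> (m - 1 - b, m - 1 - a) \<in> u_pat m K \<longleftrightarrow> (a, b) \<in> u_pat m K"
proof -
  assume ab: "a < m" "b < m"
  have "m - 1 - (m - 1 - b) = b" using ab by linarith
  then show ?thesis using v_pat_sym[OF ab] by (auto simp: u_pat_def simp del: One_nat_def)
qed

context induction_step
begin

lemma edge_row_pat: "edge_pat m \<subseteq> row_pat m K"
  using Kd by (force simp: edge_pat_def row_pat_def)

lemma v_row_pat: "v_pat m K \<subseteq> row_pat m K"
  by (auto simp: v_pat_def row_pat_def)

text \<open>A nonzero entry of x off the edge avoids row k and, by the mirrored condition, column m
  - 1 - k. So modulo u_1 only the \<open>v_pat\<close> part of x remains.\<close>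

lemma restr_v:
  assumes x: "x \<in> h"
  shows "restr m (v_pat m K) x \<in> skew m \<inter> pat m (v_pat m K)"
    "x - restr m (v_pat m K) x \<in> pat m (edge_pat m)"
proof -
  have xs: "x \<in> skew m" using x h_subset by blast
  show "restr m (v_pat m K) x \<in> skew m \<inter> pat m (v_pat m K)"
    using restr_skew[OF xs v_pat_lower v_pat_sym] restr_pat by blast
  show "x - restr m (v_pat m K) x \<in> pat m (edge_pat m)"
  proof (rule patI)
    fix a b assume ab: "a < m" "b < m" "(a, b) \<notin> edge_pat m"
    have "x $$ (a, b) = 0" if n: "(a, b) \<notin> v_pat m K"
    proof (rule ccontr)
      assume nz: "x $$ (a, b) \<noteq> 0"
      have s: "(a, b) \<in> sym_pat m K" using patD(2)[OF h_sym[OF x] ab(1,2)] nz by blast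
      have ba: "b < a" using skewD(5)[OF xs ab(1,2)] nz not_le by blast
      then have e: "b \<noteq> 0" "a \<noteq> m - 1" using ab by (simp_all add: edge_pat_def del: One_nat_def)
      then have "a \<notin> K" "m - 1 - b \<notin> K" using s ba by (simp_all add: sym_pat_def del: One_nat_def)
      moreover have "1 \<le> b" "a < m - 1" using e ab by linarith+
      ultimately show False using ba n by (simp add: v_pat_def del: One_nat_def)
    qed
    then show "(x - restr m (v_pat m K) x) $$ (a, b) = 0"
      using ab skewD(2)[OF xs] by (auto simp: restr_def)
  qed (use xs skewD(2) in \<open>auto simp: restr_def\<close>)
qed

lemma restr_u:
  assumes x: "x \<in> h"
  shows "restr m (u_pat m K) x \<in> skew m \<inter> pat m (u_pat m K)"
    "restr m (v_pat m K) x - restr m (u_pat m K) x \<in> pat m (v1_pat m K)"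
    "T (restr m (u_pat m K) x) = T x"
proof -
  have xs: "x \<in> skew m" using x h_subset by blast
  show "restr m (u_pat m K) x \<in> skew m \<inter> pat m (u_pat m K)"
    using restr_skew[OF xs u_pat_lower u_pat_sym] restr_pat by blast
  show "restr m (v_pat m K) x - restr m (u_pat m K) x \<in> pat m (v1_pat m K)"
    by (rule patI) (auto simp: restr_def u_pat_def v1_pat_def)
  show "T (restr m (u_pat m K) x) = T x"
  proof (rule eq_matI)
    fix a b assume "a < dim_row (T x)" "b < dim_col (T x)"
    then have ab: "a < n" "b < n" by auto
    have "x $$ (\<iota> a, \<iota> b) = 0" if "(\<iota> a, \<iota> b) \<notin> u_pat m K"
    proof -
      have "\<iota> a \<le> \<iota> b"
        using that iota_lt[OF ab(1)] iota_lt[OF ab(2)] iota_notin[OF ab(1)] iota_notin[OF ab(2)]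
        by (auto simp: u_pat_def v_pat_def)
      then show ?thesis using skewD(5)[OF xs] iota_lt ab by simp
    qed
    then show "T (restr m (u_pat m K) x) $$ (a, b) = T x $$ (a, b)"
      using ab iota_lt by (auto simp: restr_def)
  qed auto
qed

abbreviation (input) G :: "'a mat monoid" where
  "G \<equiv> \<lparr>carrier = UG m, monoid.mult = (*), one = 1\<^sub>m m\<rparr>"

abbreviation (input) A :: "'a mat set" where "A \<equiv> UG m \<inter> upat m (edge_pat m)"
abbreviation (input) B :: "'a mat set" where "B \<equiv> UG m \<inter> upat m (v_pat m K)"
abbreviation (input) B1 :: "'a mat set" where "B1 \<equiv> UG m \<inter> upat m (v1_pat m K)"
abbreviation (input) B2 :: "'a mat set" where "B2 \<equiv> UG m \<inter> upat m (u_pat m K)"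

lemma components:
  assumes x: "x \<in> h"
  shows "semi_left G A B (mexp m x) = mexp m x * mexp m (- restr m (v_pat m K) x)"
    and "semi_right G A B (mexp m x) = mexp m (restr m (v_pat m K) x)"
    and "mexp m x * mexp m (- restr m (v_pat m K) x) \<in> A" and "mexp m (restr m (v_pat m K) x) \<in> B"
proof -
  have x': "x \<in> skew m \<inter> pat m (row_pat m K)" using x by (simp add: h_def)
  have P: "edge_pat m O row_pat m K \<subseteq> edge_pat m" "row_pat m K O edge_pat m \<subseteq> edge_pat m"
    "v_pat m K \<inter> edge_pat m = {}"
    by (auto simp: edge_pat_def row_pat_def v_pat_def)
  note * = semidirect_components[OF x' restr_v[OF x] trans_row_pat row_pat_lower edge_row_pat P(1,2)
      trans_v_pat v_row_pat P(3) char HOL.refl HOL.refl HOL.refl]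
  show "semi_left G A B (mexp m x) = mexp m x * mexp m (- restr m (v_pat m K) x)"
    "semi_right G A B (mexp m x) = mexp m (restr m (v_pat m K) x)"
    "mexp m x * mexp m (- restr m (v_pat m K) x) \<in> A" "mexp m (restr m (v_pat m K) x) \<in> B"
    using * by auto
qed

lemma set_mult_H: "A <#>\<^bsub>G\<^esub> B = H"
proof
  show "A <#>\<^bsub>G\<^esub> B \<subseteq> H"
  proof
    fix g assume "g \<in> A <#>\<^bsub>G\<^esub> B"
    then obtain a b where ab: "a \<in> A" "b \<in> B" "g = a * b" by (auto simp: set_mult_def)
    then have "a \<in> H" "b \<in> H"
      using upat_mono[OF edge_row_pat, of m] upat_mono[OF v_row_pat, of m] by (auto simp: H_def)
    then show "g \<in> H" using H_mult ab by blast
  qed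
  show "H \<subseteq> A <#>\<^bsub>G\<^esub> B"
  proof
    fix g assume "g \<in> H"
    then obtain x where x: "x \<in> h" "g = mexp m x" using mexp_h by blast
    let ?y = "restr m (v_pat m K) x"
    have y: "?y \<in> pat m (lower m)" using restr_v(1)[OF x(1)] skewD(1) by blast
    have "g = (mexp m x * mexp m (- ?y)) * mexp m ?y"
      using mexp_uminus_mult[OF y char] x(2)
      by (simp add: assoc_mult_mat[of _ m m _ m _ m])
    then show "g \<in> A <#>\<^bsub>G\<^esub> B"
      using components(3,4)[OF x(1)] unfolding set_mult_def by auto
  qed
qed

text \<open>The factor in U_1 is exp w for some w in u_1. Column 0 of the inverse of the other
  factor is a unit vector, so exp w and exp x agree at (k,0); on row k both are linear, so w and x
  agree there. The form f sees nothing else of w, because \<open>T\<close> vanishes on u_1.\<close>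

lemma f_left_component:
  assumes x: "x \<in> h"
  shows "\<exists>w\<in>skew m. semi_left G A B (mexp m x) = mexp m w \<and> f w = f1 x"
proof -
  let ?y = "restr m (v_pat m K) x"
  have xs: "x \<in> skew m" "x \<in> pat m (row_pat m K)" using x by (auto simp: h_def)
  have "mexp m x * mexp m (- ?y) \<in> A" using components(3)[OF x] .
  then obtain w where w: "w \<in> skew m" "w \<in> pat m (edge_pat m)" "mexp m x * mexp m (- ?y) = mexp m w"
    using mexp_skew_image[OF char trans_edge_pat edge_pat_lower] by blast
  have y: "mexp m (- ?y) \<in> upat m (v_pat m K)"
    using mexp_upat[OF pat_uminus trans_v_pat] restr_pat by blast
  have "w $$ (k, 0) = x $$ (k, 0)" if k: "k \<in> K" for k
  proof -
    note k' = Kd[OF k]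
    have "w $$ (k, 0) = mexp m w $$ (k, 0)"
    proof (rule mexp_single_row[OF skewD(1)[OF w(1)], symmetric])
      show "\<And>l. 1 \<le> l \<Longrightarrow> l < m \<Longrightarrow> w $$ (k, l) = 0"
        using patD(2)[OF w(2), of k] k' by (auto simp: edge_pat_def)
    qed (use k' in auto)
    also have "\<dots> = (\<Sum>d<m. mexp m x $$ (k, d) * mexp m (- ?y) $$ (d, 0))"
      unfolding w(3)[symmetric] using k' by (intro index_mult_sum) auto
    also have "\<dots> = (\<Sum>d\<in>{0}. mexp m x $$ (k, d) * mexp m (- ?y) $$ (d, 0))"
      using upatD[OF y, of _ 0] k' by (intro sum.mono_neutral_right) (auto simp: v_pat_def)
    also have "\<dots> = mexp m x $$ (k, 0)"
      using upatD[OF y, of 0 0] k' by (simp add: v_pat_def)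
    also have "\<dots> = x $$ (k, 0)"
    proof (rule mexp_single_row[OF skewD(1)[OF xs(1)]])
      show "\<And>l. 1 \<le> l \<Longrightarrow> l < m \<Longrightarrow> x $$ (k, l) = 0"
        using patD(2)[OF xs(2), of k] k k' by (auto simp: row_pat_def)
    qed (use k' in auto)
    finally show ?thesis .
  qed
  then have "f1 w = f1 x" by (simp add: f1_def)
  then have "f w = f1 x" using w(1) tau_edge[OF w(2)] form_zero[OF ft] by (simp add: f_def)
  then show ?thesis using w components(1)[OF x] by metis
qed

text \<open>The last component is the exponential of the truncation of x to \<open>u_pat\<close>.
  Below the diagonal this support contains all pairs of kept positions, so the truncation has the
  same kept submatrix as x.\<close>

lemma tau_right_component:
  assumes x: "x \<in> h"
  shows "\<exists>w\<in>skew m. semi_right G B1 B2 (semi_right G A B (mexp m x)) = mexp m w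
    \<and> T w = T x"
proof -
  let ?y = "restr m (v_pat m K) x"
  have P: "v1_pat m K \<subseteq> v_pat m K" "v1_pat m K O v_pat m K \<subseteq> v1_pat m K"
    "v_pat m K O v1_pat m K \<subseteq> v1_pat m K" "u_pat m K \<subseteq> v_pat m K" "u_pat m K \<inter> v1_pat m K = {}"
    by (auto simp: v1_pat_def v_pat_def u_pat_def)
  have "semi_right G B1 B2 (mexp m ?y) = mexp m (restr m (u_pat m K) x)"
    by (rule semidirect_components(2)[OF restr_v(1)[OF x] restr_u(1,2)[OF x] trans_v_pat v_pat_lower
          P(1-3) trans_u_pat P(4,5) char HOL.refl HOL.refl HOL.refl])
  then show ?thesis using components(2)[OF x] restr_u[OF x] by auto
qed

end

section \<open>Roots as matrix positions\<close>

text \<open>\<open>ent \<Phi> \<alpha>\<close> is the position, counted from 0, of the entry $1$ of $e_\alpha$; the other nonzero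
  entry is its mirror image in the antidiagonal.\<close>

fun ent :: "root_system \<Rightarrow> root \<Rightarrow> nat \<times> nat" where
  "ent \<Phi> (Eps i) = (rank \<Phi>, i - 1)"
| "ent \<Phi> (EpsMinus i j) = (j - 1, i - 1)"
| "ent \<Phi> (EpsPlus i j) = (mat_size \<Phi> - j, i - 1)"

text \<open>Strictly below the diagonal and strictly above the antidiagonal: one position from each
  mirror pair. The antidiagonal itself carries no root vector.\<close>

definition tri :: "nat \<Rightarrow> (nat \<times> nat) set" where
  "tri m = {(a, b). b < a \<and> a + b + 1 < m}"

lemma finite_pos_roots [simp]: "finite (pos_roots \<Phi>)"
proof -
  have "pos_roots \<Phi> \<subseteq> (\<lambda>(i, j). EpsMinus i j) ` ({..rank \<Phi>} \<times> {..rank \<Phi>})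
      \<union> (\<lambda>(i, j). EpsPlus i j) ` ({..rank \<Phi>} \<times> {..rank \<Phi>}) \<union> Eps ` {..rank \<Phi>}"
  proof
    fix \<alpha> assume "\<alpha> \<in> pos_roots \<Phi>"
    then show "\<alpha> \<in> (\<lambda>(i, j). EpsMinus i j) ` ({..rank \<Phi>} \<times> {..rank \<Phi>})
      \<union> (\<lambda>(i, j). EpsPlus i j) ` ({..rank \<Phi>} \<times> {..rank \<Phi>}) \<union> Eps ` {..rank \<Phi>}"
      by (cases \<Phi>) force+
  qed
  then show ?thesis by (rule finite_subset) auto
qed

definition is_B :: "root_system \<Rightarrow> bool" where
  "is_B \<Phi> \<longleftrightarrow> mat_size \<Phi> = 2 * rank \<Phi> + 1"

lemma pos_roots_iff:
  "Eps i \<in> pos_roots \<Phi> \<longleftrightarrow> is_B \<Phi> \<and> 1 \<le> i \<and> i \<le> rank \<Phi>"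
  "EpsMinus i j \<in> pos_roots \<Phi> \<longleftrightarrow> 1 \<le> i \<and> i < j \<and> j \<le> rank \<Phi>"
  "EpsPlus i j \<in> pos_roots \<Phi> \<longleftrightarrow> 1 \<le> i \<and> i < j \<and> j \<le> rank \<Phi>"
  by (cases \<Phi>; auto simp: is_B_def)+

lemma mat_size_cases: "mat_size \<Phi> = (if is_B \<Phi> then 2 * rank \<Phi> + 1 else 2 * rank \<Phi>)"
  by (cases \<Phi>) (auto simp: is_B_def)

definition root_of :: "root_system \<Rightarrow> nat \<times> nat \<Rightarrow> root" where
  "root_of \<Phi> = (\<lambda>(a, b). if a < rank \<Phi> then EpsMinus (b + 1) (a + 1)
    else if is_B \<Phi> \<and> a = rank \<Phi> then Eps (b + 1) else EpsPlus (b + 1) (mat_size \<Phi> - a))"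

lemma bij_betw_ent: "bij_betw (ent \<Phi>) (pos_roots \<Phi>) (tri (mat_size \<Phi>))"
proof (rule bij_betw_byWitness[where f' = "root_of \<Phi>"])
  show "\<forall>\<alpha>\<in>pos_roots \<Phi>. root_of \<Phi> (ent \<Phi> \<alpha>) = \<alpha>"
  proof
    fix \<alpha> assume "\<alpha> \<in> pos_roots \<Phi>"
    then show "root_of \<Phi> (ent \<Phi> \<alpha>) = \<alpha>"
      by (cases \<alpha>) (auto simp: root_of_def pos_roots_iff mat_size_cases)
  qed
  show "\<forall>p\<in>tri (mat_size \<Phi>). ent \<Phi> (root_of \<Phi> p) = p"
    by (auto simp: root_of_def tri_def)
  show "ent \<Phi> ` pos_roots \<Phi> \<subseteq> tri (mat_size \<Phi>)"
  proof
    fix p assume "p \<in> ent \<Phi> ` pos_roots \<Phi>"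
    then obtain \<alpha> where "\<alpha> \<in> pos_roots \<Phi>" "p = ent \<Phi> \<alpha>" by blast
    then show "p \<in> tri (mat_size \<Phi>)"
      by (cases \<alpha>) (auto simp: pos_roots_iff mat_size_cases tri_def)
  qed
  show "root_of \<Phi> ` tri (mat_size \<Phi>)
    \<subseteq> pos_roots \<Phi>"
    by (auto simp: root_of_def tri_def pos_roots_iff mat_size_cases split: if_splits)
qed

lemma ent_tri: "\<alpha> \<in> pos_roots \<Phi> \<Longrightarrow> ent \<Phi> \<alpha> \<in> tri (mat_size \<Phi>)"
  using bij_betw_ent bij_betwE by blast

lemma ent_inj: "\<alpha> \<in> pos_roots \<Phi> \<Longrightarrow> \<gamma> \<in> pos_roots \<Phi> \<Longrightarrow> ent \<Phi> \<alpha> = ent \<Phi> \<gamma> \<longleftrightarrow> \<alpha> = \<gamma>"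
  using bij_betw_ent[of \<Phi>] by (auto simp: bij_betw_def inj_on_def)

lemma ent_surj: "p \<in> tri (mat_size \<Phi>) \<Longrightarrow> \<exists>\<alpha>\<in>pos_roots \<Phi>. ent \<Phi> \<alpha> = p"
  using bij_betw_ent[of \<Phi>] by (force simp: bij_betw_def)

lemma snd_ent: "snd (ent \<Phi> \<alpha>) = root_col \<alpha> - 1"
  by (cases \<alpha>) auto

lemma root_col_pos: "\<alpha> \<in> pos_roots \<Phi> \<Longrightarrow> 1 \<le> root_col \<alpha> \<and> root_col \<alpha> \<le> rank \<Phi>"
  by (cases \<alpha>) (auto simp: pos_roots_iff)

lemma index_root_mat:
  assumes "\<alpha> \<in> pos_roots \<Phi>" "a < mat_size \<Phi>" "b < mat_size \<Phi>"
  shows "(root_mat \<Phi> \<alpha> :: 'a::field mat) $$ (a, b) = (if ent \<Phi> \<alpha> = (a, b) then 1 else 0)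
    - (if ent \<Phi> \<alpha> = (mat_size \<Phi> - 1 - b, mat_size \<Phi> - 1 - a) then 1 else 0)"
proof -
  have p: "Defs.pos \<Phi> (int i) = i - 1" if "1 \<le> i" for i using that by (simp add: pos_def nat_diff_distrib)
  have q: "Defs.pos \<Phi> (- int i) = mat_size \<Phi> - i" if "1 \<le> i" for i
    using that by (simp add: pos_def nat_diff_distrib')
  have z: "Defs.pos \<Phi> 0 = rank \<Phi>" by (simp add: pos_def)
  define m where "m = mat_size \<Phi>"
  have e: "(elem_mat \<Phi> u v :: 'a mat) $$ (a, b) = (if a = Defs.pos \<Phi> u \<and> b = Defs.pos \<Phi> v then 1 else 0)"
    "dim_row (elem_mat \<Phi> u v :: 'a mat) = m" "dim_col (elem_mat \<Phi> u v :: 'a mat) = m" for u v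
    using assms(2,3) by (simp_all add: elem_mat_def m_def)
  obtain r c where rc: "ent \<Phi> \<alpha> = (r, c)" by (cases "ent \<Phi> \<alpha>")
  have rc': "r < m" "c < m" using ent_tri[OF assms(1)] rc by (auto simp: tri_def m_def)
  have ab: "a < m" "b < m" using assms by (auto simp: m_def)
  have refl: "(r, c) = (m - 1 - b, m - 1 - a) \<longleftrightarrow> a = m - 1 - c \<and> b = m - 1 - r"
    using rc' ab by auto
  have "(root_mat \<Phi> \<alpha> :: 'a mat) $$ (a, b) = (if a = r \<and> b = c then 1 else 0)
      - (if a = m - 1 - c \<and> b = m - 1 - r then 1 else 0)"
  proof (cases \<alpha>)
    case (Eps i)
    then have "1 \<le> i" "m - 1 - rank \<Phi> = rank \<Phi>" "m - 1 - (i - 1) = m - i" "r = rank \<Phi>" "c = i - 1"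
      using assms(1) rc by (auto simp: pos_roots_iff is_B_def m_def)
    then show ?thesis using Eps ab by (simp add: e p q z m_def[symmetric] del: One_nat_def)
  next
    case (EpsMinus i j)
    then have "1 \<le> i" "1 \<le> j" "m - 1 - (j - 1) = m - j" "m - 1 - (i - 1) = m - i" "r = j - 1" "c = i - 1"
      using assms(1) rc by (auto simp: pos_roots_iff)
    then show ?thesis using EpsMinus ab by (simp add: e p q z m_def[symmetric] del: One_nat_def)
  next
    case (EpsPlus i j)
    then have "1 \<le> i" "1 \<le> j" "m - 1 - (m - j) = j - 1" "m - 1 - (i - 1) = m - i" "r = m - j" "c = i - 1"
      using assms(1) rc by (auto simp: pos_roots_iff m_def mat_size_cases)
    then show ?thesis using EpsPlus ab by (simp add: e p q z m_def[symmetric] del: One_nat_def)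
  qed
  then show ?thesis using rc refl by (auto simp: m_def)
qed

section \<open>Singular roots\<close>

text \<open>For positive roots, the coordinates extended by zero to all natural numbers, so that
  identities between roots can be tested at any index without bounds.\<close>

fun coef :: "root \<Rightarrow> nat \<Rightarrow> real" where
  "coef (Eps i) t = (if t = i then 1 else 0)"
| "coef (EpsMinus i j) t = (if t = i then 1 else 0) - (if t = j then 1 else 0)"
| "coef (EpsPlus i j) t = (if t = i then 1 else 0) + (if t = j then 1 else 0)"

lemma dim_root_vec [simp]: "dim_vec (root_vec n \<alpha>) = n"
  by (cases \<alpha>) (auto simp: eps_def)

lemma root_vec_index:
  assumes "\<alpha> \<in> pos_roots \<Phi>" "t < rank \<Phi>"
  shows "root_vec (rank \<Phi>) \<alpha> $ t = coef \<alpha> (t + 1)"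
  using assms by (cases \<alpha>) (auto simp: pos_roots_iff eps_def)

lemma coef_outside: "\<alpha> \<in> pos_roots \<Phi> \<Longrightarrow> t = 0 \<or> rank \<Phi> < t \<Longrightarrow> coef \<alpha> t = 0"
  by (cases \<alpha>) (auto simp: pos_roots_iff)

lemma root_vec_add_iff:
  assumes "\<alpha> \<in> pos_roots \<Phi>" "\<gamma> \<in> pos_roots \<Phi>" "\<beta> \<in> pos_roots \<Phi>"
  shows "root_vec (rank \<Phi>) \<alpha> + root_vec (rank \<Phi>) \<gamma> = root_vec (rank \<Phi>) \<beta>
    \<longleftrightarrow> (\<forall>t. coef \<alpha> t + coef \<gamma> t = coef \<beta> t)"
proof
  assume e: "root_vec (rank \<Phi>) \<alpha> + root_vec (rank \<Phi>) \<gamma> = root_vec (rank \<Phi>) \<beta>"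
  show "\<forall>t. coef \<alpha> t + coef \<gamma> t = coef \<beta> t"
  proof
    fix t
    show "coef \<alpha> t + coef \<gamma> t = coef \<beta> t"
    proof (cases "t = 0 \<or> rank \<Phi> < t")
      case True
      then show ?thesis using coef_outside assms by simp
    next
      case False
      then have t: "t - 1 < rank \<Phi>" "t - 1 + 1 = t" by auto
      then show ?thesis using arg_cong[OF e, of "\<lambda>v :: real vec. vec_index v (t - 1)"]
          root_vec_index[OF assms(1) t(1)] root_vec_index[OF assms(2) t(1)] root_vec_index[OF assms(3) t(1)]
        by simp
    qed
  qed
next
  assume "\<forall>t. coef \<alpha> t + coef \<gamma> t = coef \<beta> t"
  then show "root_vec (rank \<Phi>) \<alpha> + root_vec (rank \<Phi>) \<gamma> = root_vec (rank \<Phi>) \<beta>"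
    using assms by (intro eq_vecI) (auto simp: root_vec_index)
qed

lemma scalar_prod_root_vec:
  assumes "\<alpha> \<in> pos_roots \<Phi>" "\<gamma> \<in> pos_roots \<Phi>"
  shows "root_vec (rank \<Phi>) \<alpha> \<bullet> root_vec (rank \<Phi>) \<gamma> = (\<Sum>t\<in>{1..rank \<Phi>}. coef \<alpha> t * coef \<gamma> t)"
proof -
  have "root_vec (rank \<Phi>) \<alpha> \<bullet> root_vec (rank \<Phi>) \<gamma> = (\<Sum>t<rank \<Phi>. coef \<alpha> (t + 1) * coef \<gamma> (t + 1))"
    using assms by (simp add: scalar_prod_def root_vec_index lessThan_atLeast0)
  also have "\<dots> = (\<Sum>t\<in>{1..rank \<Phi>}. coef \<alpha> t * coef \<gamma> t)"
    by (rule sum.reindex_bij_witness[of _ "\<lambda>t. t - 1" "\<lambda>t. t + 1"]) auto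
  finally show ?thesis .
qed

text \<open>Since \<alpha> avoids column 1, the summand eps_1 of \<beta> comes from \<gamma>. For i
  = col(\<alpha>), either \<beta> = eps_1 + eps_i, and then the column of \<alpha> mirrors the row
  of \<beta>; or \<gamma> must cancel eps_i, so \<gamma> = eps_1 - eps_i, and \<alpha> has the row
  of \<beta>.\<close>

lemma singular_roots_imp_ent:
  assumes \<beta>: "\<beta> \<in> pos_roots \<Phi>" "ent \<Phi> \<beta> = (k, 0)"
    and \<alpha>: "\<alpha> \<in> pos_roots \<Phi>" "root_col \<alpha> \<noteq> 1"
    and \<gamma>: "\<gamma> \<in> pos_roots \<Phi>" "\<And>t. coef \<alpha> t + coef \<gamma> t = coef \<beta> t"
  shows "fst (ent \<Phi> \<alpha>) = k \<or> snd (ent \<Phi> \<alpha>) = mat_size \<Phi> - 1 - k"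
proof -
  have b1: "root_col \<beta> = 1" using snd_ent[of \<Phi> \<beta>] root_col_pos[OF \<beta>(1)] \<beta>(2) by auto
  have c1: "coef \<gamma> 1 = 1"
    using \<gamma>(2)[of 1] b1 \<alpha> \<beta>(1) by (cases \<alpha>; cases \<beta>) (auto simp: pos_roots_iff)
  define i where "i = root_col \<alpha>"
  have i: "1 < i" using \<alpha> root_col_pos[OF \<alpha>(1)] by (simp add: i_def)
  have "coef \<alpha> i = 1" using \<alpha>(1) by (cases \<alpha>) (auto simp: i_def pos_roots_iff)
  then have ci: "coef \<beta> i - coef \<gamma> i = 1" using \<gamma>(2)[of i] by simp
  have g1: "root_col \<gamma> = 1"
    using c1 \<gamma>(1) by (cases \<gamma>) (auto simp: pos_roots_iff split: if_splits)
  have bi: "\<beta> = EpsPlus 1 i \<or> coef \<beta> i \<le> 0" using b1 i by (cases \<beta>) auto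
  have gi: "\<gamma> = EpsMinus 1 i \<or> coef \<gamma> i \<ge> 0" using g1 i by (cases \<gamma>) auto
  show ?thesis
  proof (cases "\<beta> = EpsPlus 1 i")
    case True
    then have "k = mat_size \<Phi> - i" "i \<le> rank \<Phi>" using \<beta> by (auto simp: pos_roots_iff)
    then have "i - 1 = mat_size \<Phi> - 1 - k" by (auto simp: mat_size_cases)
    then show ?thesis using snd_ent[of \<Phi> \<alpha>] by (simp add: i_def)
  next
    case False
    then have g: "\<gamma> = EpsMinus 1 i" using ci bi gi by auto
    then have bi0: "coef \<beta> i = 0" using ci i by simp
    have e: "coef \<alpha> t = coef \<beta> t" if "t \<noteq> 1" "t \<noteq> i" for t
      using \<gamma>(2)[of t] that by (simp add: g)
    have "fst (ent \<Phi> \<alpha>) = fst (ent \<Phi> \<beta>)"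
    proof (cases \<alpha>)
      case (Eps a)
      \<comment> \<open>The coordinate tested is the second index of \<beta>, if there is one: there
        \<alpha> = eps_a vanishes but \<beta> does not.\<close>
      then show ?thesis
        using e[of "nat \<bar>root_row \<beta>\<bar>"] b1 bi0 \<beta>(1) i by (cases \<beta>) (auto simp: i_def pos_roots_iff split: if_splits)
    next
      case (EpsMinus a j)
      then show ?thesis
        using e[of j] b1 \<alpha>(1) i by (cases \<beta>) (auto simp: i_def pos_roots_iff split: if_splits)
    next
      case (EpsPlus a j)
      then show ?thesis
        using e[of j] b1 \<alpha>(1) i by (cases \<beta>) (auto simp: i_def pos_roots_iff split: if_splits)
    qed
    then show ?thesis using \<beta>(2) by simp
  qed
qed

lemma coef_complement_same_row:
  assumes "\<beta> \<in> pos_roots \<Phi>" "root_col \<beta> = 1" "\<alpha> \<in> pos_roots \<Phi>" "root_col \<alpha> \<noteq> 1"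
    and "fst (ent \<Phi> \<alpha>) = fst (ent \<Phi> \<beta>)"
  shows "EpsMinus 1 (root_col \<alpha>) \<in> pos_roots \<Phi> \<and>
    (\<forall>t. coef \<alpha> t + coef (EpsMinus 1 (root_col \<alpha>)) t = coef \<beta> t)"
  using assms by (cases \<alpha>; cases \<beta>) (auto simp: pos_roots_iff mat_size_cases split: if_splits)

text \<open>For \<alpha> in column i this is eps_1 + eps_i - \<alpha>, the complement of \<alpha> in
  \<beta> = eps_1 + eps_i.\<close>

fun opposite_row :: "root \<Rightarrow> root" where
  "opposite_row (Eps i) = Eps 1"
| "opposite_row (EpsMinus i j) = EpsPlus 1 j"
| "opposite_row (EpsPlus i j) = EpsMinus 1 j"

lemma coef_complement_opposite_row:
  assumes "\<beta> \<in> pos_roots \<Phi>" "root_col \<beta> = 1" "\<alpha> \<in> pos_roots \<Phi>" "root_col \<alpha> \<noteq> 1"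
    and "snd (ent \<Phi> \<alpha>) = mat_size \<Phi> - 1 - fst (ent \<Phi> \<beta>)"
  shows "opposite_row \<alpha> \<in> pos_roots \<Phi> \<and>
    (\<forall>t. coef \<alpha> t + coef (opposite_row \<alpha>) t = coef \<beta> t)"
  using assms by (cases \<alpha>; cases \<beta>) (auto simp: pos_roots_iff mat_size_cases split: if_splits)

text \<open>The complement of \<alpha> in \<beta> is eps_1 - eps_i, with i = col(\<alpha>), when
  \<alpha> has the row of \<beta>, and the root \<open>opposite_row \<alpha>\<close> when the column
  of \<alpha> mirrors that row. The latter occurs only for \<beta> = eps_1 + eps_i, because columns
  of positive roots lie left of the middle.\<close>

lemma singular_minus_iff:
  assumes \<beta>: "\<beta> \<in> pos_roots \<Phi>" "root_col \<beta> = 1" and \<alpha>: "\<alpha> \<in> pos_roots \<Phi>" "root_col \<alpha> \<noteq> 1"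
  shows "\<alpha> \<in> singular_minus \<Phi> \<beta> \<longleftrightarrow>
    fst (ent \<Phi> \<alpha>) = fst (ent \<Phi> \<beta>) \<or> snd (ent \<Phi> \<alpha>) = mat_size \<Phi> - 1 - fst (ent \<Phi> \<beta>)"
proof -
  have b: "ent \<Phi> \<beta> = (fst (ent \<Phi> \<beta>), 0)" using snd_ent[of \<Phi> \<beta>] \<beta>(2) by (simp add: prod_eq_iff)
  have "\<alpha> \<in> singular_minus \<Phi> \<beta> \<longleftrightarrow> (\<exists>\<gamma>\<in>pos_roots \<Phi>. \<forall>t. coef \<alpha> t + coef \<gamma> t = coef \<beta> t)"
    using \<alpha> \<beta> root_vec_add_iff[OF \<alpha>(1) _ \<beta>(1)] by (auto simp: singular_minus_def singular_roots_def)
  then show ?thesis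
    using singular_roots_imp_ent[OF \<beta>(1) b \<alpha>] coef_complement_same_row[OF \<beta> \<alpha>]
      coef_complement_opposite_row[OF \<beta> \<alpha>] by blast
qed

section \<open>The root subsets as sets of positions\<close>

definition killed :: "root_system \<Rightarrow> root \<Rightarrow> nat set" where
  "killed \<Phi> \<beta> = (if root_col \<beta> > 1 then {} else {fst (ent \<Phi> \<beta>)})"

lemma ent_bounds:
  assumes "\<alpha> \<in> pos_roots \<Phi>"
  shows "snd (ent \<Phi> \<alpha>) < fst (ent \<Phi> \<alpha>)" "fst (ent \<Phi> \<alpha>) < mat_size \<Phi> - 1"
    "snd (ent \<Phi> \<alpha>) < mat_size \<Phi> - 1" "fst (ent \<Phi> \<alpha>) + snd (ent \<Phi> \<alpha>) + 1 < mat_size \<Phi>"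
  using ent_tri[OF assms] by (auto simp: tri_def)

lemma root_col_iff: "\<alpha> \<in> pos_roots \<Phi> \<Longrightarrow> root_col \<alpha> = 1 \<longleftrightarrow> snd (ent \<Phi> \<alpha>) = 0"
  using root_col_pos[of \<alpha> \<Phi>] by (auto simp: snd_ent)

lemma roots1_iff:
  assumes \<beta>: "\<beta> \<in> pos_roots \<Phi>"
  shows "\<alpha> \<in> roots1 \<Phi> \<beta> \<longleftrightarrow> \<alpha> \<in> pos_roots \<Phi> \<and> 1 \<le> snd (ent \<Phi> \<alpha>) \<and>
    fst (ent \<Phi> \<alpha>) \<notin> killed \<Phi> \<beta> \<and> mat_size \<Phi> - 1 - snd (ent \<Phi> \<alpha>) \<notin> killed \<Phi> \<beta>"
proof (cases "\<alpha> \<in> pos_roots \<Phi> \<and> root_col \<alpha> \<noteq> 1")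
  case False
  then show ?thesis using root_col_iff[of \<alpha> \<Phi>] by (auto simp: roots1_def col_set_def split: if_splits)
next
  case True
  then have \<alpha>: "\<alpha> \<in> pos_roots \<Phi>" "root_col \<alpha> \<noteq> 1" by auto
  have s: "1 \<le> snd (ent \<Phi> \<alpha>)" using root_col_iff[OF \<alpha>(1)] \<alpha>(2) by simp
  show ?thesis
  proof (cases "root_col \<beta> > 1")
    case True
    then show ?thesis using \<alpha> s by (simp add: roots1_def col_set_def killed_def)
  next
    case False
    then have b: "root_col \<beta> = 1" using root_col_pos[OF \<beta>] by simp
    show ?thesis
      using b \<alpha> s singular_minus_iff[OF \<beta> b \<alpha>] ent_bounds[OF \<alpha>(1)] ent_bounds[OF \<beta>]
      by (auto simp: roots1_def col_set_def killed_def)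
  qed
qed

text \<open>The root of column 1 with the opposite sign has row m - 1 - k, so its S^- gives the
  mirrored conditions. For \<beta> = eps_1 the middle row is its own mirror image, and these
  conditions already hold on \<open>roots1\<close>.\<close>

lemma roots2_iff:
  assumes \<beta>: "\<beta> \<in> pos_roots \<Phi>"
  shows "\<alpha> \<in> roots2 \<Phi> \<beta> \<longleftrightarrow> \<alpha> \<in> roots1 \<Phi> \<beta> \<and>
    mat_size \<Phi> - 1 - fst (ent \<Phi> \<alpha>) \<notin> killed \<Phi> \<beta> \<and> snd (ent \<Phi> \<alpha>) \<notin> killed \<Phi> \<beta>"
proof (cases "\<alpha> \<in> roots1 \<Phi> \<beta> \<and> root_col \<beta> = 1")
  case False
  moreover have "roots2 \<Phi> \<beta> \<subseteq> roots1 \<Phi> \<beta>" by (auto simp: roots2_def split: root.splits if_splits)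
  moreover have "roots2 \<Phi> \<beta> = roots1 \<Phi> \<beta>" "killed \<Phi> \<beta> = {}" if "root_col \<beta> \<noteq> 1"
    using that root_col_pos[OF \<beta>] by (auto simp: roots2_def killed_def split: root.splits)
  ultimately show ?thesis by blast
next
  case True
  then have \<alpha>1: "\<alpha> \<in> roots1 \<Phi> \<beta>" and b: "root_col \<beta> = 1" by auto
  then have \<alpha>: "\<alpha> \<in> pos_roots \<Phi>" "root_col \<alpha> \<noteq> 1"
    and r1: "fst (ent \<Phi> \<alpha>) \<notin> killed \<Phi> \<beta>" "mat_size \<Phi> - 1 - snd (ent \<Phi> \<alpha>) \<notin> killed \<Phi> \<beta>"
    using roots1_iff[OF \<beta>] root_col_iff by auto
  note bd = ent_bounds[OF \<alpha>(1)]
  have opp: "\<alpha> \<notin> singular_minus \<Phi> \<beta>' \<longleftrightarrow>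
      mat_size \<Phi> - 1 - fst (ent \<Phi> \<alpha>) \<notin> killed \<Phi> \<beta> \<and> snd (ent \<Phi> \<alpha>) \<notin> killed \<Phi> \<beta>"
    if "\<beta>' \<in> pos_roots \<Phi>" "root_col \<beta>' = 1" "fst (ent \<Phi> \<beta>') = mat_size \<Phi> - 1 - fst (ent \<Phi> \<beta>)" for \<beta>'
    using singular_minus_iff[OF that(1,2) \<alpha>] that(3) bd ent_bounds[OF \<beta>] b
    by (auto simp: killed_def)
  show ?thesis
  proof (cases \<beta>)
    case (Eps j)
    then have "mat_size \<Phi> - 1 - fst (ent \<Phi> \<beta>) = fst (ent \<Phi> \<beta>)"
      using \<beta> by (auto simp: pos_roots_iff is_B_def)
    then have "mat_size \<Phi> - 1 - fst (ent \<Phi> \<alpha>) \<notin> killed \<Phi> \<beta>" "snd (ent \<Phi> \<alpha>) \<notin> killed \<Phi> \<beta>"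
      using r1 bd b by (auto simp: killed_def)
    then show ?thesis using \<alpha>1 Eps by (simp add: roots2_def)
  next
    case (EpsMinus i j)
    then have *: "i = 1" "EpsPlus 1 j \<in> pos_roots \<Phi>"
      "fst (ent \<Phi> (EpsPlus 1 j)) = mat_size \<Phi> - 1 - fst (ent \<Phi> \<beta>)"
      using \<beta> b by (auto simp: pos_roots_iff)
    then show ?thesis using opp[of "EpsPlus 1 j"] \<alpha>1 EpsMinus by (simp add: roots2_def)
  next
    case (EpsPlus i j)
    then have *: "i = 1" "EpsMinus 1 j \<in> pos_roots \<Phi>"
      "fst (ent \<Phi> (EpsMinus 1 j)) = mat_size \<Phi> - 1 - fst (ent \<Phi> \<beta>)"
      using \<beta> b by (auto simp: pos_roots_iff mat_size_cases)
    then show ?thesis using opp[of "EpsMinus 1 j"] \<alpha>1 EpsPlus by (simp add: roots2_def)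
  qed
qed

section \<open>The Lie algebra and its subspaces in coordinates\<close>

lemma mat_exp_mexp: "mat_exp \<Phi> x = mexp (mat_size \<Phi>) x"
  by (simp add: mat_exp_def mexp_def)

lemma index_lin_comb:
  assumes "S \<subseteq> pos_roots \<Phi>" "a < mat_size \<Phi>" "b < mat_size \<Phi>"
  shows "lin_comb \<Phi> S c $$ (a, b) = (\<Sum>\<alpha>\<in>S. c \<alpha> * root_mat \<Phi> \<alpha> $$ (a, b))"
proof -
  have "root_mat \<Phi> \<alpha> \<in> carrier_mat (mat_size \<Phi>) (mat_size \<Phi>)" for \<alpha>
    by (cases \<alpha>) (auto simp: elem_mat_def)
  then have "(c \<alpha> \<cdot>\<^sub>m root_mat \<Phi> \<alpha>) $$ (a, b) = c \<alpha> * root_mat \<Phi> \<alpha> $$ (a, b)" for \<alpha>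
    using assms(2,3) by (metis carrier_matD index_smult_mat(1))
  then show ?thesis using assms by (simp add: lin_comb_def mat_sum_def)
qed

lemma lin_comb_carrier: "lin_comb \<Phi> S c \<in> carrier_mat (mat_size \<Phi>) (mat_size \<Phi>)"
  by (simp add: lin_comb_def mat_sum_def)

lemma lin_comb_skew:
  fixes c :: "root \<Rightarrow> 'a::field"
  assumes S: "S \<subseteq> pos_roots \<Phi>"
  shows "lin_comb \<Phi> S c \<in> skew (mat_size \<Phi>)"
proof -
  let ?m = "mat_size \<Phi>"
  have "lin_comb \<Phi> S c \<in> pat ?m (lower ?m)"
  proof (rule patI[OF lin_comb_carrier])
    fix a b assume ab: "a < ?m" "b < ?m" "(a, b) \<notin> lower ?m"
    have "(root_mat \<Phi> \<alpha> :: 'a mat) $$ (a, b) = 0" if "\<alpha> \<in> S" for \<alpha>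
    proof -
      have "ent \<Phi> \<alpha> \<in> tri ?m" using that S ent_tri by blast
      then have "ent \<Phi> \<alpha> \<noteq> (a, b)" "ent \<Phi> \<alpha> \<noteq> (?m - 1 - b, ?m - 1 - a)"
        using ab by (auto simp: tri_def lower_def)
      then show ?thesis using index_root_mat[of \<alpha> \<Phi> a b] that S ab by auto
    qed
    then show "lin_comb \<Phi> S c $$ (a, b) = 0" using index_lin_comb[OF S ab(1,2), of c] by simp
  qed
  moreover have "sigma ?m (lin_comb \<Phi> S c) = - lin_comb \<Phi> S c"
  proof (rule eq_matI)
    fix a b assume "a < dim_row (- lin_comb \<Phi> S c)" "b < dim_col (- lin_comb \<Phi> S c)"
    then have ab: "a < ?m" "b < ?m" using carrier_matD[OF lin_comb_carrier[of \<Phi> S c]] by auto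
    then have ab': "?m - 1 - b < ?m" "?m - 1 - a < ?m" "?m - 1 - (?m - 1 - a) = a" "?m - 1 - (?m - 1 - b) = b"
      by linarith+
    have "root_mat \<Phi> \<alpha> $$ (?m - 1 - b, ?m - 1 - a) = - (root_mat \<Phi> \<alpha> :: 'a mat) $$ (a, b)"
      if "\<alpha> \<in> S" for \<alpha>
    proof -
      have \<alpha>: "\<alpha> \<in> pos_roots \<Phi>" using that S by blast
      show ?thesis
        unfolding index_root_mat[OF \<alpha> ab] index_root_mat[OF \<alpha> ab'(1,2)] ab'(3,4) by simp
    qed
    then show "sigma ?m (lin_comb \<Phi> S c) $$ (a, b) = (- lin_comb \<Phi> S c) $$ (a, b)"
      using ab index_lin_comb[OF S ab, of c] index_lin_comb[OF S ab'(1,2), of c]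
        carrier_matD[OF lin_comb_carrier[of \<Phi> S c]]
      by (simp add: sum_negf)
  qed (use carrier_matD[OF lin_comb_carrier[of \<Phi> S c]] in auto)
  ultimately show ?thesis by (simp add: skew_def)
qed

text \<open>The mirror entries of all root vectors lie outside \<open>tri\<close>, so at a position
  in \<open>tri\<close> only one root contributes.\<close>

lemma lin_comb_ent:
  fixes c :: "root \<Rightarrow> 'a::field"
  assumes S: "S \<subseteq> pos_roots \<Phi>" and \<gamma>: "\<gamma> \<in> pos_roots \<Phi>"
  shows "lin_comb \<Phi> S c $$ ent \<Phi> \<gamma> = (if \<gamma> \<in> S then c \<gamma> else 0)"
proof -
  obtain a b where ab: "ent \<Phi> \<gamma> = (a, b)" by (cases "ent \<Phi> \<gamma>")
  have t: "(a, b) \<in> tri (mat_size \<Phi>)" using ent_tri[OF \<gamma>] ab by simp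
  then have lt: "a < mat_size \<Phi>" "b < mat_size \<Phi>" by (auto simp: tri_def)
  have r: "(root_mat \<Phi> \<alpha> :: 'a mat) $$ (a, b) = (if \<alpha> = \<gamma> then 1 else 0)" if "\<alpha> \<in> S" for \<alpha>
  proof -
    have \<alpha>: "\<alpha> \<in> pos_roots \<Phi>" using that S by blast
    have "ent \<Phi> \<alpha> \<noteq> (mat_size \<Phi> - 1 - b, mat_size \<Phi> - 1 - a)"
      using ent_tri[OF \<alpha>] t by (auto simp: tri_def)
    then show ?thesis using index_root_mat[OF \<alpha> lt] ent_inj[OF \<alpha> \<gamma>] ab by auto
  qed
  have "lin_comb \<Phi> S c $$ (a, b) = (\<Sum>\<alpha>\<in>S. if \<alpha> = \<gamma> then c \<alpha> else 0)"
    unfolding index_lin_comb[OF S lt] using r by (intro sum.cong) auto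
  then show ?thesis using ab finite_subset[OF S finite_pos_roots] by simp
qed

context
  fixes \<Phi> :: root_system
  assumes char: "mat_size \<Phi> \<le> CHAR('a::{field,finite})" and char2: "2 < CHAR('a)"
begin

text \<open>A position below the diagonal is in \<open>tri\<close>, mirror to one in
  \<open>tri\<close>, or on the antidiagonal. In the last case skewness reads z = -z, which gives 0
  since the characteristic exceeds 2.\<close>

lemma skew_eqI_ent:
  fixes x y :: "'a mat"
  assumes x: "x \<in> skew (mat_size \<Phi>)" and y: "y \<in> skew (mat_size \<Phi>)"
    and e: "\<And>\<alpha>. \<alpha> \<in> pos_roots \<Phi> \<Longrightarrow> x $$ ent \<Phi> \<alpha> = y $$ ent \<Phi> \<alpha>"
  shows "x = y"
proof (rule eq_matI)
  let ?m = "mat_size \<Phi>"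
  fix a b assume "a < dim_row y" "b < dim_col y"
  then have ab: "a < ?m" "b < ?m" using skewD(2)[OF y] by auto
  have tri: "x $$ (a, b) = y $$ (a, b)" if "(a, b) \<in> tri ?m" for a b
    using ent_surj[OF that] e by metis
  consider "a \<le> b" | "(a, b) \<in> tri ?m" | "(?m - 1 - b, ?m - 1 - a) \<in> tri ?m" | "?m - 1 - b = a" "?m - 1 - a = b"
  proof -
    have "a \<le> b \<or> (a, b) \<in> tri ?m \<or> (?m - 1 - b, ?m - 1 - a) \<in> tri ?m \<or> (?m - 1 - b = a \<and> ?m - 1 - a = b)"
      unfolding tri_def mem_Collect_eq prod.case using ab by linarith
    then show thesis using that by blast
  qed
  then show "x $$ (a, b) = y $$ (a, b)"
  proof cases
    case 1
    then show ?thesis using skewD(5)[OF x ab] skewD(5)[OF y ab] by simp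
  next
    case 2
    then show ?thesis by (rule tri)
  next
    case 3
    then show ?thesis using tri[OF 3] skewD(4)[OF x ab] skewD(4)[OF y ab] by simp
  next
    case 4
    have two: "(2 :: 'a) \<noteq> 0"
    proof
      assume "(2 :: 'a) = 0"
      then have "(of_nat 2 :: 'a) = 0" by simp
      then have "CHAR('a) dvd 2" using of_nat_eq_0_iff_char_dvd by blast
      then show False using char2 dvd_imp_le by fastforce
    qed
    have "z $$ (a, b) = 0" if "z \<in> skew ?m" for z :: "'a mat"
    proof -
      have "z $$ (a, b) = - z $$ (a, b)" using skewD(4)[OF that ab] unfolding 4 .
      then have "2 * z $$ (a, b) = 0" by (metis mult_2 add.right_inverse)
      then show ?thesis using two mult_eq_0_iff by blast
    qed
    then show ?thesis using x y by simp
  qed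
qed (use skewD(2)[OF x] skewD(2)[OF y] in auto)

lemma root_span_eq:
  assumes S: "S \<subseteq> pos_roots \<Phi>"
  shows "root_span \<Phi> S = {x \<in> skew (mat_size \<Phi>). \<forall>\<alpha>\<in>pos_roots \<Phi> - S. (x :: 'a mat) $$ ent \<Phi> \<alpha> = 0}"
proof (intro equalityI subsetI)
  fix x :: "'a mat" assume "x \<in> root_span \<Phi> S"
  then obtain c where "x = lin_comb \<Phi> S c" by (auto simp: root_span_def)
  then show "x \<in> {x \<in> skew (mat_size \<Phi>). \<forall>\<alpha>\<in>pos_roots \<Phi> - S. x $$ ent \<Phi> \<alpha> = 0}"
    by (auto simp: lin_comb_skew[OF S] lin_comb_ent[OF S])
next
  fix x :: "'a mat" assume x: "x \<in> {x \<in> skew (mat_size \<Phi>). \<forall>\<alpha>\<in>pos_roots \<Phi> - S. x $$ ent \<Phi> \<alpha> = 0}"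
  have "x = lin_comb \<Phi> S (\<lambda>\<alpha>. x $$ ent \<Phi> \<alpha>)"
    using x by (intro skew_eqI_ent) (auto simp: lin_comb_skew[OF S] lin_comb_ent[OF S])
  then show "x \<in> root_span \<Phi> S" unfolding root_span_def by (rule range_eqI[of _ "lin_comb \<Phi> S"])
qed

lemma lie_alg_eq: "lie_alg \<Phi> = (skew (mat_size \<Phi>) :: 'a mat set)"
  using root_span_eq[of "pos_roots \<Phi>"] by (simp add: lie_alg_def)

text \<open>Q has to be symmetric under the reflection because each root vector also has a mirror
  entry; the entries at the positions \<open>ent\<close> then decide membership.\<close>

lemma exp_span_eq:
  assumes S: "S \<subseteq> pos_roots \<Phi>" and Q: "trans Q" "Q \<subseteq> lower (mat_size \<Phi>)"
    and sym: "\<And>a b. a < mat_size \<Phi> \<Longrightarrow> b < mat_size \<Phi> \<Longrightarrow>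
      (mat_size \<Phi> - 1 - b, mat_size \<Phi> - 1 - a) \<in> Q \<longleftrightarrow> (a, b) \<in> Q"
    and SQ: "\<And>\<alpha>. \<alpha> \<in> pos_roots \<Phi> \<Longrightarrow> \<alpha> \<in> S \<longleftrightarrow> ent \<Phi> \<alpha> \<in> Q"
  shows "exp_span \<Phi> S = (UG (mat_size \<Phi>) \<inter> upat (mat_size \<Phi>) Q :: 'a mat set)"
proof -
  let ?m = "mat_size \<Phi>"
  have "root_span \<Phi> S = (skew ?m \<inter> pat ?m Q :: 'a mat set)"
  proof (intro equalityI subsetI)
    fix x :: "'a mat" assume "x \<in> root_span \<Phi> S"
    then have x: "x \<in> skew ?m" "\<And>\<alpha>. \<alpha> \<in> pos_roots \<Phi> \<Longrightarrow> ent \<Phi> \<alpha> \<notin> Q \<Longrightarrow> x $$ ent \<Phi> \<alpha> = 0"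
      unfolding root_span_eq[OF S] using SQ by auto
    have "x = restr ?m Q x"
    proof (rule skew_eqI_ent[OF x(1) restr_skew[OF x(1) Q(2) sym]])
      fix \<alpha> assume \<alpha>: "\<alpha> \<in> pos_roots \<Phi>"
      then have "ent \<Phi> \<alpha> \<in> tri ?m" by (rule ent_tri)
      then show "x $$ ent \<Phi> \<alpha> = restr ?m Q x $$ ent \<Phi> \<alpha>"
        using x(2)[OF \<alpha>] by (auto simp: restr_def tri_def)
    qed
    then show "x \<in> skew ?m \<inter> pat ?m Q" using x(1) restr_pat[of ?m Q x] by simp
  next
    fix x :: "'a mat" assume x: "x \<in> skew ?m \<inter> pat ?m Q"
    have "x $$ ent \<Phi> \<alpha> = 0" if "\<alpha> \<in> pos_roots \<Phi> - S" for \<alpha>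
    proof -
      obtain a b where ab: "ent \<Phi> \<alpha> = (a, b)" by (cases "ent \<Phi> \<alpha>")
      then have "(a, b) \<in> tri ?m" "(a, b) \<notin> Q" using that ent_tri[of \<alpha> \<Phi>] SQ[of \<alpha>] by auto
      then show ?thesis using patD(2)[of x ?m Q a b] x ab by (auto simp: tri_def)
    qed
    then show "x \<in> root_span \<Phi> S" unfolding root_span_eq[OF S] using x by blast
  qed
  then show ?thesis
    unfolding exp_span_def mat_exp_mexp using mexp_skew_image[OF char Q] by metis
qed

lemma unip_eq: "unip \<Phi> = \<lparr>carrier = (UG (mat_size \<Phi>) :: 'a mat set), monoid.mult = (*), one = 1\<^sub>m (mat_size \<Phi>)\<rparr>"
  unfolding unip_def lie_alg_eq mat_exp_mexp using mexp_skew[OF char] by simp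

lemma mat_ln_mexp:
  assumes "(x :: 'a mat) \<in> skew (mat_size \<Phi>)"
  shows "mat_ln \<Phi> (mexp (mat_size \<Phi>) x) = x"
proof -
  have "mat_exp \<Phi> = (mexp (mat_size \<Phi>) :: 'a mat \<Rightarrow> 'a mat)" by (rule ext) (rule mat_exp_mexp)
  then show ?thesis
    unfolding mat_ln_def lie_alg_eq using the_inv_into_f_f[OF inj_on_mexp_skew[OF char] assms] by simp
qed

lemma coords_eq:
  assumes x: "(x :: 'a mat) \<in> skew (mat_size \<Phi>)"
  shows "coords \<Phi> x = restrict (\<lambda>\<alpha>. x $$ ent \<Phi> \<alpha>) (pos_roots \<Phi>)"
  unfolding coords_def
proof (rule the_equality)
  let ?c = "restrict (\<lambda>\<alpha>. x $$ ent \<Phi> \<alpha>) (pos_roots \<Phi>)"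
  have "x = lin_comb \<Phi> (pos_roots \<Phi>) ?c"
    using x by (intro skew_eqI_ent) (auto simp: lin_comb_skew lin_comb_ent)
  then show "?c \<in> extensional (pos_roots \<Phi>) \<and> x = lin_comb \<Phi> (pos_roots \<Phi>) ?c" by simp
  fix c assume c: "c \<in> extensional (pos_roots \<Phi>) \<and> x = lin_comb \<Phi> (pos_roots \<Phi>) c"
  show "c = ?c"
  proof (rule extensionalityI[of _ "pos_roots \<Phi>"])
    fix \<alpha> assume "\<alpha> \<in> pos_roots \<Phi>"
    then show "c \<alpha> = ?c \<alpha>" using c lin_comb_ent[of "pos_roots \<Phi>" \<Phi> \<alpha> c] by simp
  qed (use c in auto)
qed

lemma dual_basis_eq:
  "(x :: 'a mat) \<in> skew (mat_size \<Phi>) \<Longrightarrow> \<alpha> \<in> pos_roots \<Phi> \<Longrightarrow> dual_basis \<Phi> \<alpha> x = x $$ ent \<Phi> \<alpha>"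
  by (simp add: dual_basis_def lie_alg_eq coords_eq)

lemma rook_form_eq:
  assumes "D \<subseteq> pos_roots \<Phi>"
  shows "rook_form \<Phi> D \<xi> = (\<lambda>x\<in>skew (mat_size \<Phi>). \<Sum>\<beta>\<in>D. \<xi> \<beta> * (x :: 'a mat) $$ ent \<Phi> \<beta>)"
  unfolding rook_form_def lie_alg_eq using dual_basis_eq assms
  by (intro restrict_ext sum.cong) auto

lemma form_rook_form:
  assumes D: "D \<subseteq> pos_roots \<Phi>"
  shows "form (mat_size \<Phi>) (rook_form \<Phi> D \<xi> :: 'a mat \<Rightarrow> 'a)"
proof (rule formI)
  have e: "fst (ent \<Phi> \<beta>) < mat_size \<Phi> \<and> snd (ent \<Phi> \<beta>) < mat_size \<Phi>" if "\<beta> \<in> D" for \<beta>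
    using ent_tri[of \<beta> \<Phi>] that D by (auto simp: tri_def split: prod.splits)
  fix x y :: "'a mat" assume xy: "x \<in> skew (mat_size \<Phi>)" "y \<in> skew (mat_size \<Phi>)"
  have "(x + y) $$ ent \<Phi> \<beta> = x $$ ent \<Phi> \<beta> + y $$ ent \<Phi> \<beta>" if "\<beta> \<in> D" for \<beta>
    using e[OF that] skewD(2)[OF xy(1)] skewD(2)[OF xy(2)] by (cases "ent \<Phi> \<beta>") auto
  then show "rook_form \<Phi> D \<xi> (x + y) = rook_form \<Phi> D \<xi> x + rook_form \<Phi> D \<xi> y"
    using xy skew_add[OF xy] by (simp add: rook_form_eq[OF D] sum.distrib algebra_simps)
  fix a
  have "(a \<cdot>\<^sub>m x) $$ ent \<Phi> \<beta> = a * x $$ ent \<Phi> \<beta>" if "\<beta> \<in> D" for \<beta>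
    using e[OF that] skewD(2)[OF xy(1)] by (cases "ent \<Phi> \<beta>") auto
  then show "rook_form \<Phi> D \<xi> (a \<cdot>\<^sub>m x) = a * rook_form \<Phi> D \<xi> x"
    using xy skew_smult[OF xy(1)] by (simp add: rook_form_eq[OF D] sum_distrib_left algebra_simps)
qed (simp add: rook_form_eq[OF D])

lemma rook_orbit_eq: "rook_orbit \<Phi> D \<xi> = orb (mat_size \<Phi>) (rook_form \<Phi> D \<xi> :: 'a mat \<Rightarrow> 'a)"
proof -
  have "coadj \<Phi> g \<mu> = coad (mat_size \<Phi>) g \<mu>" if "g \<in> UG (mat_size \<Phi>)" for g and \<mu> :: "'a mat \<Rightarrow> 'a"
    using inv_UG[OF char that] by (simp add: coadj_def coad_def unip_eq lie_alg_eq)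
  then show ?thesis
    unfolding rook_orbit_def orbit_def orb_def by (simp add: unip_eq image_def Bex_def) metis
qed

end

section \<open>Relabelling the kept positions\<close>

text \<open>Inverse of \<open>kappa\<close>, shifted because \<open>kappa\<close> counts from 1 and
  matrix positions count from 0.\<close>

definition iota :: "nat set \<Rightarrow> nat \<Rightarrow> nat" where
  "iota M a = the_inv_into M (kappa M) (Suc a)"

lemma finite_kept [simp]: "finite (kept m K)"
  by (rule finite_subset[of _ "{..m}"]) (auto simp: kept_def)

lemma iota_kappa:
  assumes "finite M"
  shows "a < card M \<Longrightarrow> iota M a \<in> M" "a < card M \<Longrightarrow> kappa M (iota M a) = Suc a"
    and "d \<in> M \<Longrightarrow> iota M (kappa M d - 1) = d" "d \<in> M \<Longrightarrow> 1 \<le> kappa M d \<and> kappa M d \<le> card M"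
proof -
  have bij: "bij_betw (kappa M) M {1..card M}" using bij_betw_kappa[OF assms] .
  then have inj: "inj_on (kappa M) M" and im: "kappa M ` M = {1..card M}" by (auto simp: bij_betw_def)
  show "iota M a \<in> M" "kappa M (iota M a) = Suc a" if "a < card M"
    using the_inv_into_into[OF inj, of "Suc a" M] f_the_inv_into_f[OF inj, of "Suc a"] im that
    by (auto simp: iota_def)
  show k: "1 \<le> kappa M d \<and> kappa M d \<le> card M" if "d \<in> M" using im that by auto
  show "iota M (kappa M d - 1) = d" if "d \<in> M"
    using k[OF that] the_inv_into_f_f[OF inj that] by (simp add: iota_def)
qed

lemma bij_betw_iota:
  assumes "finite M"
  shows "bij_betw (iota M) {..<card M} M"
proof (rule bij_betw_byWitness[where f' = "\<lambda>d. kappa M d - 1"])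
  show "\<forall>a\<in>{..<card M}. kappa M (iota M a) - 1 = a" using iota_kappa(2)[OF assms] by simp
  show "\<forall>d\<in>M. iota M (kappa M d - 1) = d" using iota_kappa(3)[OF assms] by simp
  show "iota M ` {..<card M} \<subseteq> M" using iota_kappa(1)[OF assms] by auto
  show "(\<lambda>d. kappa M d - 1) ` M \<subseteq> {..<card M}" using iota_kappa(4)[OF assms] by fastforce
qed

lemma iota_mono:
  assumes M: "finite M" and ab: "a < b" "b < card M"
  shows "iota M a < iota M b"
proof (rule ccontr)
  assume "\<not> iota M a < iota M b"
  then have "iota M b \<le> iota M a" by simp
  moreover have "iota M a \<in> M" "iota M b \<in> M" using iota_kappa(1)[OF M] ab by auto
  ultimately have "kappa M (iota M b) \<le> kappa M (iota M a)"
    using strict_mono_onD[OF strict_mono_on_kappa[OF M], of "iota M b" "iota M a"]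
    by (cases "iota M b = iota M a") auto
  then show False using iota_kappa(2)[OF M] ab by simp
qed

text \<open>The reflection reverses the kept set, so \<open>kappa\<close> at m - 1 - a counts the
  kept positions from a upwards. Together with the count of those up to a this covers the kept set,
  with a counted twice.\<close>

lemma kappa_kept_reflect:
  assumes a: "a \<in> kept m K"
  shows "kappa (kept m K) (m - 1 - a) + kappa (kept m K) a = card (kept m K) + 1"
proof -
  let ?M = "kept m K"
  have refl: "m - 1 - b \<in> ?M \<and> m - 1 - (m - 1 - b) = b" if "b \<in> ?M" for b
    using that by (auto simp: kept_def)
  have am: "a < m - 1" using a by (simp add: kept_def)
  have "card {b \<in> ?M. b \<le> m - 1 - a} = card {b \<in> ?M. a \<le> b}"
  proof (rule bij_betw_same_card)
    show "bij_betw (\<lambda>b. m - 1 - b) {b \<in> ?M. b \<le> m - 1 - a} {b \<in> ?M. a \<le> b}"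
      using refl am by (intro bij_betw_byWitness[where f' = "\<lambda>b. m - 1 - b"]) (auto simp del: One_nat_def)
  qed
  moreover have "card {b \<in> ?M. a \<le> b} + card {b \<in> ?M. b \<le> a}
      = card ({b \<in> ?M. a \<le> b} \<union> {b \<in> ?M. b \<le> a}) + card ({b \<in> ?M. a \<le> b} \<inter> {b \<in> ?M. b \<le> a})"
    by (rule card_Un_Int) auto
  moreover have "{b \<in> ?M. a \<le> b} \<union> {b \<in> ?M. b \<le> a} = ?M" by auto
  moreover have "{b \<in> ?M. a \<le> b} \<inter> {b \<in> ?M. b \<le> a} = {a}" using a by auto
  ultimately show ?thesis by (simp add: kappa_def)
qed

lemma iota_reflect:
  assumes "a < card (kept m K)"
  shows "iota (kept m K) (card (kept m K) - 1 - a) = m - 1 - iota (kept m K) a"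
proof -
  let ?M = "kept m K"
  have i: "iota ?M a \<in> ?M" "kappa ?M (iota ?M a) = Suc a" using iota_kappa[of ?M] assms by auto
  have r: "m - 1 - d \<in> ?M" if "d \<in> ?M" for d using that by (auto simp: kept_def)
  have "kappa ?M (m - 1 - iota ?M a) - 1 = card ?M - 1 - a"
    using kappa_kept_reflect[OF i(1)] i(2) by simp
  then show ?thesis using iota_kappa(3)[OF _ r[OF i(1)]] by simp
qed

section \<open>The smaller root system\<close>

text \<open>For col(\<beta>) = 1 the count depends on whether k is its own mirror image, which
  happens exactly for \<beta> = eps_1.\<close>

lemma mat_size_smaller:
  assumes \<beta>: "\<beta> \<in> pos_roots \<Phi>"
  shows "mat_size (smaller \<Phi> \<beta>) = card (kept (mat_size \<Phi>) (killed \<Phi> \<beta>))"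
proof (cases "root_col \<beta> > 1")
  case True
  then have "kept (mat_size \<Phi>) (killed \<Phi> \<beta>) = {1..<mat_size \<Phi> - 1}"
    by (auto simp: kept_def killed_def)
  moreover have "2 \<le> rank \<Phi>" using root_col_pos[OF \<beta>] True by simp
  ultimately show ?thesis using True by (cases \<Phi>) auto
next
  case False
  let ?m = "mat_size \<Phi>"
  obtain k where k: "fst (ent \<Phi> \<beta>) = k" by blast
  have b: "root_col \<beta> = 1" "killed \<Phi> \<beta> = {k}" using False root_col_pos[OF \<beta>] k by (auto simp: killed_def)
  have k': "1 \<le> k" "k < ?m - 1" using ent_bounds[OF \<beta>] k by auto
  have ke: "kept ?m (killed \<Phi> \<beta>) = {1..<?m - 1} - {k, ?m - 1 - k}"
    using k' by (auto simp: kept_def b)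
  have cd: "card ({1..<?m - 1} - {k, ?m - 1 - k}) = card {1..<?m - 1} - card {k, ?m - 1 - k}"
    using k' by (intro card_Diff_subset) auto
  have c: "card (kept ?m (killed \<Phi> \<beta>)) = ?m - 2 - card {k, ?m - 1 - k}"
    unfolding ke cd card_atLeastLessThan by linarith
  have "\<beta> = Eps 1 \<and> is_B \<Phi> \<and> ?m - 1 - k = k \<or> root_row \<beta> \<noteq> 0 \<and> ?m - 1 - k \<noteq> k"
    using \<beta> b k by (cases \<beta>) (auto simp: pos_roots_iff mat_size_cases split: if_splits)
  then show ?thesis
  proof
    assume "\<beta> = Eps 1 \<and> is_B \<Phi> \<and> ?m - 1 - k = k"
    then show ?thesis using c by (cases \<Phi>) (auto simp: is_B_def)
  next
    assume r: "root_row \<beta> \<noteq> 0 \<and> ?m - 1 - k \<noteq> k"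
    then have "card {k, ?m - 1 - k} = 2" by (metis card_2_iff)
    then have c4: "card (kept ?m (killed \<Phi> \<beta>)) = ?m - 4" unfolding c by linarith
    have "2 \<le> rank \<Phi>" using r \<beta> by (cases \<beta>) (auto simp: pos_roots_iff)
    then show ?thesis unfolding c4 using r b(1) by (cases \<Phi>) simp_all
  qed
qed

lemma rank_smaller:
  assumes \<beta>: "\<beta> \<in> pos_roots \<Phi>"
  shows "rank (smaller \<Phi> \<beta>) = card (index_set \<Phi> \<beta>)"
    and "is_B (smaller \<Phi> \<beta>) \<longleftrightarrow> is_B \<Phi> \<and> \<beta> \<noteq> Eps 1"
proof -
  have B: "is_B (TypeB n)" "\<not> is_B (TypeD n)" for n by (auto simp: is_B_def)
  show "rank (smaller \<Phi> \<beta>) = card (index_set \<Phi> \<beta>)"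
    using \<beta> by (cases \<Phi>; cases \<beta>) (auto simp: index_set_def)
  show "is_B (smaller \<Phi> \<beta>) \<longleftrightarrow> is_B \<Phi> \<and> \<beta> \<noteq> Eps 1"
    using \<beta> B by (cases \<Phi>; cases \<beta>) auto
qed

lemma finite_index_set [simp]: "finite (index_set \<Phi> \<beta>)"
  by (auto simp: index_set_def split: root.splits)

lemma kept_index:
  assumes \<beta>: "\<beta> \<in> pos_roots \<Phi>" and a: "a < rank \<Phi>"
  shows "a \<in> kept (mat_size \<Phi>) (killed \<Phi> \<beta>) \<longleftrightarrow> Suc a \<in> index_set \<Phi> \<beta>"
proof -
  have "root_col \<beta> \<ge> 1" using root_col_pos[OF \<beta>] by simp
  then show ?thesis
    using \<beta> a by (cases \<beta>) (auto simp: kept_def killed_def index_set_def pos_roots_iff mat_size_cases split: if_splits)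
qed

text \<open>Index i sits at position i - 1. Below the rank, the kept positions and the index set
  correspond under this shift, so their counting functions agree.\<close>

lemma kappa_index:
  assumes \<beta>: "\<beta> \<in> pos_roots \<Phi>" and a: "a < rank \<Phi>"
  shows "kappa (kept (mat_size \<Phi>) (killed \<Phi> \<beta>)) a = kappa (index_set \<Phi> \<beta>) (Suc a)"
proof -
  let ?M = "kept (mat_size \<Phi>) (killed \<Phi> \<beta>)" and ?I = "index_set \<Phi> \<beta>"
  have "0 \<notin> ?I" by (auto simp: index_set_def split: root.splits)
  have "{b \<in> ?I. b \<le> Suc a} = Suc ` {b \<in> ?M. b \<le> a}"
  proof (intro equalityI subsetI)
    fix b assume b: "b \<in> {b \<in> ?I. b \<le> Suc a}"
    then obtain d where "b = Suc d" using \<open>0 \<notin> ?I\<close> by (cases b) auto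
    then show "b \<in> Suc ` {b \<in> ?M. b \<le> a}" using b kept_index[OF \<beta>, of d] a by auto
  next
    fix b assume "b \<in> Suc ` {b \<in> ?M. b \<le> a}"
    then show "b \<in> {b \<in> ?I. b \<le> Suc a}" using kept_index[OF \<beta>] a by auto
  qed
  then show ?thesis by (simp add: kappa_def card_image)
qed

context
  fixes \<Phi> :: root_system and \<beta> :: root
  assumes \<beta>: "\<beta> \<in> pos_roots \<Phi>"
begin

abbreviation (input) "M \<equiv> kept (mat_size \<Phi>) (killed \<Phi> \<beta>)"

lemma roots2_kept:
  assumes "\<alpha> \<in> pos_roots \<Phi>"
  shows "\<alpha> \<in> roots2 \<Phi> \<beta> \<longleftrightarrow> fst (ent \<Phi> \<alpha>) \<in> M \<and> snd (ent \<Phi> \<alpha>) \<in> M"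
  using assms roots1_iff[OF \<beta>, of \<alpha>] roots2_iff[OF \<beta>, of \<alpha>] ent_bounds[OF assms] by (auto simp: kept_def)

text \<open>For rows above the middle, relabelling indices is relabelling positions up to a shift.
  The rows of eps_i and eps_i + eps_j are reached by the reflection: the middle position keeps the
  middle rank, and position m - j is mirror to j - 1.\<close>

lemma pi_root_props:
  assumes \<alpha>: "\<alpha> \<in> pos_roots \<Phi>" "\<alpha> \<in> roots2 \<Phi> \<beta>"
  shows "pi_root \<Phi> \<beta> \<alpha> \<in> pos_roots (smaller \<Phi> \<beta>)"
    and "ent (smaller \<Phi> \<beta>) (pi_root \<Phi> \<beta> \<alpha>) = (kappa M (fst (ent \<Phi> \<alpha>)) - 1, kappa M (snd (ent \<Phi> \<alpha>)) - 1)"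
proof -
  let ?I = "index_set \<Phi> \<beta>" and ?\<Psi> = "smaller \<Phi> \<beta>"
  have k: "fst (ent \<Phi> \<alpha>) \<in> M" "snd (ent \<Phi> \<alpha>) \<in> M" using roots2_kept \<alpha> by auto
  have I: "i \<in> ?I \<and> kappa M (i - 1) = kappa ?I i \<and> 1 \<le> kappa ?I i \<and> kappa ?I i \<le> card ?I"
    if "i - 1 \<in> M" "1 \<le> i" "i \<le> rank \<Phi>" for i
  proof -
    have s: "i - 1 < rank \<Phi>" "Suc (i - 1) = i" using that by auto
    then have "i \<in> ?I" using kept_index[OF \<beta> s(1)] that by simp
    then show ?thesis using kappa_index[OF \<beta> s(1)] s(2) iota_kappa(4)[OF finite_index_set] by simp
  qed
  have lt: "kappa ?I i < kappa ?I j" if "i \<in> ?I" "j \<in> ?I" "i < j" for i j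
    using strict_mono_onD[OF strict_mono_on_kappa[OF finite_index_set] that] .
  have r: "rank ?\<Psi> = card ?I" and m: "mat_size ?\<Psi> = card M"
    using rank_smaller[OF \<beta>] mat_size_smaller[OF \<beta>] by auto
  have "pi_root \<Phi> \<beta> \<alpha> \<in> pos_roots ?\<Psi> \<and>
    ent ?\<Psi> (pi_root \<Phi> \<beta> \<alpha>) = (kappa M (fst (ent \<Phi> \<alpha>)) - 1, kappa M (snd (ent \<Phi> \<alpha>)) - 1)"
  proof (cases \<alpha>)
    case (Eps i)
    then have i: "1 \<le> i" "i \<le> rank \<Phi>" "is_B \<Phi>" using \<alpha> by (auto simp: pos_roots_iff)
    have kr: "rank \<Phi> \<in> M" using k(1) Eps by simp
    have "\<beta> \<noteq> Eps 1" using kr by (auto simp: kept_def killed_def)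
    then have B: "is_B ?\<Psi>" using rank_smaller(2)[OF \<beta>] i by simp
    have "mat_size \<Phi> - 1 - rank \<Phi> = rank \<Phi>" using i by (simp add: is_B_def)
    then have "kappa M (rank \<Phi>) + kappa M (rank \<Phi>) = card M + 1" using kappa_kept_reflect[OF kr] by simp
    then have "kappa M (rank \<Phi>) - 1 = rank ?\<Psi>" using B m by (simp add: is_B_def)
    then show ?thesis using I[of i] i k Eps B r by (auto simp: pi_root_def pos_roots_iff)
  next
    case (EpsMinus i j)
    then have ij: "1 \<le> i" "i < j" "j \<le> rank \<Phi>" using \<alpha> by (auto simp: pos_roots_iff)
    then show ?thesis using I[of i] I[of j] lt[of i j] k EpsMinus r by (auto simp: pi_root_def pos_roots_iff)
  next
    case (EpsPlus i j)
    then have ij: "1 \<le> i" "i < j" "j \<le> rank \<Phi>" using \<alpha> by (auto simp: pos_roots_iff)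
    have jm: "mat_size \<Phi> - 1 - (mat_size \<Phi> - j) = j - 1" "mat_size \<Phi> - 1 - (j - 1) = mat_size \<Phi> - j"
      using ij by (auto simp: mat_size_cases)
    have "mat_size \<Phi> - j \<in> M" using k(1) EpsPlus by simp
    then have j: "j - 1 \<in> M" using jm by (auto simp: kept_def simp del: One_nat_def)
    have "kappa M (mat_size \<Phi> - j) - 1 = mat_size ?\<Psi> - kappa M (j - 1)"
      using kappa_kept_reflect[OF j] m iota_kappa(4)[OF finite_kept j] unfolding jm by linarith
    then show ?thesis using I[of i] I[of j] lt[of i j] k EpsPlus r ij j by (auto simp: pi_root_def pos_roots_iff)
  qed
  then show "pi_root \<Phi> \<beta> \<alpha> \<in> pos_roots ?\<Psi>"
    "ent ?\<Psi> (pi_root \<Phi> \<beta> \<alpha>) = (kappa M (fst (ent \<Phi> \<alpha>)) - 1, kappa M (snd (ent \<Phi> \<alpha>)) - 1)" by auto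
qed

lemma roots2_pos: "roots2 \<Phi> \<beta> \<subseteq> pos_roots \<Phi>" "roots1 \<Phi> \<beta> \<subseteq> pos_roots \<Phi>"
  using roots1_iff[OF \<beta>] roots2_iff[OF \<beta>] by auto

lemma ent_iota:
  assumes \<alpha>: "\<alpha> \<in> roots2 \<Phi> \<beta>" "ent (smaller \<Phi> \<beta>) (pi_root \<Phi> \<beta> \<alpha>) = (a, b)"
  shows "ent \<Phi> \<alpha> = (iota M a, iota M b)" "a < card M" "b < card M"
proof -
  have p: "\<alpha> \<in> pos_roots \<Phi>" using \<alpha> roots2_pos by blast
  have k: "fst (ent \<Phi> \<alpha>) \<in> M" "snd (ent \<Phi> \<alpha>) \<in> M" using roots2_kept[OF p] \<alpha> by auto
  have ab: "a = kappa M (fst (ent \<Phi> \<alpha>)) - 1" "b = kappa M (snd (ent \<Phi> \<alpha>)) - 1"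
    using pi_root_props(2)[OF p \<alpha>(1)] \<alpha>(2) by auto
  then show "ent \<Phi> \<alpha> = (iota M a, iota M b)"
    using iota_kappa(3)[OF finite_kept k(1)] iota_kappa(3)[OF finite_kept k(2)] by (simp add: prod_eq_iff)
  show "a < card M" "b < card M"
    using iota_kappa(4)[OF finite_kept k(1)] iota_kappa(4)[OF finite_kept k(2)] ab by auto
qed

text \<open>For surjectivity, \<iota> carries the smaller \<open>tri\<close> into
  \<open>tri\<close>: monotonicity keeps a position below the diagonal, and monotonicity combined
  with the reflection keeps it above the antidiagonal.\<close>

lemma bij_betw_pi_root: "bij_betw (pi_root \<Phi> \<beta>) (roots2 \<Phi> \<beta>) (pos_roots (smaller \<Phi> \<beta>))"
proof (rule bij_betw_imageI)
  let ?\<Psi> = "smaller \<Phi> \<beta>"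
  show "inj_on (pi_root \<Phi> \<beta>) (roots2 \<Phi> \<beta>)"
  proof (rule inj_onI)
    fix \<alpha> \<gamma> assume *: "\<alpha> \<in> roots2 \<Phi> \<beta>" "\<gamma> \<in> roots2 \<Phi> \<beta>" "pi_root \<Phi> \<beta> \<alpha> = pi_root \<Phi> \<beta> \<gamma>"
    obtain a b where "ent ?\<Psi> (pi_root \<Phi> \<beta> \<alpha>) = (a, b)" by (cases "ent ?\<Psi> (pi_root \<Phi> \<beta> \<alpha>)")
    then have "ent \<Phi> \<alpha> = ent \<Phi> \<gamma>" using ent_iota(1)[OF *(1)] ent_iota(1)[OF *(2)] *(3) by simp
    then show "\<alpha> = \<gamma>" using ent_inj * roots2_pos by blast
  qed
  show "pi_root \<Phi> \<beta> ` roots2 \<Phi> \<beta> = pos_roots ?\<Psi>"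
  proof (intro equalityI subsetI)
    fix \<alpha>' assume "\<alpha>' \<in> pi_root \<Phi> \<beta> ` roots2 \<Phi> \<beta>"
    then show "\<alpha>' \<in> pos_roots ?\<Psi>" using pi_root_props(1) roots2_pos by blast
  next
    fix \<alpha>' assume \<alpha>': "\<alpha>' \<in> pos_roots ?\<Psi>"
    obtain a b where ab: "ent ?\<Psi> \<alpha>' = (a, b)" by (cases "ent ?\<Psi> \<alpha>'")
    have t: "b < a" "a + b + 1 < card M"
      using ent_tri[OF \<alpha>'] ab mat_size_smaller[OF \<beta>] by (auto simp: tri_def)
    have i: "iota M a \<in> M" "iota M b \<in> M" using iota_kappa(1)[OF finite_kept] t by auto
    have "iota M b < iota M a" using iota_mono[OF finite_kept t(1)] t by simp
    moreover have "iota M a < mat_size \<Phi> - 1 - iota M b"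
    proof -
      have "a < card M - 1 - b" "card M - 1 - b < card M" using t by linarith+
      then have "iota M a < iota M (card M - 1 - b)" by (rule iota_mono[OF finite_kept])
      then show ?thesis using iota_reflect[of b "mat_size \<Phi>" "killed \<Phi> \<beta>"] t by simp
    qed
    ultimately have "(iota M a, iota M b) \<in> tri (mat_size \<Phi>)" by (auto simp: tri_def)
    then obtain \<alpha> where \<alpha>: "\<alpha> \<in> pos_roots \<Phi>" "ent \<Phi> \<alpha> = (iota M a, iota M b)" using ent_surj by blast
    then have r: "\<alpha> \<in> roots2 \<Phi> \<beta>" using roots2_kept[OF \<alpha>(1)] i by simp
    have "ent ?\<Psi> (pi_root \<Phi> \<beta> \<alpha>) = ent ?\<Psi> \<alpha>'"
      using pi_root_props(2)[OF \<alpha>(1) r] \<alpha>(2) ab iota_kappa(2)[OF finite_kept] t by simp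
    then have "pi_root \<Phi> \<beta> \<alpha> = \<alpha>'" using ent_inj[OF pi_root_props(1)[OF \<alpha>(1) r] \<alpha>'] by simp
    then show "\<alpha>' \<in> pi_root \<Phi> \<beta> ` roots2 \<Phi> \<beta>" using r by blast
  qed
qed

end

text \<open>Both sides are skew matrices of the smaller size with equal entries at the root
  positions: the coefficient of x at \<alpha> is the entry of the submatrix at the position of the
  relabelled root.\<close>

lemma pi_lie_eq:
  fixes x :: "'a::{field,finite} mat"
  assumes char: "mat_size \<Phi> \<le> CHAR('a)" and char2: "2 < CHAR('a)" and \<beta>: "\<beta> \<in> pos_roots \<Phi>"
    and x: "x \<in> skew (mat_size \<Phi>)"
    and \<tau>: "tau (mat_size (smaller \<Phi> \<beta>)) (iota (kept (mat_size \<Phi>) (killed \<Phi> \<beta>))) x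
      \<in> skew (mat_size (smaller \<Phi> \<beta>))"
    and le: "mat_size (smaller \<Phi> \<beta>) \<le> mat_size \<Phi>"
  shows "pi_lie \<Phi> \<beta> x = tau (mat_size (smaller \<Phi> \<beta>)) (iota (kept (mat_size \<Phi>) (killed \<Phi> \<beta>))) x"
proof -
  let ?\<Psi> = "smaller \<Phi> \<beta>" and ?M = "kept (mat_size \<Phi>) (killed \<Phi> \<beta>)"
  let ?n = "mat_size ?\<Psi>"
  let ?t = "tau ?n (iota ?M) x"
  have n: "?n = card ?M" using mat_size_smaller[OF \<beta>] .
  have charn: "?n \<le> CHAR('a)" using char le by simp
  have e: "x $$ ent \<Phi> \<alpha> = ?t $$ ent ?\<Psi> (pi_root \<Phi> \<beta> \<alpha>)" if "\<alpha> \<in> roots2 \<Phi> \<beta>" for \<alpha>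
  proof -
    obtain a b where ab: "ent ?\<Psi> (pi_root \<Phi> \<beta> \<alpha>) = (a, b)" by (cases "ent ?\<Psi> (pi_root \<Phi> \<beta> \<alpha>)")
    show ?thesis using ent_iota[OF \<beta> that ab] ab n by simp
  qed
  have "pi_lie \<Phi> \<beta> x = mat_sum ?n (\<lambda>\<alpha>. ?t $$ ent ?\<Psi> (pi_root \<Phi> \<beta> \<alpha>) \<cdot>\<^sub>m root_mat ?\<Psi> (pi_root \<Phi> \<beta> \<alpha>)) (roots2 \<Phi> \<beta>)"
    unfolding pi_lie_def mat_sum_def
  proof (intro arg_cong[of _ _ "mat ?n ?n"] ext sum.cong HOL.refl)
    fix rc \<alpha> assume a: "\<alpha> \<in> roots2 \<Phi> \<beta>"
    then have "\<alpha> \<in> pos_roots \<Phi>" using roots2_pos[OF \<beta>] by blast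
    then show "(dual_basis \<Phi> \<alpha> x \<cdot>\<^sub>m root_mat ?\<Psi> (pi_root \<Phi> \<beta> \<alpha>)) $$ rc =
        (?t $$ ent ?\<Psi> (pi_root \<Phi> \<beta> \<alpha>) \<cdot>\<^sub>m root_mat ?\<Psi> (pi_root \<Phi> \<beta> \<alpha>)) $$ rc"
      using dual_basis_eq[OF char char2 x] e[OF a] by simp
  qed
  also have "\<dots> = lin_comb ?\<Psi> (pos_roots ?\<Psi>) (\<lambda>\<alpha>'. ?t $$ ent ?\<Psi> \<alpha>')"
    unfolding lin_comb_def mat_sum_def
    by (intro arg_cong[of _ _ "mat ?n ?n"] ext
        sum.reindex_bij_betw[OF bij_betw_pi_root[OF \<beta>],
          of "\<lambda>\<alpha>'. (?t $$ ent ?\<Psi> \<alpha>' \<cdot>\<^sub>m root_mat ?\<Psi> \<alpha>') $$ rc" for rc])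
  also have "\<dots> = ?t"
    using \<tau> by (intro skew_eqI_ent[OF charn char2]) (auto simp: lin_comb_skew lin_comb_ent)
  finally show ?thesis .
qed

text \<open>For \<beta> = eps_1 + eps_j or eps_1 - eps_j and \<gamma> outside column 1, the inner
  product is up to sign the coordinate of \<gamma> at j; so orthogonality keeps \<gamma> off row k,
  column k and their mirror images. For \<beta> = eps_1 the rook condition on row 0 does
  this.\<close>

lemma rook_roots2:
  assumes D: "orthogonal_rook_placement \<Phi> D" and \<beta>: "\<beta> \<in> D" "root_col \<beta> = 1"
  shows "D \<inter> col_set \<Phi> 1 = {\<beta>}" and "D - col_set \<Phi> 1 \<subseteq> roots2 \<Phi> \<beta>"
proof -
  have Dp: "D \<subseteq> pos_roots \<Phi>" using D by (simp add: orthogonal_rook_placement_def)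
  have \<beta>p: "\<beta> \<in> pos_roots \<Phi>" using Dp \<beta> by blast
  have rank: "1 \<le> rank \<Phi>" using root_col_pos[OF \<beta>p] by simp
  have uniq: "\<gamma> = \<beta>" if "finite S" "card S \<le> 1" "\<gamma> \<in> S" "\<beta> \<in> S" for \<gamma> S
    using that card_le_Suc0_iff_eq[of S] by simp
  have fin: "finite D" using Dp finite_pos_roots finite_subset by blast
  have "card (D \<inter> col_set \<Phi> 1) \<le> 1"
    using D rank by (simp add: orthogonal_rook_placement_def)
  moreover have "\<beta> \<in> D \<inter> col_set \<Phi> 1" using \<beta> \<beta>p by (simp add: col_set_def)
  ultimately show "D \<inter> col_set \<Phi> 1 = {\<beta>}" using uniq[of "D \<inter> col_set \<Phi> 1"] fin by blast
  show "D - col_set \<Phi> 1 \<subseteq> roots2 \<Phi> \<beta>"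
  proof
    fix \<gamma> assume "\<gamma> \<in> D - col_set \<Phi> 1"
    then have \<gamma>: "\<gamma> \<in> D" "\<gamma> \<in> pos_roots \<Phi>" "root_col \<gamma> \<noteq> 1" "\<gamma> \<noteq> \<beta>"
      using Dp \<beta> by (auto simp: col_set_def)
    have "root_vec (rank \<Phi>) \<beta> \<bullet> root_vec (rank \<Phi>) \<gamma> = 0"
      using D \<beta>(1) \<gamma> by (auto simp: orthogonal_rook_placement_def)
    then have o: "(\<Sum>t\<in>{1..rank \<Phi>}. coef \<beta> t * coef \<gamma> t) = 0"
      using scalar_prod_root_vec[OF \<beta>p \<gamma>(2)] by simp
    have c1: "coef \<gamma> 1 = 0" using \<gamma> by (cases \<gamma>) (auto simp: pos_roots_iff)
    have g0: "coef \<gamma> j = 0" if "\<beta> = EpsMinus 1 j \<or> \<beta> = EpsPlus 1 j" for j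
    proof -
      have j: "1 < j" "j \<le> rank \<Phi>" using that \<beta>p by (auto simp: pos_roots_iff)
      have "(\<Sum>t\<in>{1..rank \<Phi>}. coef \<beta> t * coef \<gamma> t) = (\<Sum>t\<in>{1, j}. coef \<beta> t * coef \<gamma> t)"
        using j that by (intro sum.mono_neutral_right) auto
      then show ?thesis using o c1 j that by auto
    qed
    have bd: "2 \<le> root_col \<gamma>" using \<gamma> root_col_pos[of \<gamma> \<Phi>] by auto
    show "\<gamma> \<in> roots2 \<Phi> \<beta>"
    proof (cases \<beta>)
      case (Eps i)
      then have i: "\<beta> = Eps 1" "is_B \<Phi>" using \<beta> \<beta>p by (auto simp: pos_roots_iff)
      have "root_row \<gamma> \<noteq> 0"
      proof
        assume "root_row \<gamma> = 0"
        then have "\<gamma> \<in> D \<inter> row_set \<Phi> 0" "\<beta> \<in> D \<inter> row_set \<Phi> 0"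
          using \<gamma> \<beta> \<beta>p i by (auto simp: row_set_def)
        moreover have "0 \<in> {- int (rank \<Phi>) + 1..int (rank \<Phi>) - 1}" using rank by auto
        then have "card (D \<inter> row_set \<Phi> 0) \<le> 1" using D unfolding orthogonal_rook_placement_def by blast
        ultimately show False using uniq[of "D \<inter> row_set \<Phi> 0" \<gamma>] fin \<gamma>(4) by blast
      qed
      then show ?thesis
        unfolding roots2_kept[OF \<beta>p \<gamma>(2)] using i \<gamma>(2) bd
        by (cases \<gamma>) (auto simp: kept_def killed_def pos_roots_iff is_B_def)
    next
      case (EpsMinus i j)
      then have b: "i = 1" "1 < j" "j \<le> rank \<Phi>" using \<beta> \<beta>p by (auto simp: pos_roots_iff)
      have "coef \<gamma> j = 0" using g0 EpsMinus b by simp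
      then show ?thesis
        unfolding roots2_kept[OF \<beta>p \<gamma>(2)] using EpsMinus b \<gamma>(2) bd
        by (cases \<gamma>) (auto simp: kept_def killed_def pos_roots_iff mat_size_cases split: if_splits)
    next
      case (EpsPlus i j)
      then have b: "i = 1" "1 < j" "j \<le> rank \<Phi>" using \<beta> \<beta>p by (auto simp: pos_roots_iff)
      have "coef \<gamma> j = 0" using g0 EpsPlus b by simp
      then show ?thesis
        unfolding roots2_kept[OF \<beta>p \<gamma>(2)] using EpsPlus b \<gamma>(2) bd
        by (cases \<gamma>) (auto simp: kept_def killed_def pos_roots_iff mat_size_cases split: if_splits)
    qed
  qed
qed

section \<open>The subgroups as groups with prescribed support\<close>

lemma edge_pat_sym: "a < m \<Longrightarrow> b < m \<Longrightarrow> (m - 1 - b, m - 1 - a) \<in> edge_pat m \<longleftrightarrow> (a, b) \<in> edge_pat m"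
  by (auto simp: edge_pat_def)

lemma v1_pat_sym: "a < m \<Longrightarrow> b < m \<Longrightarrow> (m - 1 - b, m - 1 - a) \<in> v1_pat m K \<longleftrightarrow> (a, b) \<in> v1_pat m K"
proof -
  assume ab: "a < m" "b < m"
  have "m - 1 - (m - 1 - b) = b" using ab by linarith
  then show ?thesis using v_pat_sym[OF ab] by (auto simp: v1_pat_def simp del: One_nat_def)
qed

context
  fixes \<Phi> :: root_system and \<beta> :: root
  assumes char: "mat_size \<Phi> \<le> CHAR('a::{field,finite})" and char2: "2 < CHAR('a)" and \<beta>: "\<beta> \<in> pos_roots \<Phi>"
begin

lemma ent_v_pat:
  assumes "\<alpha> \<in> pos_roots \<Phi>"
  shows "\<alpha> \<in> roots1 \<Phi> \<beta> \<longleftrightarrow> ent \<Phi> \<alpha> \<in> v_pat (mat_size \<Phi>) (killed \<Phi> \<beta>)"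
proof -
  obtain a b where ab: "ent \<Phi> \<alpha> = (a, b)" by (cases "ent \<Phi> \<alpha>")
  then show ?thesis using roots1_iff[OF \<beta>, of \<alpha>] ent_bounds[OF assms] assms by (auto simp: v_pat_def)
qed

lemma ent_u_pat:
  assumes "\<alpha> \<in> pos_roots \<Phi>"
  shows "\<alpha> \<in> roots2 \<Phi> \<beta> \<longleftrightarrow> ent \<Phi> \<alpha> \<in> u_pat (mat_size \<Phi>) (killed \<Phi> \<beta>)"
proof -
  obtain a b where ab: "ent \<Phi> \<alpha> = (a, b)" by (cases "ent \<Phi> \<alpha>")
  then show ?thesis using roots2_iff[OF \<beta>, of \<alpha>] ent_v_pat[OF assms] by (auto simp: u_pat_def)
qed

lemma subgroups_eq:
  "U1 \<Phi> = (UG (mat_size \<Phi>) \<inter> upat (mat_size \<Phi>) (edge_pat (mat_size \<Phi>)) :: 'a mat set)"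
  "V' \<Phi> \<beta> = (UG (mat_size \<Phi>) \<inter> upat (mat_size \<Phi>) (v_pat (mat_size \<Phi>) (killed \<Phi> \<beta>)) :: 'a mat set)"
  "V1 \<Phi> \<beta> = (UG (mat_size \<Phi>) \<inter> upat (mat_size \<Phi>) (v1_pat (mat_size \<Phi>) (killed \<Phi> \<beta>)) :: 'a mat set)"
  "U_tilde \<Phi> \<beta> = (UG (mat_size \<Phi>) \<inter> upat (mat_size \<Phi>) (u_pat (mat_size \<Phi>) (killed \<Phi> \<beta>)) :: 'a mat set)"
proof -
  note r = roots2_pos[OF \<beta>]
  have e: "\<alpha> \<in> col_set \<Phi> 1 \<longleftrightarrow> ent \<Phi> \<alpha> \<in> edge_pat (mat_size \<Phi>)" if "\<alpha> \<in> pos_roots \<Phi>" for \<alpha>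
  proof -
    obtain a b where ab: "ent \<Phi> \<alpha> = (a, b)" by (cases "ent \<Phi> \<alpha>")
    then show ?thesis
      using root_col_iff[OF that] ent_bounds[OF that] that by (auto simp: edge_pat_def col_set_def)
  qed
  have v1: "\<alpha> \<in> roots1 \<Phi> \<beta> - roots2 \<Phi> \<beta> \<longleftrightarrow> ent \<Phi> \<alpha> \<in> v1_pat (mat_size \<Phi>) (killed \<Phi> \<beta>)"
    if "\<alpha> \<in> pos_roots \<Phi>" for \<alpha>
    using ent_v_pat[OF that] ent_u_pat[OF that] by (auto simp: u_pat_def v1_pat_def)
  show "U1 \<Phi> = (UG (mat_size \<Phi>) \<inter> upat (mat_size \<Phi>) (edge_pat (mat_size \<Phi>)) :: 'a mat set)"
    unfolding U1_def
    by (rule exp_span_eq[OF char char2 _ trans_edge_pat edge_pat_lower edge_pat_sym e])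
      (auto simp: col_set_def)
  show "V' \<Phi> \<beta> = (UG (mat_size \<Phi>) \<inter> upat (mat_size \<Phi>) (v_pat (mat_size \<Phi>) (killed \<Phi> \<beta>)) :: 'a mat set)"
    unfolding V'_def
    by (rule exp_span_eq[OF char char2 r(2) trans_v_pat v_pat_lower v_pat_sym ent_v_pat])
  show "V1 \<Phi> \<beta> = (UG (mat_size \<Phi>) \<inter> upat (mat_size \<Phi>) (v1_pat (mat_size \<Phi>) (killed \<Phi> \<beta>)) :: 'a mat set)"
    unfolding V1_def
    by (rule exp_span_eq[OF char char2 _ trans_v1_pat v1_pat_lower v1_pat_sym v1]) (use r in auto)
  show "U_tilde \<Phi> \<beta> = (UG (mat_size \<Phi>) \<inter> upat (mat_size \<Phi>) (u_pat (mat_size \<Phi>) (killed \<Phi> \<beta>)) :: 'a mat set)"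
    unfolding U_tilde_def
    by (rule exp_span_eq[OF char char2 r(1) trans_u_pat u_pat_lower u_pat_sym ent_u_pat])
qed

end

section \<open>From root data to the matrix form of the character formula\<close>

theorem theorem4p7:
  fixes \<Phi> :: root_system
    and \<theta> :: "'a::{field,finite} \<Rightarrow> complex"
    and \<beta> :: "nat \<Rightarrow> root" and t :: nat
    and D :: "root set" and \<xi> :: "root \<Rightarrow> 'a"
  assumes "CHAR('a) \<ge> mat_size \<Phi>"
    and "\<forall>a. \<theta> a \<noteq> 0" and "\<forall>a b. \<theta> (a + b) = \<theta> a * \<theta> b" and "\<exists>a. \<theta> a \<noteq> 1"
    and "t \<ge> 1" and "D = \<beta> ` {1..t}" and "strict_mono_on {1..t} (\<lambda>i. root_col (\<beta> i))"
    and "orthogonal_rook_placement \<Phi> D"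
    and "\<forall>\<gamma>\<in>D. \<xi> \<gamma> \<noteq> 0"
  shows "\<forall>g\<in>carrier (unip \<Phi>).
    chi \<Phi> \<theta> D \<xi> g =
      induced (unip \<Phi>) (U1V' \<Phi> (\<beta> 1))
        (\<lambda>h. psi \<Phi> \<theta> D \<xi> (proj_U1 \<Phi> (\<beta> 1) h) *
             chi_tilde \<Phi> \<theta> (\<beta> 1) D \<xi> (proj_U_tilde \<Phi> (\<beta> 1) h)) g"
proof -
  define m where "m = mat_size \<Phi>"
  define b where "b = \<beta> 1"
  define K where "K = killed \<Phi> b"
  define M where "M = kept m K"
  define \<Psi> where "\<Psi> = smaller \<Phi> b"
  define n where "n = mat_size \<Psi>"
  define \<iota> where "\<iota> = iota M"
  \<comment> \<open>The value 1 is a default that keeps c nonzero for col(beta_1) > 1, where K is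
    empty and \<open>f1\<close> is an empty sum.\<close>
  define c where "c = (if root_col b = 1 then \<xi> b else 1)"
  have Dp: "D \<subseteq> pos_roots \<Phi>" using assms(8) by (simp add: orthogonal_rook_placement_def)
  have bD: "b \<in> D" using assms(5,6) by (auto simp: b_def)
  then have bp: "b \<in> pos_roots \<Phi>" using Dp by blast
  have finD: "finite D" using Dp finite_pos_roots finite_subset by blast
  \<comment> \<open>A root position satisfies column < row and row + column + 1 < m, so m is at
    least 3; with p >= m this gives p > 2.\<close>
  have m3: "3 \<le> m" using bp ent_bounds[OF bp] by (auto simp: m_def)
  have char: "mat_size \<Phi> \<le> CHAR('a)" and char2: "2 < CHAR('a)" using assms(1) m3 by (auto simp: m_def)
  have nM: "n = card M" using mat_size_smaller[OF bp] by (simp add: n_def \<Psi>_def M_def m_def K_def)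
  have "M \<subseteq> {..<m}" by (auto simp: M_def kept_def)
  then have nm: "n \<le> m" using card_mono[of "{..<m}" M] nM by simp
  have charn: "mat_size \<Psi> \<le> CHAR('a)" using nm char by (simp add: n_def m_def)
  have col1: "root_col b = 1" if "\<not> root_col b > 1" using that root_col_pos[OF bp] by simp
  have D1: "D \<inter> col_set \<Phi> 1 = (if root_col b = 1 then {b} else {})" "D - col_set \<Phi> 1 \<subseteq> roots2 \<Phi> b"
  proof -
    have "root_col b \<le> root_col \<gamma>" if g: "\<gamma> \<in> D" for \<gamma>
    proof -
      obtain i where i: "i \<in> {1..t}" "\<gamma> = \<beta> i" using g assms(6) by blast
      then show ?thesis using strict_mono_onD[OF assms(7), of 1 i] by (cases "i = 1") (auto simp: b_def)
    qed
    then have g: "D \<inter> col_set \<Phi> 1 = {} \<and> D - col_set \<Phi> 1 \<subseteq> roots2 \<Phi> b" if "root_col b > 1"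
    proof -
      have "root_col \<gamma> > 1" if "\<gamma> \<in> D" for \<gamma> using \<open>\<And>\<gamma>. \<gamma> \<in> D \<Longrightarrow> root_col b \<le> root_col \<gamma>\<close>[OF that] \<open>root_col b > 1\<close> by simp
      moreover have "\<gamma> \<in> roots2 \<Phi> b" if "\<gamma> \<in> D" "root_col \<gamma> > 1" for \<gamma>
      proof -
        have gp: "\<gamma> \<in> pos_roots \<Phi>" using that Dp by blast
        have "killed \<Phi> b = {}" using \<open>root_col b > 1\<close> by (simp add: killed_def)
        then show ?thesis using roots2_iff[OF bp, of \<gamma>] roots1_iff[OF bp, of \<gamma>] gp that snd_ent[of \<Phi> \<gamma>] by auto
      qed
      ultimately show ?thesis by (fastforce simp: col_set_def)
    qed
    show "D \<inter> col_set \<Phi> 1 = (if root_col b = 1 then {b} else {})"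
      using g rook_roots2(1)[OF assms(8) bD] col1 by auto
    show "D - col_set \<Phi> 1 \<subseteq> roots2 \<Phi> b"
      using g rook_roots2(2)[OF assms(8) bD] col1 by blast
  qed
  have pi_bij: "bij_betw (pi_root \<Phi> b) (roots2 \<Phi> b) (pos_roots \<Psi>)"
    using bij_betw_pi_root[OF bp] by (simp add: \<Psi>_def)
  have pi_inj: "inj_on (pi_root \<Phi> b) (D - col_set \<Phi> 1)"
    using inj_on_subset[OF bij_betw_imp_inj_on[OF pi_bij] D1(2)] .
  have Dt: "D_tilde \<Phi> b D \<subseteq> pos_roots \<Psi>"
    using pi_bij D1(2) by (auto simp: D_tilde_def bij_betw_def)
  define ft where "ft = (rook_form \<Psi> (D_tilde \<Phi> b D) (xi_tilde \<Phi> b D \<xi>) :: 'a mat \<Rightarrow> 'a)"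
  have ft: "form n ft" unfolding ft_def n_def by (rule form_rook_form[OF charn char2 Dt])
  interpret S: induction_step m n \<iota> K c ft \<theta>
  proof
    show "m \<le> CHAR('a)" "2 < CHAR('a)" "n \<le> m" "2 \<le> m" using char char2 nm m3 by (auto simp: m_def)
    show "K = {} \<or> (\<exists>k. K = {k} \<and> 1 \<le> k \<and> k < m - 1)"
      using ent_bounds[OF bp] by (auto simp: K_def killed_def m_def)
    show "bij_betw \<iota> {..<n} (kept m K)"
      using bij_betw_iota[of M] by (simp add: \<iota>_def nM) (simp add: M_def)
    show "\<And>a b. a < b \<Longrightarrow> b < n \<Longrightarrow> \<iota> a < \<iota> b"
      unfolding \<iota>_def nM by (rule iota_mono) (simp_all add: M_def)
    show "\<And>a. a < n \<Longrightarrow> \<iota> (n - 1 - a) = m - 1 - \<iota> a"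
      unfolding \<iota>_def nM M_def by (rule iota_reflect)
    show "c \<noteq> 0" using assms(9) bD by (simp add: c_def)
    show "form n ft" by (rule ft)
    show "\<And>a. \<theta> a \<noteq> 0" "\<And>a b. \<theta> (a + b) = \<theta> a * \<theta> b" "\<exists>a. \<theta> a \<noteq> 1"
      using assms(2-4) by auto
  qed
  \<comment> \<open>Relabelling the roots and passing to the submatrix cancel, so the form of the
    smaller placement pulls back to the part of f outside column 1.\<close>
  have ft_tau: "ft (S.T x) = (\<Sum>\<gamma>\<in>D - col_set \<Phi> 1. \<xi> \<gamma> * x $$ ent \<Phi> \<gamma>)" if x: "x \<in> skew m" for x
  proof -
    have "ft (S.T x) = (\<Sum>\<gamma>\<in>D_tilde \<Phi> b D. xi_tilde \<Phi> b D \<xi> \<gamma> * S.T x $$ ent \<Psi> \<gamma>)"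
      using S.tau_skew[OF x] unfolding ft_def rook_form_eq[OF charn char2 Dt] by (simp add: n_def)
    also have "\<dots> = (\<Sum>\<gamma>\<in>D - col_set \<Phi> 1.
        xi_tilde \<Phi> b D \<xi> (pi_root \<Phi> b \<gamma>) * S.T x $$ ent \<Psi> (pi_root \<Phi> b \<gamma>))"
      unfolding D_tilde_def by (subst sum.reindex[OF pi_inj]) simp
    also have "\<dots> = (\<Sum>\<gamma>\<in>D - col_set \<Phi> 1. \<xi> \<gamma> * x $$ ent \<Phi> \<gamma>)"
    proof (rule sum.cong[OF HOL.refl])
      fix \<gamma> assume g: "\<gamma> \<in> D - col_set \<Phi> 1"
      then have r: "\<gamma> \<in> roots2 \<Phi> b" using D1(2) by blast
      obtain p q where pq: "ent \<Psi> (pi_root \<Phi> b \<gamma>) = (p, q)" by (cases "ent \<Psi> (pi_root \<Phi> b \<gamma>)")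
      have "ent \<Phi> \<gamma> = (\<iota> p, \<iota> q)" "p < n" "q < n"
        using ent_iota[OF bp r, of p q] pq nM by (auto simp: \<Psi>_def \<iota>_def M_def m_def K_def)
      then show "xi_tilde \<Phi> b D \<xi> (pi_root \<Phi> b \<gamma>) * S.T x $$ ent \<Psi> (pi_root \<Phi> b \<gamma>) = \<xi> \<gamma> * x $$ ent \<Phi> \<gamma>"
        using pq the_inv_into_f_f[OF pi_inj g] by (simp add: xi_tilde_def)
    qed
    finally show ?thesis .
  qed
  have f1: "S.f1 x = (\<Sum>\<gamma>\<in>D \<inter> col_set \<Phi> 1. \<xi> \<gamma> * x $$ ent \<Phi> \<gamma>)" for x
  proof (cases "root_col b = 1")
    case True
    have "ent \<Phi> b = (fst (ent \<Phi> b), 0)" using snd_ent[of \<Phi> b] True by (simp add: prod_eq_iff)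
    then show ?thesis
      using True unfolding D1(1) S.f1_def unfolding K_def killed_def c_def by simp
  next
    case False
    then show ?thesis using col1 unfolding D1(1) S.f1_def unfolding K_def killed_def by auto
  qed
  have f: "S.f = rook_form \<Phi> D \<xi>"
  proof -
    have "S.f1 x + ft (S.T x) = (\<Sum>\<gamma>\<in>D. \<xi> \<gamma> * x $$ ent \<Phi> \<gamma>)" if x: "x \<in> skew m" for x
      unfolding f1 ft_tau[OF x] using sum.Int_Diff[OF finD, of "\<lambda>\<gamma>. \<xi> \<gamma> * x $$ ent \<Phi> \<gamma>" "col_set \<Phi> 1"] by simp
    then show ?thesis
      unfolding S.f_def rook_form_eq[OF char char2 Dp] unfolding m_def by (intro restrict_ext) simp
  qed
  note sub = subgroups_eq[OF char char2 bp, folded m_def K_def]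
  note un = unip_eq[OF char char2, folded m_def]
  have ln: "mat_ln \<Phi> (mexp m x) = x" if "x \<in> skew m" for x :: "'a mat"
    using mat_ln_mexp[OF char char2] that by (simp add: m_def)
  have HU: "U1V' \<Phi> b = S.H"
    unfolding U1V'_def sub un by (rule S.set_mult_H)
  \<comment> \<open>The character to be induced, at exp z: its first factor reads
    \<open>f1 z\<close> off the component in U_1, its second depends on the submatrix alone.\<close>
  have phi: "psi \<Phi> \<theta> D \<xi> (proj_U1 \<Phi> b (mexp m z)) * chi_tilde \<Phi> \<theta> b D \<xi> (proj_U_tilde \<Phi> b (mexp m z))
      = \<theta> (S.f1 z) * orbit_sum \<theta> (orb n ft) (S.T z)" if z: "z \<in> S.h" for z
  proof -
    obtain w where w: "w \<in> skew m" "proj_U1 \<Phi> b (mexp m z) = mexp m w" "S.f w = S.f1 z"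
      using S.f_left_component[OF z] unfolding proj_U1_def sub un by blast
    obtain v where v: "v \<in> skew m" "proj_U_tilde \<Phi> b (mexp m z) = mexp m v" "S.T v = S.T z"
      using S.tau_right_component[OF z] unfolding proj_U_tilde_def sub un by auto
    have pv: "pi_lie \<Phi> b v = S.T v"
      using pi_lie_eq[OF char char2 bp, of v] v(1) S.tau_skew[OF v(1)] nm
      by (simp add: n_def m_def \<iota>_def M_def K_def \<Psi>_def)
    have ob: "rook_orbit (smaller \<Phi> b) (D_tilde \<Phi> b D) (xi_tilde \<Phi> b D \<xi>) = orb n ft"
      using rook_orbit_eq[OF charn char2] by (simp add: ft_def n_def \<Psi>_def)
    show ?thesis
      using w v by (simp add: psi_def chi_tilde_def ln ob pv f)
  qed
  show ?thesis
  proof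
    fix g :: "'a mat" assume "g \<in> carrier (unip \<Phi>)"
    then obtain y where y: "y \<in> skew m" "g = mexp m y"
      using mexp_skew[OF S.char] by (auto simp: un)
    let ?\<phi> = "\<lambda>h. psi \<Phi> \<theta> D \<xi> (proj_U1 \<Phi> b h) * chi_tilde \<Phi> \<theta> b D \<xi> (proj_U_tilde \<Phi> b h)"
    have conj: "inv\<^bsub>unip \<Phi>\<^esub> x \<otimes>\<^bsub>unip \<Phi>\<^esub> g \<otimes>\<^bsub>unip \<Phi>\<^esub> x = mexp m (sigma m x * y * x)" if "x \<in> UG m" for x
      using inv_UG[OF S.char that] sigma_UG[OF S.char that] UG_carrier[OF that] skewD(2)[OF y(1)] y(2)
        mexp_conj[of "sigma m x" m x y]
      by (simp add: un)
    \<comment> \<open>Injectivity of the exponential turns the condition that a conjugate lies in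
      \<open>H\<close> into a condition on the Lie algebra.\<close>
    have inH: "mexp m z \<in> S.H \<longleftrightarrow> z \<in> S.h" if "z \<in> skew m" for z
    proof
      assume "mexp m z \<in> S.H"
      then obtain z' where "z' \<in> S.h" "mexp m z = mexp m z'" using S.mexp_h by (metis imageE)
      then show "z \<in> S.h" using inj_onD[OF inj_on_mexp_skew[OF S.char], of z z'] that S.h_subset(1) by auto
    qed (use S.mexp_h in blast)
    have zs: "sigma m x * y * x \<in> skew m" if "x \<in> UG m" for x using conj_skew[OF S.char that y(1)] .
    let ?c = "\<lambda>x. inv\<^bsub>unip \<Phi>\<^esub> x \<otimes>\<^bsub>unip \<Phi>\<^esub> g \<otimes>\<^bsub>unip \<Phi>\<^esub> x"
    have "(\<Sum>x | x \<in> carrier (unip \<Phi>) \<and> ?c x \<in> S.H. ?\<phi> (?c x))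
        = (\<Sum>x | x \<in> UG m \<and> sigma m x * y * x \<in> S.h.
          \<theta> (S.f1 (sigma m x * y * x)) * orbit_sum \<theta> (orb n ft) (S.T (sigma m x * y * x)))"
    proof (rule sum.cong)
      show "{x. x \<in> carrier (unip \<Phi>) \<and> ?c x \<in> S.H} = {x. x \<in> UG m \<and> sigma m x * y * x \<in> S.h}"
      proof (rule Collect_cong)
        fix x :: "'a mat"
        have "x \<in> carrier (unip \<Phi>) \<longleftrightarrow> x \<in> UG m" by (simp add: un)
        then show "(x \<in> carrier (unip \<Phi>) \<and> ?c x \<in> S.H) = (x \<in> UG m \<and> sigma m x * y * x \<in> S.h)"
          using conj[of x] inH[OF zs, of x] by metis
      qed
      fix x assume x: "x \<in> {x. x \<in> UG m \<and> sigma m x * y * x \<in> S.h}"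
      then have "?c x = mexp m (sigma m x * y * x)" by (intro conj) simp
      then show "?\<phi> (?c x)
          = \<theta> (S.f1 (sigma m x * y * x)) * orbit_sum \<theta> (orb n ft) (S.T (sigma m x * y * x))"
        using phi[of "sigma m x * y * x"] x by simp
    qed
    then have "induced (unip \<Phi>) (U1V' \<Phi> b) ?\<phi> g = 1 / of_nat (card S.H) *
        (\<Sum>x | x \<in> UG m \<and> sigma m x * y * x \<in> S.h.
          \<theta> (S.f1 (sigma m x * y * x)) * orbit_sum \<theta> (orb n ft) (S.T (sigma m x * y * x)))"
      unfolding induced_def HU by (rule arg_cong)
    also have "\<dots> = orbit_sum \<theta> (orb m S.f) y" by (rule S.orbit_sum_induced[OF y(1)])
    also have "\<dots> = chi \<Phi> \<theta> D \<xi> g"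
      using rook_orbit_eq[OF char char2, of D \<xi>] y ln[OF y(1)]
      unfolding f by (simp add: chi_def orbit_char_def m_def)
    finally show "chi \<Phi> \<theta> D \<xi> g = induced (unip \<Phi>) (U1V' \<Phi> (\<beta> 1))
        (\<lambda>h. psi \<Phi> \<theta> D \<xi> (proj_U1 \<Phi> (\<beta> 1) h) * chi_tilde \<Phi> \<theta> (\<beta> 1) D \<xi> (proj_U_tilde \<Phi> (\<beta> 1) h)) g"
      by (simp add: b_def)
  qed
qed

end
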